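(* Let $(\mathcal E,\mathcal C)$ be an admissible form on $X$ of martingale dimension one, let $B\subset X$ be closed and an $(\mathcal E,\mathcal C)$-null set, let $(\mathcal E,\mathcal C)$ be complete (with respect to a fixed point $p\in X\setminus B$), and let $b\in\ker\partial_B^\ast$ be minimal energy-dominant. Let $f_1,f_2\in\mathcal D(\partial_B^\bot)$ have canonical representations $$f_i=g_i+\star_b^{-1}\partial u_i+w_i,\qquad i=1,2,$$ with $g_i\in\mathcal C$, $u_i\in\mathcal D(\Delta_B)$, $w_i\in\ker\partial^\bot$, and let $z_i:=\partial_B^\bot f_i-\star_b^{-1}\partial g_i\in\ker\partial^\bot$. Then $$\langle\partial_B^\bot f_1,f_2\rangle_{L^2(X,\nu_b)}+\langle f_1,\partial_B^\bot f_2\rangle_{L^2(X,\nu_b)}=n_B(f_1b)(g_2)+n_B(f_2b)(g_1)-n_Bb(g_1g_2)+\langle w_1,z_2\rangle_{L^2(X,\nu_b)}+\langle z_1,w_2\rangle_{L^2(X,\nu_b)} .$$ The right-hand side does not depend on the choice of the canonical representations of $f_1$ and $f_2$.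
   Context: **Admissible forms.** $(X,\varrho)$ is a locally compact separable metric space, $C_c(X)$ the space of continuous compactly supported real functions with norm $\|\cdot\|_{\sup}$. An admissible form is a pair $(\mathcal E,\mathcal C)$, $\mathcal C\subset C_c(X)$ a subalgebra, $\mathcal E:\mathcal C\times\mathcal C\to\mathbb R$ nonnegative definite symmetric bilinear, $\mathcal E(f):=\mathcal E(f,f)$, such that: (1) $\mathcal C$ is dense in $C_c(X)$; (2) $\mathcal C$ is separable for the seminorm $\mathcal E^{1/2}$; (3) $u\in\mathcal C$ implies $(u\wedge1)\vee0\in\mathcal C$ and $\mathcal E((u\wedge1)\vee0)\le\mathcal E(u)$; (4) for $f\in\mathcal C$ the functional $g\mapsto\mathcal E(fg,f)-\frac12\mathcal E(f^2,g)$ is positive on $\mathcal C$ and bounded w.r.t. $\|\cdot\|_{\sup}$; (5) $\mathcal E(f,g)=0$ whenever $g$ is constant on a neighborhood of $\operatorname{supp}f$. **First order structure.** For $f_1,f_2\in\mathcal C$, $\nu_{f_1,f_2}$ is the unique finite signed Radon measure with $\int g\,d\nu_{f_1,f_2}=\frac12\{\mathcal E(f_1g,f_2)+\mathcal E(f_1,f_2g)-\mathcal E(f_1f_2,g)\}$, $g\in\mathcal C$; $\nu_f:=\nu_{f,f}$. Put $d_uf(x,y)=f(x)-f(y)$, $\overline g(x,y)=\frac12(g(x)+g(y))$. $\mathcal H$ is the Hilbert space obtained from the span of all $\overline g\,d_uf$ ($g\in C_c(X)$, $f\in\mathcal C$) with the nonnegative definite form $\langle\overline g_1d_uf_1,\overline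 g_2d_uf_2\rangle_{\mathcal H}=\int g_1g_2\,d\nu_{f_1,f_2}$ by factoring out null elements and completing. $\partial f$ is the class of $d_uf$, $g\,\partial f$ the class of $\overline g\,d_uf$; this extends to a bounded action of $C_c(X)$ on $\mathcal H$. One has $\|\partial f\|_{\mathcal H}^2=\mathcal E(f)$ and $\partial(fg)=f\partial g+g\partial f$. For $v,w\in\mathcal H$, $\nu_{v,w}$ is the finite signed measure determined by bilinear continuous extension of $\nu_{g_1\partial f_1,g_2\partial f_2}=g_1g_2\nu_{f_1,f_2}$; $\nu_v:=\nu_{v,v}\ge0$, $\nu_{v,w}(X)=\langle v,w\rangle_{\mathcal H}$. The map $g\mapsto gv$ extends to an isometry $L^2(X,\nu_v)\to\mathcal H$. $\mathcal C$ is normed by $\|f\|_{\mathcal C}=\mathcal E(f)^{1/2}+\|f\|_{\sup}$, with dual $\mathcal C^\ast$. **Energy dominance, martingale dimension.** A $\sigma$-finite Borel measure $\nu$ is energy-dominant if $\nu_f\ll\nu$ for all $f\in\mathcal C$; minimal if moreover $\nu\ll\nu'$ for every energy-dominant $\nu'$. $v\in\mathcal H$ is minimal energy-dominant if $\nu_v$ is. A Borel set is an $(\mathcal E,\mathcal C)$-null set if it is null for some (hence all) minimal energy-dominant measures. For a minimal energy-dominant $\nu$, the pointwise index is the ($\nu$-a.e. unique) minimal Borel function $p(\cdot):X\to\mathbb N\cup\{\infty\}$ with $\operatorname{rank}\big(\frac{d\nu_{f_i,f_j}}{d\nu}(x)\big)_{i,j=1}^N\le p(x)$ for $\nu$-a.e.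 $x$, for all $N$ and $f_1,\dots,f_N\in\mathcal C$. The martingale dimension is $\nu\text{-}\operatorname{ess\,sup}p(\cdot)$ (independent of $\nu$). **Duality and operators.** If the martingale dimension is one and $b$ is minimal energy-dominant, $\star_b:L^2(X,\nu_b)\to\mathcal H$, $\star_bg:=gb$, is an isometric isomorphism. $\mathcal C_B:=\{f\in\mathcal C:f|_B\equiv0\}$, $\partial_B:=\partial|_{\mathcal C_B}$. For $v\in\mathcal H$, $v\in\ker\partial_B^\ast$ (resp. $v\in\ker\partial^\ast$) means $\langle v,\partial\varphi\rangle_{\mathcal H}=0$ for all $\varphi\in\mathcal C_B$ (resp. $\varphi\in\mathcal C$). $(\partial^\ast,\mathcal D(\partial^\ast))$ and $(\partial_B^\ast,\mathcal D(\partial_B^\ast))$ are the adjoints (from $\mathcal H$ to $L^2(X,\nu_b)$) of the densely defined operators $(\partial,\mathcal C)$, $(\partial_B,\mathcal C_B)$ from $L^2(X,\nu_b)$ to $\mathcal H$. $\mathcal D(\partial^\bot):=\star_b^{-1}\mathcal D(\partial^\ast)$, $\partial^\bot f:=-\partial^\ast\star_bf$; $\mathcal D(\partial_B^\bot):=\star_b^{-1}\mathcal D(\partial_B^\ast)$, $\partial_B^\bot f:=-\partial_B^\ast\star_bf$. **Completeness.** The form is complete with respect to $p\in X\setminus B$ if $\mathbf 1\in\mathcal C$, $\ker\partial=\mathbb R$ (constants), $\mathcal C_p:=\{f\in\mathcal C:f(p)=0\}$ is a Hilbert space with scalar product $\mathcal E$, and $\|f\|_{\sup}\le c_p\mathcal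 E(f)^{1/2}$ for $f\in\mathcal C_p$ with some $c_p>0$. Then $X$ is compact and $\mathcal H=\partial(\mathcal C)\oplus\ker\partial^\ast$ orthogonally. **Laplacian, normal parts, Neumann problem** (with $\nu=\nu_b$). $u\in\mathcal C$ is in $\mathcal D(\Delta_B)$ with $\Delta_Bu=f\in L^2(X,\nu)$ if $\mathcal E(u,\varphi)=-\int_Xf\varphi\,d\nu$ for all $\varphi\in\mathcal C_B$. For $B\ne\emptyset$ and $v\in\mathcal D(\partial_B^\ast)$ the normal part $n_Bv\in\mathcal C^\ast$ is $n_Bv(\varphi):=\langle v,\partial\varphi\rangle_{\mathcal H}-\int_X(\partial_B^\ast v)\varphi\,d\nu$, $\varphi\in\mathcal C$; for $B=\emptyset$, $n_Bv:=0$. $(du)_B:=n_B\partial u$ for $u\in\mathcal D(\Delta_B)$. For $f\in L^2(X,\nu)$ and $G\in\mathcal C^\ast$ vanishing on $\mathcal C_B$, $u\in\mathcal C$ is a weak solution of $\Delta_Bu=f$ on $X\setminus B$, $(du)_B=G$ on $B$, if $\mathcal E(u,\varphi)=G(\varphi)-\int_Xf\varphi\,d\nu$ for all $\varphi\in\mathcal C$ (for $B=\emptyset$: the Poisson equation $\Delta u=f$, $G=0$). **Canonical representation** of $f\in\mathcal D(\partial_B^\bot)$: $f=g+\star_b^{-1}\partial u+w$ with $g\in\mathcal C$ such that $z:=\partial_B^\bot f-\star_b^{-1}\partial g\in\ker\partial^\bot$, $w\in\ker\partial^\bot$, and $u$ a weak solution of $\Delta_Bu=z$ on $X\setminus B$,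 $(du)_B=n_B(fb)-n_Bb(g\,\cdot)$ on $B$, where $n_Bb(g\,\cdot)$ is $\varphi\mapsto n_Bb(g\varphi)$. Every $f\in\mathcal D(\partial_B^\bot)$ has one; any two are related by $\widetilde g=g+c$, $\partial\widetilde u=\partial u-c\,\partial h$, $\widetilde w=w-c\star_b^{-1}v$ with $c\in\mathbb R$, where $b=\partial h+v$, $h\in\mathcal C$, $v\in\ker\partial^\ast$. *)

theory Defs
  imports
    "HOL-Analysis.Analysis"
    "HOL-Probability.Essential_Supremum"
    "Jordan_Normal_Form.DL_Rank"
begin

section \<open>Admissible forms\<close>

definition tsupp :: "('a::topological_space \<Rightarrow> real) \<Rightarrow> 'a set" where
  "tsupp f = closure {x. f x \<noteq> 0}"

definition Cc :: "('a::topological_space \<Rightarrow> real) set" where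
  "Cc = {f. continuous_on UNIV f \<and> compact (tsupp f)}"

definition sup_norm :: "('a \<Rightarrow> real) \<Rightarrow> real" where
  "sup_norm f = (SUP x. \<bar>f x\<bar>)"

text \<open>A form is a function on all pairs of functions, of which only the values on \<open>C\<close> matter.\<close>

definition admissible_form ::
  "(('a::topological_space \<Rightarrow> real) \<Rightarrow> ('a \<Rightarrow> real) \<Rightarrow> real) \<Rightarrow> ('a \<Rightarrow> real) set \<Rightarrow> bool" where
  "admissible_form E C \<longleftrightarrow>
    \<comment> \<open>\<open>C\<close> is a subalgebra of \<open>Cc\<close>\<close>
    C \<subseteq> Cc \<and> (\<lambda>x. 0) \<in> C \<and>
    (\<forall>f\<in>C. \<forall>g\<in>C. (\<lambda>x. f x + g x) \<in> C \<and> (\<lambda>x. f x * g x) \<in> C) \<and>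
    (\<forall>f\<in>C. \<forall>c. (\<lambda>x. c * f x) \<in> C) \<and>
    \<comment> \<open>\<open>E\<close> is bilinear, symmetric and nonnegative definite on \<open>C\<close>\<close>
    (\<forall>f\<in>C. \<forall>g\<in>C. \<forall>h\<in>C. E (\<lambda>x. f x + g x) h = E f h + E g h) \<and>
    (\<forall>f\<in>C. \<forall>h\<in>C. \<forall>c. E (\<lambda>x. c * f x) h = c * E f h) \<and>
    (\<forall>f\<in>C. \<forall>g\<in>C. E f g = E g f) \<and>
    (\<forall>f\<in>C. E f f \<ge> 0) \<and>
    \<comment> \<open>(1) density in the supremum norm\<close>
    (\<forall>f\<in>Cc. \<forall>\<epsilon>>0. \<exists>g\<in>C. sup_norm (\<lambda>x. f x - g x) < \<epsilon>) \<and>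
    \<comment> \<open>(2) separability for the energy seminorm\<close>
    (\<exists>D. countable D \<and> D \<subseteq> C \<and>
       (\<forall>f\<in>C. \<forall>\<epsilon>>0. \<exists>d\<in>D. sqrt (E (\<lambda>x. f x - d x) (\<lambda>x. f x - d x)) < \<epsilon>)) \<and>
    \<comment> \<open>(3) Markov property\<close>
    (\<forall>u\<in>C. (\<lambda>x. max (min (u x) 1) 0) \<in> C \<and>
       E (\<lambda>x. max (min (u x) 1) 0) (\<lambda>x. max (min (u x) 1) 0) \<le> E u u) \<and>
    \<comment> \<open>(4) the energy functionals are positive and bounded\<close>
    (\<forall>f\<in>C. (\<forall>g\<in>C. (\<forall>x. g x \<ge> 0) \<longrightarrow>
                 E (\<lambda>x. f x * g x) f - E (\<lambda>x. f x * f x) g / 2 \<ge> 0) \<and>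
       (\<exists>K. \<forall>g\<in>C. \<bar>E (\<lambda>x. f x * g x) f - E (\<lambda>x. f x * f x) g / 2\<bar> \<le> K * sup_norm g)) \<and>
    \<comment> \<open>(5) strong locality\<close>
    (\<forall>f\<in>C. \<forall>g\<in>C. (\<exists>U c. open U \<and> tsupp f \<subseteq> U \<and> (\<forall>x\<in>U. g x = c)) \<longrightarrow> E f g = 0)"


section \<open>Finite signed measures\<close>

text \<open>
  A finite signed Borel measure is represented by its set function; values on non-Borel sets
  are irrelevant. On a locally compact separable metric space every finite Borel measure is a
  Radon measure.
\<close>

definition decomposes :: "'a::topological_space measure \<Rightarrow> 'a measure \<Rightarrow> ('a set \<Rightarrow> real) \<Rightarrow> bool" where
  "decomposes M N \<mu> \<longleftrightarrow>
     finite_measure M \<and> sets M = sets borel \<and> finite_measure N \<and> sets N = sets borel \<and>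
     (\<forall>A\<in>sets borel. \<mu> A = measure M A - measure N A)"

definition finite_signed_measure :: "('a::topological_space set \<Rightarrow> real) \<Rightarrow> bool" where
  "finite_signed_measure \<mu> \<longleftrightarrow> (\<exists>M N. decomposes M N \<mu>)"

text \<open>The integral of a bounded Borel function; it does not depend on the decomposition.\<close>

definition signed_integral :: "('a::topological_space set \<Rightarrow> real) \<Rightarrow> ('a \<Rightarrow> real) \<Rightarrow> real" where
  "signed_integral \<mu> g =
     (THE c. \<exists>M N. decomposes M N \<mu> \<and> c = (\<integral>x. g x \<partial>M) - (\<integral>x. g x \<partial>N))"

definition to_measure :: "('a::topological_space set \<Rightarrow> real) \<Rightarrow> 'a measure" where
  "to_measure \<mu> = measure_of UNIV (sets borel) (\<lambda>A. ennreal (\<mu> A))"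

definition signed_RN_deriv :: "'a::topological_space measure \<Rightarrow> ('a set \<Rightarrow> real) \<Rightarrow> 'a \<Rightarrow> real" where
  "signed_RN_deriv \<nu> \<mu> =
     (SOME \<rho>. integrable \<nu> \<rho> \<and> (\<forall>A\<in>sets borel. \<mu> A = (\<integral>x. indicator A x * \<rho> x \<partial>\<nu>)))"


section \<open>First order structure\<close>

text \<open>
  The type \<open>'h\<close> plays the role of the Hilbert space of the first order structure, which is
  determined only up to isometric isomorphism: \<open>cls F\<close> is the class of the function \<open>F\<close> on
  \<open>X \<times> X\<close>. The set functions \<open>emeas f\<^sub>1 f\<^sub>2\<close> and \<open>hmeas v w\<close> are the signed energy measures of
  functions \<open>f\<^sub>1\<close>, \<open>f\<^sub>2\<close> in \<open>core\<close> and of elements \<open>v\<close>, \<open>w\<close> of \<open>'h\<close>. These three components are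
  determined by \<open>form\<close> and \<open>core\<close> (\<open>cls\<close> up to isometric isomorphism) through the predicate
  \<open>first_order_structure\<close> below.
\<close>

record ('a, 'h) form_data =
  form :: "('a \<Rightarrow> real) \<Rightarrow> ('a \<Rightarrow> real) \<Rightarrow> real"
  core :: "('a \<Rightarrow> real) set"
  emeas :: "('a \<Rightarrow> real) \<Rightarrow> ('a \<Rightarrow> real) \<Rightarrow> 'a set \<Rightarrow> real"
  cls :: "('a \<times> 'a \<Rightarrow> real) \<Rightarrow> 'h"
  hmeas :: "'h \<Rightarrow> 'h \<Rightarrow> 'a set \<Rightarrow> real"

definition d_u :: "('a \<Rightarrow> real) \<Rightarrow> 'a \<times> 'a \<Rightarrow> real" where
  "d_u f = (\<lambda>(x, y). f x - f y)"

definition avg :: "('a \<Rightarrow> real) \<Rightarrow> 'a \<times> 'a \<Rightarrow> real" where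
  "avg g = (\<lambda>(x, y). (g x + g y) / 2)"

text \<open>The linear span of all \<open>avg g * d_u f\<close>; scalars can be absorbed into \<open>g\<close>.\<close>

definition simple_fields :: "('a::topological_space, 'h) form_data \<Rightarrow> ('a \<times> 'a \<Rightarrow> real) set" where
  "simple_fields S =
     {F. \<exists>(n::nat) g f. (\<forall>i<n. g i \<in> Cc \<and> f i \<in> core S) \<and>
                        F = (\<lambda>z. \<Sum>i<n. avg (g i) z * d_u (f i) z)}"

definition fld :: "('a, 'h) form_data \<Rightarrow> ('a \<Rightarrow> real) \<Rightarrow> ('a \<Rightarrow> real) \<Rightarrow> 'h" where
  "fld S g f = cls S (\<lambda>z. avg g z * d_u f z)"

text \<open>
  If the constants belong to \<open>core S\<close>, as they do for complete forms, then \<open>d_u f\<close> is itself in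
  \<open>simple_fields S\<close>.
\<close>

definition partial :: "('a, 'h) form_data \<Rightarrow> ('a \<Rightarrow> real) \<Rightarrow> 'h" where
  "partial S f = cls S (d_u f)"

definition energy_measures :: "('a::topological_space, 'h) form_data \<Rightarrow> bool" where
  "energy_measures S \<longleftrightarrow>
     (\<forall>f1\<in>core S. \<forall>f2\<in>core S. finite_signed_measure (emeas S f1 f2) \<and>
        (\<forall>g\<in>core S. signed_integral (emeas S f1 f2) g =
           (form S (\<lambda>x. f1 x * g x) f2 + form S f1 (\<lambda>x. f2 x * g x)
              - form S (\<lambda>x. f1 x * f2 x) g) / 2))"

text \<open>
  \<open>cls\<close> exhibits \<open>'h\<close> as the completion of \<open>simple_fields\<close> modulo null elements: it is linear,
  carries the semi-inner product to \<open>inner\<close>, and has dense range in the Hilbert space \<open>'h\<close>.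
\<close>

definition hilbert_completion ::
  "('a::topological_space, 'h::{real_inner,complete_space}) form_data \<Rightarrow> bool" where
  "hilbert_completion S \<longleftrightarrow>
     (\<forall>F\<in>simple_fields S. \<forall>G\<in>simple_fields S. cls S (\<lambda>z. F z + G z) = cls S F + cls S G) \<and>
     (\<forall>F\<in>simple_fields S. \<forall>c. cls S (\<lambda>z. c * F z) = c *\<^sub>R cls S F) \<and>
     (\<forall>g1\<in>Cc. \<forall>g2\<in>Cc. \<forall>f1\<in>core S. \<forall>f2\<in>core S.
        inner (fld S g1 f1) (fld S g2 f2) = signed_integral (emeas S f1 f2) (\<lambda>x. g1 x * g2 x)) \<and>
     closure (cls S ` simple_fields S) = UNIV"

text \<open>
  By density, the continuous bilinear map \<open>(v, w) \<mapsto> hmeas S v w A\<close> is determined by its values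
  on the fields \<open>fld S g f\<close>.
\<close>

definition field_measures ::
  "('a::topological_space, 'h::{real_inner,complete_space}) form_data \<Rightarrow> bool" where
  "field_measures S \<longleftrightarrow>
     (\<forall>v w. finite_signed_measure (hmeas S v w)) \<and>
     (\<forall>A\<in>sets borel. bounded_bilinear (\<lambda>v w. hmeas S v w A)) \<and>
     (\<forall>g1\<in>Cc. \<forall>g2\<in>Cc. \<forall>f1\<in>core S. \<forall>f2\<in>core S. \<forall>A\<in>sets borel.
        hmeas S (fld S g1 f1) (fld S g2 f2) A =
          signed_integral (emeas S f1 f2) (\<lambda>x. indicator A x * (g1 x * g2 x)))"

definition first_order_structure ::
  "('a::topological_space, 'h::{real_inner,complete_space}) form_data \<Rightarrow> bool" where
  "first_order_structure S \<longleftrightarrow>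
     admissible_form (form S) (core S) \<and> energy_measures S \<and> hilbert_completion S \<and>
     field_measures S"

definition vmeas :: "('a::topological_space, 'h) form_data \<Rightarrow> 'h \<Rightarrow> 'a measure" where
  "vmeas S v = to_measure (hmeas S v v)"


section \<open>Multiplication of fields by functions\<close>

definition cc_mult ::
  "('a::topological_space, 'h::{real_inner,complete_space}) form_data \<Rightarrow> ('a \<Rightarrow> real) \<Rightarrow> 'h \<Rightarrow> 'h" where
  "cc_mult S g = (THE T. bounded_linear T \<and>
     (\<forall>h\<in>Cc. \<forall>f\<in>core S. T (fld S h f) = fld S (\<lambda>x. g x * h x) f))"

text \<open>Elements of \<open>L\<^sup>2\<close> are represented by functions, identified up to almost everywhere equality.\<close>

definition L2 :: "'a measure \<Rightarrow> ('a \<Rightarrow> real) set" where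
  "L2 M = {f \<in> borel_measurable M. integrable M (\<lambda>x. (f x)\<^sup>2)}"

definition l2_inner :: "'a measure \<Rightarrow> ('a \<Rightarrow> real) \<Rightarrow> ('a \<Rightarrow> real) \<Rightarrow> real" where
  "l2_inner M f g = (\<integral>x. f x * g x \<partial>M)"

text \<open>\<open>g v\<close> for \<open>g \<in> L\<^sup>2(X, \<nu>\<^sub>v)\<close>, extending the action of \<open>Cc\<close> by continuity.\<close>

definition l2_mult ::
  "('a::topological_space, 'h::{real_inner,complete_space}) form_data \<Rightarrow> ('a \<Rightarrow> real) \<Rightarrow> 'h \<Rightarrow> 'h" where
  "l2_mult S g v = (THE w. \<exists>h. (\<forall>n. h n \<in> Cc) \<and>
     (\<lambda>n. \<integral>x. (h n x - g x)\<^sup>2 \<partial>(vmeas S v)) \<longlonglongrightarrow> 0 \<and>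
     (\<lambda>n. cc_mult S (h n) v) \<longlonglongrightarrow> w)"


section \<open>Energy dominance and martingale dimension\<close>

definition energy_dominant :: "('a::topological_space, 'h) form_data \<Rightarrow> 'a measure \<Rightarrow> bool" where
  "energy_dominant S \<nu> \<longleftrightarrow> sets \<nu> = sets borel \<and> sigma_finite_measure \<nu> \<and>
     (\<forall>f\<in>core S. absolutely_continuous \<nu> (to_measure (emeas S f f)))"

definition minimal_energy_dominant ::
  "('a::topological_space, 'h) form_data \<Rightarrow> 'a measure \<Rightarrow> bool" where
  "minimal_energy_dominant S \<nu> \<longleftrightarrow> energy_dominant S \<nu> \<and>
     (\<forall>\<nu>'. energy_dominant S \<nu>' \<longrightarrow> absolutely_continuous \<nu>' \<nu>)"

definition form_null_set :: "('a::topological_space, 'h) form_data \<Rightarrow> 'a set \<Rightarrow> bool" where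
  "form_null_set S A \<longleftrightarrow> (\<exists>\<nu>. minimal_energy_dominant S \<nu> \<and> A \<in> null_sets \<nu>)"

definition index_bound ::
  "('a::topological_space, 'h) form_data \<Rightarrow> 'a measure \<Rightarrow> ('a \<Rightarrow> enat) \<Rightarrow> bool" where
  "index_bound S \<nu> p \<longleftrightarrow> p \<in> borel \<rightarrow>\<^sub>M count_space UNIV \<and>
     (\<forall>N f. (\<forall>i<N. f i \<in> core S) \<longrightarrow>
        (AE x in \<nu>. enat (vec_space.rank N
            (mat N N (\<lambda>(i, j). signed_RN_deriv \<nu> (emeas S (f i) (f j)) x))) \<le> p x))"

definition pointwise_index ::
  "('a::topological_space, 'h) form_data \<Rightarrow> 'a measure \<Rightarrow> ('a \<Rightarrow> enat) \<Rightarrow> bool" where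
  "pointwise_index S \<nu> p \<longleftrightarrow> index_bound S \<nu> p \<and>
     (\<forall>q. index_bound S \<nu> q \<longrightarrow> (AE x in \<nu>. p x \<le> q x))"

definition has_martingale_dimension ::
  "('a::topological_space, 'h) form_data \<Rightarrow> enat \<Rightarrow> bool" where
  "has_martingale_dimension S d \<longleftrightarrow>
     (\<exists>\<nu> p. minimal_energy_dominant S \<nu> \<and> pointwise_index S \<nu> p \<and>
        esssup \<nu> (\<lambda>x. ennreal_of_enat (p x)) = ennreal_of_enat d)"


section \<open>Duality and the operators\<close>

definition star ::
  "('a::topological_space, 'h::{real_inner,complete_space}) form_data \<Rightarrow> 'h \<Rightarrow> ('a \<Rightarrow> real) \<Rightarrow> 'h" where
  "star S b g = l2_mult S g b"

definition star_inv ::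
  "('a::topological_space, 'h::{real_inner,complete_space}) form_data \<Rightarrow> 'h \<Rightarrow> 'h \<Rightarrow> 'a \<Rightarrow> real" where
  "star_inv S b v = (SOME g. g \<in> L2 (vmeas S b) \<and> star S b g = v)"

definition core_off :: "('a, 'h) form_data \<Rightarrow> 'a set \<Rightarrow> ('a \<Rightarrow> real) set" where
  "core_off S B = {f \<in> core S. \<forall>x\<in>B. f x = 0}"

text \<open>
  In the following the set \<open>B\<close> is the argument of the operators with boundary; since
  \<open>core_off S {} = core S\<close>, the operators without boundary are those for \<open>B = {}\<close>.
\<close>

definition ker_adj :: "('a, 'h::real_inner) form_data \<Rightarrow> 'a set \<Rightarrow> 'h set" where
  "ker_adj S B = {v. \<forall>\<phi>\<in>core_off S B. inner v (partial S \<phi>) = 0}"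

definition is_adj ::
  "('a::topological_space, 'h::real_inner) form_data \<Rightarrow> 'h \<Rightarrow> 'a set \<Rightarrow> 'h \<Rightarrow> ('a \<Rightarrow> real) \<Rightarrow> bool" where
  "is_adj S b B v \<psi> \<longleftrightarrow> \<psi> \<in> L2 (vmeas S b) \<and>
     (\<forall>\<phi>\<in>core_off S B. inner v (partial S \<phi>) = l2_inner (vmeas S b) \<psi> \<phi>)"

definition adj_dom ::
  "('a::topological_space, 'h::real_inner) form_data \<Rightarrow> 'h \<Rightarrow> 'a set \<Rightarrow> 'h set" where
  "adj_dom S b B = {v. \<exists>\<psi>. is_adj S b B v \<psi>}"

definition adj ::
  "('a::topological_space, 'h::real_inner) form_data \<Rightarrow> 'h \<Rightarrow> 'a set \<Rightarrow> 'h \<Rightarrow> 'a \<Rightarrow> real" where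
  "adj S b B v = (SOME \<psi>. is_adj S b B v \<psi>)"

definition perp_dom ::
  "('a::topological_space, 'h::{real_inner,complete_space}) form_data \<Rightarrow> 'h \<Rightarrow> 'a set \<Rightarrow> ('a \<Rightarrow> real) set" where
  "perp_dom S b B = {f \<in> L2 (vmeas S b). star S b f \<in> adj_dom S b B}"

definition perp ::
  "('a::topological_space, 'h::{real_inner,complete_space}) form_data \<Rightarrow> 'h \<Rightarrow> 'a set \<Rightarrow> ('a \<Rightarrow> real) \<Rightarrow> 'a \<Rightarrow> real" where
  "perp S b B f = (\<lambda>x. - adj S b B (star S b f) x)"

definition ker_perp ::
  "('a::topological_space, 'h::{real_inner,complete_space}) form_data \<Rightarrow> 'h \<Rightarrow> ('a \<Rightarrow> real) set" where
  "ker_perp S b = {f \<in> perp_dom S b {}. AE x in vmeas S b. perp S b {} f x = 0}"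


section \<open>Completeness\<close>

definition complete_form :: "('a::topological_space, 'h::zero) form_data \<Rightarrow> 'a \<Rightarrow> bool" where
  "complete_form S p \<longleftrightarrow>
     (\<lambda>x. 1) \<in> core S \<and>
     {f \<in> core S. partial S f = 0} = range (\<lambda>c x. c) \<and>
     \<comment> \<open>\<open>core_off S {p}\<close> is a Hilbert space with scalar product \<open>form S\<close>\<close>
     (\<forall>f\<in>core_off S {p}. form S f f = 0 \<longrightarrow> f = (\<lambda>x. 0)) \<and>
     (\<forall>F. (\<forall>n. F n \<in> core_off S {p}) \<and>
          (\<forall>\<epsilon>>0. \<exists>N. \<forall>m\<ge>N. \<forall>n\<ge>N.
             sqrt (form S (\<lambda>x. F m x - F n x) (\<lambda>x. F m x - F n x)) < \<epsilon>) \<longrightarrow>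
        (\<exists>f\<in>core_off S {p}.
           (\<lambda>n::nat. sqrt (form S (\<lambda>x. F n x - f x) (\<lambda>x. F n x - f x))) \<longlonglongrightarrow> 0)) \<and>
     (\<exists>c>0. \<forall>f\<in>core_off S {p}. sup_norm f \<le> c * sqrt (form S f f))"


section \<open>Laplacian, normal parts and canonical representations\<close>

definition dom_laplacian ::
  "('a::topological_space, 'h) form_data \<Rightarrow> 'h \<Rightarrow> 'a set \<Rightarrow> ('a \<Rightarrow> real) set" where
  "dom_laplacian S b B = {u \<in> core S. \<exists>f\<in>L2 (vmeas S b).
     \<forall>\<phi>\<in>core_off S B. form S u \<phi> = - l2_inner (vmeas S b) f \<phi>}"

definition normal_part ::
  "('a::topological_space, 'h::real_inner) form_data \<Rightarrow> 'h \<Rightarrow> 'a set \<Rightarrow> 'h \<Rightarrow> ('a \<Rightarrow> real) \<Rightarrow> real" where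
  "normal_part S b B v \<phi> = (if B = {} then 0
     else inner v (partial S \<phi>) - l2_inner (vmeas S b) (adj S b B v) \<phi>)"

text \<open>
  Weak solutions of \<open>\<Delta>\<^sub>B u = f\<close> on \<open>X - B\<close>, \<open>(du)\<^sub>B = G\<close> on \<open>B\<close>, for \<open>f\<close> in \<open>L\<^sup>2\<close> and a
  functional \<open>G\<close> on \<open>core S\<close> that is bounded and vanishes on \<open>core_off S B\<close>; differences of
  normal parts have these properties. The set \<open>B\<close> enters only through \<open>G\<close>.
\<close>

definition weak_solution ::
  "('a::topological_space, 'h) form_data \<Rightarrow> 'h \<Rightarrow> ('a \<Rightarrow> real) \<Rightarrow> ('a \<Rightarrow> real) \<Rightarrow>
     (('a \<Rightarrow> real) \<Rightarrow> real) \<Rightarrow> bool" where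
  "weak_solution S b u f G \<longleftrightarrow> u \<in> core S \<and>
     (\<forall>\<phi>\<in>core S. form S u \<phi> = G \<phi> - l2_inner (vmeas S b) f \<phi>)"

definition z_part ::
  "('a::topological_space, 'h::{real_inner,complete_space}) form_data \<Rightarrow> 'h \<Rightarrow> 'a set \<Rightarrow>
     ('a \<Rightarrow> real) \<Rightarrow> ('a \<Rightarrow> real) \<Rightarrow> 'a \<Rightarrow> real" where
  "z_part S b B f g = (\<lambda>x. perp S b B f x - star_inv S b (partial S g) x)"

definition canonical_rep ::
  "('a::topological_space, 'h::{real_inner,complete_space}) form_data \<Rightarrow> 'h \<Rightarrow> 'a set \<Rightarrow>
     ('a \<Rightarrow> real) \<Rightarrow> ('a \<Rightarrow> real) \<Rightarrow> ('a \<Rightarrow> real) \<Rightarrow> ('a \<Rightarrow> real) \<Rightarrow> bool" where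
  "canonical_rep S b B f g u w \<longleftrightarrow>
     g \<in> core S \<and> u \<in> dom_laplacian S b B \<and> w \<in> ker_perp S b \<and>
     (AE x in vmeas S b. f x = g x + star_inv S b (partial S u) x + w x) \<and>
     z_part S b B f g \<in> ker_perp S b \<and>
     weak_solution S b u (z_part S b B f g)
       (\<lambda>\<phi>. normal_part S b B (star S b f) \<phi> - normal_part S b B b (\<lambda>x. g x * \<phi> x))"

text \<open>The right-hand side of the integration by parts formula.\<close>

definition boundary_terms ::
  "('a::topological_space, 'h::{real_inner,complete_space}) form_data \<Rightarrow> 'h \<Rightarrow> 'a set \<Rightarrow>
     ('a \<Rightarrow> real) \<Rightarrow> ('a \<Rightarrow> real) \<Rightarrow> ('a \<Rightarrow> real) \<Rightarrow>
     ('a \<Rightarrow> real) \<Rightarrow> ('a \<Rightarrow> real) \<Rightarrow> ('a \<Rightarrow> real) \<Rightarrow> real" where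
  "boundary_terms S b B f1 g1 w1 f2 g2 w2 =
     normal_part S b B (star S b f1) g2 + normal_part S b B (star S b f2) g1
     - normal_part S b B b (\<lambda>x. g1 x * g2 x)
     + l2_inner (vmeas S b) w1 (z_part S b B f2 g2)
     + l2_inner (vmeas S b) (z_part S b B f1 g1) w2"

end

theory Submission
  imports Defs
begin

text \<open>
  Write \<open>\<partial>\<^sub>B\<^sup>\<bottom> f\<^sub>i = z\<^sub>i + \<star>\<^sub>b\<^sup>-\<^sup>1 \<partial>g\<^sub>i\<close> and expand both scalar products with the canonical representations.
  The terms pairing \<open>z\<^sub>i\<close> or \<open>w\<^sub>i\<close> with a gradient vanish, the energies of \<open>g\<^sub>i\<close> and \<open>u\<^sub>j\<close> are given
  by the weak formulation of the Neumann problem for \<open>u\<^sub>j\<close>, and the remaining pairings of \<open>g\<^sub>j \<partial>g\<^sub>i\<close>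
  with \<open>b\<close> add up to the pairing of \<open>\<partial>(g\<^sub>1g\<^sub>2)\<close> with \<open>b\<close> by the Leibniz rule. The latter is
  the normal part of \<open>b\<close> at \<open>g\<^sub>1g\<^sub>2\<close>, because \<open>B\<close> is a null set and hence \<open>\<partial>\<^sub>B\<^sup>* b = 0\<close> almost everywhere.

  All this needs that \<open>\<star>\<^sub>b\<close> is an isometry whose range contains every gradient. The range
  statement is where martingale dimension one enters: all two by two minors of the densities
  of energy measures vanish almost everywhere, so the squared distance of \<open>\<partial>u\<close> to \<open>h b\<close> is the
  integral of \<open>(h - r)\<^sup>2\<close> against the energy measure of \<open>b\<close>, where \<open>r\<close> is the density of the
  mutual energy measure of \<open>b\<close> and \<open>u\<close> with respect to that of \<open>b\<close>; continuous functions \<open>h\<close>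
  are dense in \<open>L\<^sup>2\<close>.
\<close>

text \<open>The Hilbert space is given only as the closure of the image of \<open>cls\<close>, and
  \<open>hmeas\<close> only as a bounded bilinear map for each Borel set separately. Hence
  positivity, symmetry, total mass and the action of functions on fields are all verified on the
  fields \<open>fld S g f\<close> or their finite sums and carried over by density. Measures are
  compared through integrals of squares \<open>h^2\<close> of continuous functions, because such an
  integral for a finite sum of fields is a squared norm. Multiplication operators are obtained by
  duality, as the vectors that represent the functionals given by \<open>hint\<close>.

  \<open>star\<close>, \<open>star_inv\<close> and \<open>adj\<close> are picked by definite or
  indefinite description and acquire meaning only through existence and uniqueness results. The
  chosen value of \<open>adj\<close> is pinned down by its products with functions that vanish on
  \<open>B\<close>, which is the obstacle in evaluating the normal part of \<open>b\<close> on
  functions that do not vanish there.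

  Independence of the representations is read off from the formula, whose left-hand side does not
  mention them.\<close>

text \<open>The discriminant criterion with \<open>c = 0\<close> included: there the polynomial is
  affine, hence constant, and a negative \<open>c\<close> is impossible. It feeds both
  Cauchy-Schwarz inequalities below, where the form is only semidefinite.\<close>

lemma quadratic_nonneg_imp:
  fixes a b c :: real
  assumes q: "\<And>t. a + 2 * t * b + t\<^sup>2 * c \<ge> 0"
  shows "b\<^sup>2 \<le> a * c"
proof (cases "c = 0")
  case True
  have "b = 0"
  proof (rule ccontr)
    assume "b \<noteq> 0"
    \<comment> \<open>At this point the affine function takes the value -1.\<close>
    with q[of "- (a + 1) / (2 * b)"] True show False by (simp add: field_simps)
  qed
  then show ?thesis using True by simp
next
  case False
  have "c > 0"
  proof (rule ccontr)
    assume "\<not> c > 0"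
    with False have c: "c < 0" by simp
    have a: "a \<ge> 0" using q[of 0] by simp
    \<comment> \<open>\<open>t\<close> is so large that \<open>t * c\<close> outweighs
      \<open>2 * |b| + a + 1\<close>; the final \<open>+ 1\<close> gives \<open>t >= 1\<close>, so
      that multiplying a negative number by \<open>t\<close> does not increase it.\<close>
    define t where "t = (2 * \<bar>b\<bar> + a + 1) / (- c) + 1"
    have "(2 * \<bar>b\<bar> + a + 1) / (- c) \<ge> 0" using c a by (intro divide_nonneg_pos) auto
    then have t1: "t \<ge> 1" by (simp add: t_def)
    have tc: "t * c = - (2 * \<bar>b\<bar> + a + 1) + c" using c by (simp add: t_def field_simps)
    have "2 * t * b + t\<^sup>2 * c = t * (2 * b + t * c)"
      by (simp add: power2_eq_square algebra_simps)
    also have "\<dots> = t * (2 * b - (2 * \<bar>b\<bar> + a + 1) + c)" unfolding tc by simp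
    also have "\<dots> \<le> t * (- (a + 1))" using t1 c by (intro mult_left_mono) auto
    also have "\<dots> \<le> 1 * (- (a + 1))" using t1 a by (intro mult_right_mono_neg) auto
    finally show False using q[of t] by simp
  qed
  then show ?thesis using q[of "- b / c"]
    by (simp add: field_simps power2_eq_square)
qed

section \<open>Finite Borel measures on metric spaces\<close>

text \<open>The sets with this property form a sigma-algebra, complements exchanging the roles of
  the closed and the open set. Closed sets belong to it because in a metric space they are
  decreasing intersections of open neighbourhoods.\<close>

lemma closed_open_regular:
  fixes M :: "'a::metric_space measure"
  assumes "finite_measure M" and sM: "sets M = sets borel" and A: "A \<in> sets borel" and "\<epsilon> > 0"
  shows "\<exists>F U. closed F \<and> open U \<and> F \<subseteq> A \<and> A \<subseteq> U \<and> measure M (U - F) < \<epsilon>"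
proof -
  interpret finite_measure M by fact
  have sets_M[simp]: "closed F \<Longrightarrow> F \<in> sets M" "open F \<Longrightarrow> F \<in> sets M" for F
    using sM by auto
  have "A \<in> sigma_sets UNIV (Collect closed)"
    using A by (simp add: borel_eq_closed)
  then show ?thesis using \<open>\<epsilon> > 0\<close>
  proof (induction arbitrary: \<epsilon> rule: sigma_sets.induct)
    case (Basic A)
    show ?case
    proof (cases "A = {}")
      case True
      then show ?thesis using Basic by (intro exI[of _ "{}"]) auto
    next
      case False
      have cl: "closed A" using Basic by simp
      define U where "U n = {x. infdist x A < 1 / real (Suc n)}" for n
      have oU: "open (U n)" for n
        unfolding U_def by (intro open_Collect_less continuous_intros)
      have dU: "decseq U"
        unfolding decseq_def U_def
        by (auto elim!: order_less_le_trans intro!: divide_left_mono)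
      have iU: "(\<Inter>n. U n) = A"
      proof safe
        fix x assume "x \<in> (\<Inter>n. U n)"
        then have "\<And>n. infdist x A < inverse (real (Suc n))"
          by (auto simp: U_def divide_inverse simp del: of_nat_Suc)
        then have "infdist x A \<le> 0"
          by (meson linorder_not_le not_less_iff_gr_or_eq reals_Archimedean)
        then show "x \<in> A" using in_closed_iff_infdist_zero[OF cl False] infdist_nonneg[of x A] by simp
      next
        fix x n assume "x \<in> A" then show "x \<in> U n" by (simp add: U_def)
      qed
      have "(\<lambda>n. measure M (U n)) \<longlonglongrightarrow> measure M (\<Inter>n. U n)"
        by (rule finite_Lim_measure_decseq) (use oU dU in auto)
      then have "(\<lambda>n. measure M (U n)) \<longlonglongrightarrow> measure M A" using iU by simp
      then have "eventually (\<lambda>n. measure M (U n) < measure M A + \<epsilon>) sequentially"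
        using Basic(2) by (intro order_tendstoD) auto
      then obtain n where "measure M (U n) < measure M A + \<epsilon>"
        by (auto simp: eventually_sequentially)
      moreover have "A \<subseteq> U n" using iU by auto
      ultimately have "measure M (U n - A) < \<epsilon>"
        using finite_measure_Diff[of "U n" A] oU cl by auto
      then show ?thesis using oU cl \<open>A \<subseteq> U n\<close> by blast
    qed
  next
    case Empty
    then show ?case by (intro exI[of _ "{}"]) auto
  next
    case (Compl A)
    obtain F U where FU: "closed F" "open U" "F \<subseteq> A" "A \<subseteq> U" "measure M (U - F) < \<epsilon>"
      using Compl.IH[OF Compl.prems] by blast
    have "- F - - U = U - F" by auto
    then have "closed (- U) \<and> open (- F) \<and> - U \<subseteq> - A \<and> - A \<subseteq> - F \<and> measure M (- F - - U) < \<epsilon>"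
      using FU by auto
    then show ?case unfolding Compl_eq_Diff_UNIV[symmetric] by blast
  next
    case (Union A)
    \<comment> \<open>These tolerances sum to \<open>\<epsilon> / 2\<close>, which leaves room for
      the passage from infinitely many closed sets to finitely many.\<close>
    have "\<exists>F U. closed F \<and> open U \<and> F \<subseteq> A i \<and> A i \<subseteq> U \<and> measure M (U - F) < \<epsilon> / 4 * (1/2)^i" for i
      using Union.IH[of "\<epsilon> / 4 * (1/2)^i" i] Union.prems by simp
    then obtain F U where FU: "\<And>i. closed (F i)" "\<And>i. open (U i)" "\<And>i. F i \<subseteq> A i" "\<And>i. A i \<subseteq> U i"
      "\<And>i. measure M (U i - F i) < \<epsilon> / 4 * (1/2)^i" by metis
    have sm: "(\<lambda>i. \<epsilon> / 4 * (1/2)^i) sums (\<epsilon> / 4 * 2)"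
      using geometric_sums[of "1/2::real"] by (intro sums_mult) auto
    have su: "summable (\<lambda>i. measure M (U i - F i))"
      by (rule summable_comparison_test'[OF sums_summable[OF sm], of 0])
         (use FU(5) less_imp_le in auto)
    have UF: "(\<Union>i. U i - F i) \<in> sets M" using FU by (intro sets.countable_nat_UN) auto
    have "measure M (\<Union>i. U i - F i) \<le> (\<Sum>i. measure M (U i - F i))"
      by (rule finite_measure_subadditive_countably) (use FU su in auto)
    also have "\<dots> \<le> (\<Sum>i. \<epsilon> / 4 * (1/2)^i)"
      by (rule suminf_le) (use FU(5) less_imp_le su sums_summable[OF sm] in auto)
    also have "\<dots> = \<epsilon> / 2" using sums_unique[OF sm] by simp
    finally have 1: "measure M (\<Union>i. U i - F i) \<le> \<epsilon> / 2" .
    define V where "V = (\<Union>i. U i)"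
    \<comment> \<open>An infinite union of closed sets need not be closed. The finite unions are,
      and \<open>V - G n\<close> decreases to a subset of the union of the
      \<open>U i - F i\<close>.\<close>
    define G where "G n = (\<Union>i\<le>n. F i)" for n :: nat
    have cG: "closed (G n)" for n unfolding G_def using FU by auto
    have oV: "open V" unfolding V_def using FU by auto
    have "(\<lambda>n. measure M (V - G n)) \<longlonglongrightarrow> measure M (\<Inter>n. V - G n)"
    proof (rule finite_Lim_measure_decseq)
      show "range (\<lambda>n. V - G n) \<subseteq> sets M" using oV cG by auto
      have "G m \<subseteq> G n" if "m \<le> n" for m n using that by (force simp: G_def)
      then show "decseq (\<lambda>n. V - G n)" unfolding decseq_def by blast
    qed
    moreover have "measure M (\<Inter>n. V - G n) < \<epsilon>"
    proof -
      have "(\<Inter>n. V - G n) \<subseteq> (\<Union>i. U i - F i)" by (auto simp: V_def G_def)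
      then have "measure M (\<Inter>n. V - G n) \<le> measure M (\<Union>i. U i - F i)"
        by (intro finite_measure_mono UF)
      with 1 Union.prems show ?thesis by simp
    qed
    ultimately have "eventually (\<lambda>n. measure M (V - G n) < \<epsilon>) sequentially"
      by (rule order_tendstoD)
    then obtain n where "measure M (V - G n) < \<epsilon>" by (auto simp: eventually_sequentially)
    moreover have "G n \<subseteq> (\<Union>i. A i)" "(\<Union>i. A i) \<subseteq> V" using FU(3,4) unfolding G_def V_def by blast+
    ultimately show ?case by (intro exI[of _ "G n"] exI[of _ V] conjI cG oV)
  qed
qed

lemma continuous_cutoff:
  fixes F U :: "'a::metric_space set"
  assumes "closed F" "open U" "F \<subseteq> U"
  obtains h :: "'a \<Rightarrow> real" where "continuous_on UNIV h" "\<And>x. 0 \<le> h x" "\<And>x. h x \<le> 1"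
    "\<And>x. x \<in> F \<Longrightarrow> h x = 1" "\<And>x. x \<notin> U \<Longrightarrow> h x = 0"
proof -
  have "normal_space (euclidean :: 'a topology)"
    by (intro metrizable_imp_normal_space metrizable_space_euclidean)
  then obtain h where h: "continuous_map (euclidean :: 'a topology) (top_of_set {0..1::real}) h"
      "h ` (- U) \<subseteq> {0}" "h ` F \<subseteq> {1}"
    using Urysohn_lemma[of "euclidean :: 'a topology" "- U" F 0 1] assms
    by (auto simp: disjnt_def)
  show ?thesis
    by (rule that[of h]) (use h in \<open>auto simp: image_subset_iff continuous_map_in_subtopology\<close>)
qed

text \<open>Test functions for an arbitrary metric space; on the compact spaces of the later
  sections they are exactly \<open>Cc\<close>.\<close>

definition bounded_cont :: "('a::topological_space \<Rightarrow> real) \<Rightarrow> bool" where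
  "bounded_cont h \<longleftrightarrow> continuous_on UNIV h \<and> (\<exists>K. \<forall>x. \<bar>h x\<bar> \<le> K)"

lemma bounded_cont_add: "bounded_cont g \<Longrightarrow> bounded_cont h \<Longrightarrow> bounded_cont (\<lambda>x. g x + h x)"
  unfolding bounded_cont_def
  by (auto intro!: continuous_intros) (meson abs_triangle_ineq add_mono order_trans)

lemma bounded_cont_cmult: "bounded_cont g \<Longrightarrow> bounded_cont (\<lambda>x. c * g x)"
  unfolding bounded_cont_def
  by (auto intro!: continuous_intros simp: abs_mult) (meson abs_ge_zero mult_left_mono)

section \<open>Square-integrable functions\<close>

lemma L2_bounded:
  assumes "finite_measure M" "f \<in> borel_measurable M" "\<And>x. \<bar>f x\<bar> \<le> K"
  shows "f \<in> L2 M"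
proof -
  interpret finite_measure M by fact
  have "\<bar>f x\<bar>\<^sup>2 \<le> K\<^sup>2" for x by (rule power_mono) (use assms in auto)
  then have "integrable M (\<lambda>x. (f x)\<^sup>2)"
    using assms(2) by (intro integrable_const_bound[of _ "K\<^sup>2"]) auto
  then show ?thesis using assms by (simp add: L2_def)
qed

lemma L2_mult_integrable:
  assumes "f \<in> L2 M" "g \<in> L2 M"
  shows "integrable M (\<lambda>x. f x * g x)"
proof (rule Bochner_Integration.integrable_bound)
  show "integrable M (\<lambda>x. (f x)\<^sup>2 + (g x)\<^sup>2)" using assms by (auto simp: L2_def)
  show "(\<lambda>x. f x * g x) \<in> borel_measurable M" using assms by (auto simp: L2_def)
  have "2 * (\<bar>a\<bar> * \<bar>b\<bar>) \<le> a\<^sup>2 + b\<^sup>2" for a b :: real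
    using zero_le_power2[of "\<bar>a\<bar> - \<bar>b\<bar>"] by (simp add: power2_eq_square algebra_simps)
  then have "\<bar>a\<bar> * \<bar>b\<bar> \<le> a\<^sup>2 + b\<^sup>2" for a b :: real
    by (smt (verit, best) mult_nonneg_nonneg abs_ge_zero)
  then show "AE x in M. norm (f x * g x) \<le> norm ((f x)\<^sup>2 + (g x)\<^sup>2)"
    by (auto simp: abs_mult)
qed

lemma L2_add: "f \<in> L2 M \<Longrightarrow> g \<in> L2 M \<Longrightarrow> (\<lambda>x. f x + g x) \<in> L2 M"
  using L2_mult_integrable[of f M g] by (auto simp: L2_def power2_sum mult.assoc)

lemma L2_cmult: "f \<in> L2 M \<Longrightarrow> (\<lambda>x. c * f x) \<in> L2 M"
  by (auto simp: L2_def power_mult_distrib)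

lemma L2_diff: "f \<in> L2 M \<Longrightarrow> g \<in> L2 M \<Longrightarrow> (\<lambda>x. f x - g x) \<in> L2 M"
  using L2_add[of f M "\<lambda>x. - 1 * g x"] L2_cmult[of g M "-1"] by simp

lemma L2_sq: "f \<in> L2 M \<Longrightarrow> integrable M (\<lambda>x. (f x)\<^sup>2)"
  by (simp add: L2_def)

lemma L2_Cauchy_Schwarz:
  assumes "f \<in> L2 M" "g \<in> L2 M"
  shows "(\<integral>x. f x * g x \<partial>M)\<^sup>2 \<le> (\<integral>x. (f x)\<^sup>2 \<partial>M) * (\<integral>x. (g x)\<^sup>2 \<partial>M)"
proof (rule quadratic_nonneg_imp)
  fix t :: real
  have "0 \<le> (\<integral>x. (f x + t * g x)\<^sup>2 \<partial>M)" by (rule Bochner_Integration.integral_nonneg) simp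
  also have "\<dots> = (\<integral>x. (f x)\<^sup>2 + 2 * t * (f x * g x) + t\<^sup>2 * (g x)\<^sup>2 \<partial>M)"
    by (simp add: power2_sum power_mult_distrib algebra_simps)
  also have "\<dots> = (\<integral>x. (f x)\<^sup>2 \<partial>M) + 2 * t * (\<integral>x. f x * g x \<partial>M) + t\<^sup>2 * (\<integral>x. (g x)\<^sup>2 \<partial>M)"
    using L2_mult_integrable[OF assms] L2_sq[OF assms(1)] L2_sq[OF assms(2)] by simp
  finally show "0 \<le> (\<integral>x. (f x)\<^sup>2 \<partial>M) + 2 * t * (\<integral>x. f x * g x \<partial>M) + t\<^sup>2 * (\<integral>x. (g x)\<^sup>2 \<partial>M)" .
qed

text \<open>Twice the sum of squares replaces the triangle inequality, which would require square
  roots. The pointwise bound is the parallelogram identity with one square dropped.\<close>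

lemma L2_dist_triangle:
  assumes "f \<in> L2 M" "g \<in> L2 M" "h \<in> L2 M"
  shows "(\<integral>x. (f x - h x)\<^sup>2 \<partial>M) \<le> 2 * (\<integral>x. (f x - g x)\<^sup>2 \<partial>M) + 2 * (\<integral>x. (g x - h x)\<^sup>2 \<partial>M)"
proof -
  have i: "integrable M (\<lambda>x. (f x - g x)\<^sup>2)" "integrable M (\<lambda>x. (g x - h x)\<^sup>2)" "integrable M (\<lambda>x. (f x - h x)\<^sup>2)"
    using assms by (auto intro!: L2_sq L2_diff)
  have e: "(a - c)\<^sup>2 \<le> 2 * (a - b)\<^sup>2 + 2 * (b - c)\<^sup>2" for a b c :: real
    using zero_le_power2[of "(a - b) - (b - c)"] by (simp add: power2_eq_square algebra_simps)
  have "(\<integral>x. (f x - h x)\<^sup>2 \<partial>M) \<le> (\<integral>x. 2 * (f x - g x)\<^sup>2 + 2 * (g x - h x)\<^sup>2 \<partial>M)"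
    using i e by (intro integral_mono) auto
  then show ?thesis using i by simp
qed

lemma simple_function_real_decomp:
  fixes s :: "'a \<Rightarrow> real"
  assumes "simple_function M s" "space M = UNIV"
  shows "(\<lambda>x. \<Sum>y\<in>range s. y * indicator (s -` {y}) x) = s"
proof (rule ext)
  fix x
  show "(\<Sum>y\<in>range s. y * indicator (s -` {y}) x) = s x"
    using simple_function_indicator_representation_banach[OF assms(1), of x]
    unfolding assms(2) by (simp only: UNIV_I Int_UNIV_right real_scaleR_def mult.commute)
qed

text \<open>Regularity of the measure and a cutoff function handle indicators, linearity handles
  simple functions, and dominated convergence the rest.\<close>

lemma L2_continuous_approx:
  fixes M :: "'a::metric_space measure"
  assumes "finite_measure M" and sM: "sets M = sets borel" and f: "f \<in> L2 M" and "\<epsilon> > 0"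
  shows "\<exists>h. bounded_cont h \<and> (\<integral>x. (h x - f x)\<^sup>2 \<partial>M) < \<epsilon>"
proof -
  interpret finite_measure M by fact
  have spM: "space M = UNIV" using sets_eq_imp_space_eq[OF sM] by simp
  have mM: "borel_measurable M = borel_measurable borel" using sM by (simp cong: measurable_cong_sets)
  define P where "P f \<longleftrightarrow> f \<in> L2 M \<and> (\<forall>\<epsilon>>0. \<exists>h. bounded_cont h \<and> (\<integral>x. (h x - f x)\<^sup>2 \<partial>M) < \<epsilon>)" for f
  have bL2: "bounded_cont h \<Longrightarrow> h \<in> L2 M" for h
    unfolding bounded_cont_def
    using L2_bounded[OF \<open>finite_measure M\<close>, of h] mM borel_measurable_continuous_onI by blast
  have PI: "P (indicator A)" if A: "A \<in> sets borel" for A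
  proof -
    have iL: "(indicator A :: 'a \<Rightarrow> real) \<in> L2 M"
      by (rule L2_bounded[of _ _ 1]) (use that sM \<open>finite_measure M\<close> in \<open>auto simp: indicator_def\<close>)
    moreover have "\<exists>h. bounded_cont h \<and> (\<integral>x. (h x - indicator A x)\<^sup>2 \<partial>M) < \<epsilon>" if "\<epsilon> > 0" for \<epsilon> :: real
    proof -
      obtain F U where FU: "closed F" "open U" "F \<subseteq> A" "A \<subseteq> U" "measure M (U - F) < \<epsilon>"
        using closed_open_regular[OF \<open>finite_measure M\<close> sM A \<open>\<epsilon> > 0\<close>] by blast
      have UF: "U - F \<in> sets M" using FU sM by auto
      have "F \<subseteq> U" using FU by auto
      obtain h :: "'a \<Rightarrow> real" where h: "continuous_on UNIV h" "\<And>x. 0 \<le> h x" "\<And>x. h x \<le> 1"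
        "\<And>x. x \<in> F \<Longrightarrow> h x = 1" "\<And>x. x \<notin> U \<Longrightarrow> h x = 0"
        using continuous_cutoff[OF FU(1,2) \<open>F \<subseteq> U\<close>] by metis
      have bh: "bounded_cont h" using h by (auto simp: bounded_cont_def intro!: exI[of _ 1])
      have le: "(h x - indicator A x)\<^sup>2 \<le> indicator (U - F) x" for x
      proof -
        have "\<bar>h x - indicator A x\<bar> \<le> 1" using h(2,3)[of x] by (auto simp: indicator_def)
        then have "(h x - indicator A x)\<^sup>2 \<le> 1" by (simp add: abs_square_le_1)
        moreover have "h x - indicator A x = 0" if "x \<notin> U - F"
          using that h(4,5)[of x] FU by (auto simp: indicator_def)
        ultimately show ?thesis by (cases "x \<in> U - F") auto
      qed
      have "(\<integral>x. (h x - indicator A x)\<^sup>2 \<partial>M) \<le> (\<integral>x. indicator (U - F) x \<partial>M)"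
        using le UF by (intro integral_mono L2_sq L2_diff bL2 bh iL) (auto simp: less_top[symmetric])
      also have "\<dots> < \<epsilon>" using FU spM by simp
      finally show ?thesis using bh by blast
    qed
    ultimately show ?thesis by (simp add: P_def)
  qed
  have Padd: "P (\<lambda>x. f x + g x)" if "P f" "P g" for f g
  proof -
    have fg: "f \<in> L2 M" "g \<in> L2 M" using that by (auto simp: P_def)
    have "\<exists>h. bounded_cont h \<and> (\<integral>x. (h x - (f x + g x))\<^sup>2 \<partial>M) < \<epsilon>" if "\<epsilon> > 0" for \<epsilon> :: real
    proof -
      obtain h k where hk: "bounded_cont h" "bounded_cont k"
        "(\<integral>x. (h x - f x)\<^sup>2 \<partial>M) < \<epsilon> / 4" "(\<integral>x. (k x - g x)\<^sup>2 \<partial>M) < \<epsilon> / 4"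
        using \<open>P f\<close> \<open>P g\<close> \<open>\<epsilon> > 0\<close> unfolding P_def by (meson zero_less_divide_iff zero_less_numeral)
      have "(\<integral>x. ((h x + k x) - (f x + g x))\<^sup>2 \<partial>M) \<le> 2 * (\<integral>x. ((h x + k x) - (f x + k x))\<^sup>2 \<partial>M)
          + 2 * (\<integral>x. ((f x + k x) - (f x + g x))\<^sup>2 \<partial>M)"
        by (rule L2_dist_triangle; intro L2_add fg bL2 hk(1,2))
      also have "\<dots> < \<epsilon>" using hk by simp
      finally show ?thesis using bounded_cont_add[OF hk(1,2)] by blast
    qed
    then show ?thesis using L2_add[OF fg] by (simp add: P_def)
  qed
  have Pcm: "P (\<lambda>x. c * f x)" if "P f" for c f
  proof -
    have fL: "f \<in> L2 M" using that by (auto simp: P_def)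
    have "\<exists>h. bounded_cont h \<and> (\<integral>x. (h x - (c * f x))\<^sup>2 \<partial>M) < \<epsilon>" if "\<epsilon> > 0" for \<epsilon> :: real
    proof -
      \<comment> \<open>The added 1 keeps the denominator positive when
        \<open>c = 0\<close>.\<close>
      have "\<epsilon> / (c\<^sup>2 + 1) > 0" using that by (simp add: add_nonneg_pos)
      then obtain h where h: "bounded_cont h" "(\<integral>x. (h x - f x)\<^sup>2 \<partial>M) < \<epsilon> / (c\<^sup>2 + 1)"
        using \<open>P f\<close> unfolding P_def by meson
      have "(\<integral>x. (c * h x - c * f x)\<^sup>2 \<partial>M) = c\<^sup>2 * (\<integral>x. (h x - f x)\<^sup>2 \<partial>M)"
        by (simp add: right_diff_distrib[symmetric] power_mult_distrib)
      also have "\<dots> \<le> (c\<^sup>2 + 1) * (\<integral>x. (h x - f x)\<^sup>2 \<partial>M)" by (intro mult_right_mono) auto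
      also have "\<dots> < \<epsilon>" using h(2) by (simp add: pos_less_divide_eq mult.commute add_nonneg_pos)
      finally show ?thesis using bounded_cont_cmult[OF h(1)] by blast
    qed
    then show ?thesis using L2_cmult[OF fL] by (simp add: P_def)
  qed
  have P0: "P (\<lambda>x. 0)" using Pcm[OF PI[of "{}"], of 0] by simp
  have Psum: "P (\<lambda>x. \<Sum>y\<in>Y. y * indicator (A y) x)" if "finite Y" "\<And>y. y \<in> Y \<Longrightarrow> A y \<in> sets borel" for Y A
    using that
  proof (induction Y rule: finite_induct)
    case empty then show ?case using P0 by simp
  next
    case (insert y Y)
    have "P (\<lambda>x. y * indicator (A y) x + (\<Sum>y\<in>Y. y * indicator (A y) x))"
      using insert by (intro Padd Pcm PI) auto
    moreover have "(\<Sum>y\<in>insert y Y. y * indicator (A y) x) =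
        y * indicator (A y) x + (\<Sum>y\<in>Y. y * indicator (A y) x)" for x
      by (rule sum.insert) (use insert in auto)
    ultimately show ?case by simp
  qed
  have fm: "f \<in> borel_measurable M" using f by (simp add: L2_def)
  obtain s where s: "\<And>i. simple_function M (s i)" "\<And>x. (\<lambda>i. s i x) \<longlonglongrightarrow> f x"
    "\<And>i x. dist (s i x) 0 \<le> 2 * dist (f x) 0"
    using borel_measurable_implies_sequence_metric[OF fm, of 0] unfolding spM by (metis UNIV_I)
  have sr: "(\<lambda>x. \<Sum>y\<in>range (s i). y * indicator (s i -` {y}) x) = s i" for i
    by (rule simple_function_real_decomp[OF s(1) spM])
  have Ps: "P (s i)" for i
  proof -
    have "finite (range (s i))" "\<And>y. y \<in> range (s i) \<Longrightarrow> s i -` {y} \<in> sets borel"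
      using s(1)[of i] spM sM by (auto simp: simple_function_def)
    from Psum[of "range (s i)" "\<lambda>y. s i -` {y}", OF this] show ?thesis unfolding sr .
  qed
  \<comment> \<open>The approximants satisfy \<open>|s i x| <= 2 * |f x|\<close>, so their distance
    to \<open>f x\<close> is at most \<open>3 * |f x|\<close>; squaring gives the factor 9.\<close>
  have bd: "(s i x - f x)\<^sup>2 \<le> 9 * (f x)\<^sup>2" for i x
  proof -
    have "\<bar>s i x - f x\<bar> \<le> 3 * \<bar>f x\<bar>" using s(3)[of i x] by (simp add: dist_real_def)
    then have "\<bar>s i x - f x\<bar>\<^sup>2 \<le> (3 * \<bar>f x\<bar>)\<^sup>2" by (rule power_mono) simp
    then show ?thesis by (simp add: power_mult_distrib)
  qed
  have "(\<lambda>i. \<integral>x. (s i x - f x)\<^sup>2 \<partial>M) \<longlonglongrightarrow> (\<integral>x. 0 \<partial>M)"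
  proof (rule integral_dominated_convergence[where w = "\<lambda>x. 9 * (f x)\<^sup>2"])
    show "(\<lambda>x. (s i x - f x)\<^sup>2) \<in> borel_measurable M" for i
      using fm borel_measurable_simple_function[OF s(1)] by auto
    show "integrable M (\<lambda>x. 9 * (f x)\<^sup>2)" using L2_sq[OF f] by simp
    show "AE x in M. (\<lambda>i. (s i x - f x)\<^sup>2) \<longlonglongrightarrow> 0"
    proof (rule AE_I2)
      fix x
      have "(\<lambda>i. (s i x - f x)\<^sup>2) \<longlonglongrightarrow> (f x - f x)\<^sup>2" by (intro tendsto_intros s(2))
      then show "(\<lambda>i. (s i x - f x)\<^sup>2) \<longlonglongrightarrow> 0" by simp
    qed
  qed (use bd in auto)
  then have "eventually (\<lambda>i. (\<integral>x. (s i x - f x)\<^sup>2 \<partial>M) < \<epsilon> / 4) sequentially"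
    using \<open>\<epsilon> > 0\<close> by (intro order_tendstoD) auto
  then obtain i where i: "(\<integral>x. (s i x - f x)\<^sup>2 \<partial>M) < \<epsilon> / 4" by (auto simp: eventually_sequentially)
  obtain h where h: "bounded_cont h" "(\<integral>x. (h x - s i x)\<^sup>2 \<partial>M) < \<epsilon> / 4"
    using Ps[of i] \<open>\<epsilon> > 0\<close> unfolding P_def by (meson zero_less_divide_iff zero_less_numeral)
  have "(\<integral>x. (h x - f x)\<^sup>2 \<partial>M) < \<epsilon>"
    using L2_dist_triangle[of h M "s i" f] bL2[OF h(1)] Ps[of i] f h(2) i by (auto simp: P_def)
  then show ?thesis using h(1) by blast
qed

text \<open>The difference of the products is
  \<open>(h - f) (k - g) + f (k - g) + (h - f) g\<close>, and each of the three integrals tends to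
  zero by Cauchy-Schwarz.\<close>

lemma L2_inner_tendsto:
  assumes L: "\<And>n. h n \<in> L2 M" "\<And>n. k n \<in> L2 M" "f \<in> L2 M" "g \<in> L2 M"
    and h: "(\<lambda>n. \<integral>x. (h n x - f x)\<^sup>2 \<partial>M) \<longlonglongrightarrow> 0" and k: "(\<lambda>n. \<integral>x. (k n x - g x)\<^sup>2 \<partial>M) \<longlonglongrightarrow> 0"
  shows "(\<lambda>n. \<integral>x. h n x * k n x \<partial>M) \<longlonglongrightarrow> (\<integral>x. f x * g x \<partial>M)"
proof -
  have z: "(\<lambda>n. \<integral>x. p n x * q n x \<partial>M) \<longlonglongrightarrow> 0"
    if "\<And>n. p n \<in> L2 M" "\<And>n. q n \<in> L2 M"
      and pq: "(\<lambda>n. (\<integral>x. (p n x)\<^sup>2 \<partial>M) * (\<integral>x. (q n x)\<^sup>2 \<partial>M)) \<longlonglongrightarrow> 0" for p q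
  proof -
    have "(\<lambda>n. (\<integral>x. p n x * q n x \<partial>M)\<^sup>2) \<longlonglongrightarrow> 0"
      by (rule tendsto_sandwich[OF _ _ tendsto_const pq]) (auto intro!: always_eventually L2_Cauchy_Schwarz that)
    from tendsto_real_sqrt[OF this] have "(\<lambda>n. \<bar>\<integral>x. p n x * q n x \<partial>M\<bar>) \<longlonglongrightarrow> 0" by simp
    then show ?thesis by (rule tendsto_rabs_zero_cancel)
  qed
  have 1: "(\<lambda>n. \<integral>x. (h n x - f x) * (k n x - g x) \<partial>M) \<longlonglongrightarrow> 0"
    using tendsto_mult[OF h k] by (intro z L2_diff L) simp
  have 2: "(\<lambda>n. \<integral>x. f x * (k n x - g x) \<partial>M) \<longlonglongrightarrow> 0"
    using tendsto_mult[OF tendsto_const k] by (intro z L2_diff L) simp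
  have 3: "(\<lambda>n. \<integral>x. (h n x - f x) * g x \<partial>M) \<longlonglongrightarrow> 0"
    using tendsto_mult[OF h tendsto_const] by (intro z L2_diff L) simp
  have e: "(\<integral>x. h n x * k n x \<partial>M) = (\<integral>x. (h n x - f x) * (k n x - g x) \<partial>M) + (\<integral>x. f x * (k n x - g x) \<partial>M)
      + (\<integral>x. (h n x - f x) * g x \<partial>M) + (\<integral>x. f x * g x \<partial>M)" for n
  proof -
    have i: "integrable M (\<lambda>x. (h n x - f x) * (k n x - g x))" "integrable M (\<lambda>x. f x * (k n x - g x))"
      "integrable M (\<lambda>x. (h n x - f x) * g x)" "integrable M (\<lambda>x. f x * g x)"
      by (intro L2_mult_integrable L2_diff L)+
    have "(\<integral>x. h n x * k n x \<partial>M) = (\<integral>x. (h n x - f x) * (k n x - g x) + f x * (k n x - g x)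
        + (h n x - f x) * g x + f x * g x \<partial>M)"
      by (intro Bochner_Integration.integral_cong) (auto simp: algebra_simps)
    then show ?thesis using i by simp
  qed
  show ?thesis unfolding e using tendsto_add[OF tendsto_add[OF tendsto_add[OF 1 2] 3] tendsto_const] by simp
qed

section \<open>Integrals of bounded Borel functions against signed measures\<close>

definition bounded_borel :: "('a::topological_space \<Rightarrow> real) \<Rightarrow> bool" where
  "bounded_borel g \<longleftrightarrow> g \<in> borel_measurable borel \<and> (\<exists>K. \<forall>x. \<bar>g x\<bar> \<le> K)"

lemma bounded_borelI: "g \<in> borel_measurable borel \<Longrightarrow> (\<And>x. \<bar>g x\<bar> \<le> K) \<Longrightarrow> bounded_borel g"
  by (auto simp: bounded_borel_def)

lemma bounded_cont_imp_borel: "bounded_cont h \<Longrightarrow> bounded_borel h"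
  by (auto simp: bounded_borel_def bounded_cont_def borel_measurable_continuous_onI)

lemma bounded_borel_indicator: "A \<in> sets borel \<Longrightarrow> bounded_borel (indicator A)"
  by (rule bounded_borelI[where K = 1]) (auto simp: indicator_def)

lemma bounded_borel_add: "bounded_borel g \<Longrightarrow> bounded_borel h \<Longrightarrow> bounded_borel (\<lambda>x. g x + h x)"
  unfolding bounded_borel_def by (auto) (meson abs_triangle_ineq add_mono order_trans)

lemma bounded_borel_mult: "bounded_borel g \<Longrightarrow> bounded_borel h \<Longrightarrow> bounded_borel (\<lambda>x. g x * h x)"
  unfolding bounded_borel_def
  by (auto simp: abs_mult) (meson abs_ge_zero mult_mono order_trans)

lemma bounded_borel_const: "bounded_borel (\<lambda>x. c)"
  by (rule bounded_borelI) auto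

lemma bounded_borel_cmult: "bounded_borel g \<Longrightarrow> bounded_borel (\<lambda>x. c * g x)"
  by (intro bounded_borel_mult bounded_borel_const)

text \<open>Signed measures have no monotone convergence, so the limit step is by uniformly bounded
  pointwise convergence, under which the integrals converge by domination.\<close>

lemma bounded_borel_induct [consumes 1, case_names indicator add cmult lim]:
  fixes g :: "'a::topological_space \<Rightarrow> real"
  assumes g: "bounded_borel g"
    and ind: "\<And>A. A \<in> sets borel \<Longrightarrow> P (indicator A)"
    and add: "\<And>f g. bounded_borel f \<Longrightarrow> bounded_borel g \<Longrightarrow> P f \<Longrightarrow> P g \<Longrightarrow> P (\<lambda>x. f x + g x)"
    and cmult: "\<And>f c. bounded_borel f \<Longrightarrow> P f \<Longrightarrow> P (\<lambda>x. c * f x)"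
    and lim: "\<And>s f C. (\<And>i::nat. bounded_borel (s i)) \<Longrightarrow> bounded_borel f \<Longrightarrow>
        (\<And>i x. \<bar>s i x\<bar> \<le> C) \<Longrightarrow> (\<And>x. (\<lambda>i. s i x) \<longlonglongrightarrow> f x) \<Longrightarrow> (\<And>i. P (s i)) \<Longrightarrow> P f"
  shows "P g"
proof -
  obtain K where gm: "g \<in> borel_measurable borel" and K: "\<And>x. \<bar>g x\<bar> \<le> K"
    using g by (auto simp: bounded_borel_def)
  have Psum: "bounded_borel (\<lambda>x. \<Sum>y\<in>Y. y * indicator (A y) x) \<and> P (\<lambda>x. \<Sum>y\<in>Y. y * indicator (A y) x)"
    if "finite Y" "\<And>y. y \<in> Y \<Longrightarrow> A y \<in> sets borel" for Y and A :: "real \<Rightarrow> 'a set"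
    using that
  proof (induction Y rule: finite_induct)
    case empty
    \<comment> \<open>The zero function is reached as 0 times the indicator of the empty
      set.\<close>
    have E: "{} \<in> sets borel" by simp
    show ?case
      using cmult[OF bounded_borel_indicator[OF E] ind[OF E], of 0] by (simp add: bounded_borel_const)
  next
    case (insert y Y)
    have A: "A y \<in> sets borel" using insert.prems by simp
    have bP: "bounded_borel (\<lambda>x. \<Sum>y\<in>Y. y * indicator (A y) x)" "P (\<lambda>x. \<Sum>y\<in>Y. y * indicator (A y) x)"
      using insert by simp_all
    have e: "(\<lambda>x. \<Sum>y\<in>insert y Y. y * indicator (A y) x) =
        (\<lambda>x. y * indicator (A y) x + (\<Sum>y\<in>Y. y * indicator (A y) x))"
      by (rule ext, rule sum.insert) (use insert in auto)
    show ?case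
      unfolding e using bounded_borel_cmult[OF bounded_borel_indicator[OF A]] bP
        cmult[OF bounded_borel_indicator[OF A] ind[OF A]]
      by (intro conjI bounded_borel_add add)
  qed
  obtain s where s: "\<And>i. simple_function borel (s i)" "\<And>x. (\<lambda>i. s i x) \<longlonglongrightarrow> g x"
    "\<And>i x. dist (s i x) 0 \<le> 2 * dist (g x) 0"
    using borel_measurable_implies_sequence_metric[OF gm, of 0] unfolding space_borel by (metis UNIV_I)
  have sr: "(\<lambda>x. \<Sum>y\<in>range (s i). y * indicator (s i -` {y}) x) = s i" for i
    by (rule simple_function_real_decomp[OF s(1) space_borel])
  have Ps: "bounded_borel (s i) \<and> P (s i)" for i
  proof -
    have "finite (range (s i))" "\<And>y. y \<in> range (s i) \<Longrightarrow> s i -` {y} \<in> sets borel"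
      using s(1)[of i] by (auto simp: simple_function_def)
    from Psum[of "range (s i)" "\<lambda>y. s i -` {y}", OF this] show ?thesis unfolding sr .
  qed
  show ?thesis
  proof (rule lim[of s _ "2 * K"])
    show "\<bar>s i x\<bar> \<le> 2 * K" for i x using s(3)[of i x] K[of x] by (simp add: dist_real_def)
  qed (use s(2) Ps g in auto)
qed

section \<open>Well-definedness and continuity of signed integrals\<close>

lemma integrable_bounded_borel:
  assumes "finite_measure M" "sets M = sets borel" "bounded_borel g"
  shows "integrable M g"
proof -
  interpret finite_measure M by fact
  have "borel_measurable M = borel_measurable borel" using assms(2) by (simp cong: measurable_cong_sets)
  moreover obtain K where "g \<in> borel_measurable borel" "\<And>x. \<bar>g x\<bar> \<le> K"
    using assms(3) by (auto simp: bounded_borel_def)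
  ultimately show ?thesis by (intro integrable_const_bound[of _ K]) auto
qed

lemma integral_bounded_borel_tendsto:
  assumes M: "finite_measure M" "sets M = sets borel"
    and s: "\<And>i::nat. bounded_borel (s i)" "bounded_borel f" "\<And>i x. \<bar>s i x\<bar> \<le> C" "\<And>x. (\<lambda>i. s i x) \<longlonglongrightarrow> f x"
  shows "(\<lambda>i. \<integral>x. s i x \<partial>M) \<longlonglongrightarrow> (\<integral>x. f x \<partial>M)"
proof (rule integral_dominated_convergence[where w = "\<lambda>x. C"])
  show "integrable M (\<lambda>x. C)" using M by (simp add: finite_measure.integrable_const)
  have "borel_measurable M = borel_measurable borel" using M by (simp cong: measurable_cong_sets)
  then show "f \<in> borel_measurable M" "\<And>i. s i \<in> borel_measurable M"
    using s by (auto simp: bounded_borel_def)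
qed (use s in auto)

text \<open>This makes the definite description in \<open>signed_integral\<close> meaningful: the
  two differences agree on indicators because both decompose the same set function.\<close>

lemma decomposes_integral_unique:
  assumes d: "decomposes M N \<mu>" "decomposes M' N' \<mu>" and g: "bounded_borel g"
  shows "(\<integral>x. g x \<partial>M) - (\<integral>x. g x \<partial>N) = (\<integral>x. g x \<partial>M') - (\<integral>x. g x \<partial>N')"
proof -
  note D = d[unfolded decomposes_def]
  have sp: "space M = UNIV" "space N = UNIV" "space M' = UNIV" "space N' = UNIV"
    using D sets_eq_imp_space_eq[of _ borel] by (metis space_borel)+
  show ?thesis using g
  proof (induction g rule: bounded_borel_induct)
    case (indicator A)
    then show ?case using D sp by (auto simp: Int_absorb2)
  next
    case (add f g)
    then show ?case using D
      by (simp add: integrable_bounded_borel algebra_simps)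
  next
    case (cmult f c)
    then show ?case by (simp add: right_diff_distrib[symmetric])
  next
    case (lim s f C)
    have "(\<lambda>i. (\<integral>x. s i x \<partial>M) - (\<integral>x. s i x \<partial>N)) \<longlonglongrightarrow> (\<integral>x. f x \<partial>M) - (\<integral>x. f x \<partial>N)"
         "(\<lambda>i. (\<integral>x. s i x \<partial>M') - (\<integral>x. s i x \<partial>N')) \<longlonglongrightarrow> (\<integral>x. f x \<partial>M') - (\<integral>x. f x \<partial>N')"
      by (intro tendsto_diff integral_bounded_borel_tendsto[of _ _ _ C]; use D lim in auto)+
    then show ?case using lim.IH LIMSEQ_unique by auto
  qed
qed

lemma signed_integral_eq:
  assumes d: "decomposes M N \<mu>" and g: "bounded_borel g"
  shows "signed_integral \<mu> g = (\<integral>x. g x \<partial>M) - (\<integral>x. g x \<partial>N)"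
  unfolding signed_integral_def
proof (rule the_equality)
  fix c assume "\<exists>M N. decomposes M N \<mu> \<and> c = (\<integral>x. g x \<partial>M) - (\<integral>x. g x \<partial>N)"
  then obtain M' N' where "decomposes M' N' \<mu>" "c = (\<integral>x. g x \<partial>M') - (\<integral>x. g x \<partial>N')" by blast
  then show "c = (\<integral>x. g x \<partial>M) - (\<integral>x. g x \<partial>N)" using decomposes_integral_unique[OF d _ g] by simp
qed (use d in blast)

lemma signed_integral_cong:
  assumes "\<And>A. A \<in> sets borel \<Longrightarrow> \<mu> A = \<mu>' A"
  shows "signed_integral \<mu> g = signed_integral \<mu>' g"
proof -
  have "decomposes M N \<mu> = decomposes M N \<mu>'" for M N using assms by (auto simp: decomposes_def)
  then show ?thesis by (simp add: signed_integral_def)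
qed

lemma signed_integral_indicator:
  assumes "finite_signed_measure \<mu>" "A \<in> sets borel"
  shows "signed_integral \<mu> (indicator A) = \<mu> A"
proof -
  obtain M N where d: "decomposes M N \<mu>" using assms by (auto simp: finite_signed_measure_def)
  note D = d[unfolded decomposes_def]
  have sp: "space M = UNIV" "space N = UNIV"
    using D sets_eq_imp_space_eq[of _ borel] by (metis space_borel)+
  show ?thesis using signed_integral_eq[OF d bounded_borel_indicator[OF assms(2)]] D sp assms(2)
    by (simp add: Int_absorb2)
qed

lemma signed_integral_add:
  assumes "finite_signed_measure \<mu>" "bounded_borel f" "bounded_borel g"
  shows "signed_integral \<mu> (\<lambda>x. f x + g x) = signed_integral \<mu> f + signed_integral \<mu> g"
proof -
  obtain M N where d: "decomposes M N \<mu>" using assms by (auto simp: finite_signed_measure_def)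
  note D = d[unfolded decomposes_def]
  show ?thesis using signed_integral_eq[OF d] bounded_borel_add[OF assms(2,3)] assms(2,3) D
    by (simp add: integrable_bounded_borel)
qed

lemma signed_integral_cmult:
  assumes "finite_signed_measure \<mu>" "bounded_borel f"
  shows "signed_integral \<mu> (\<lambda>x. c * f x) = c * signed_integral \<mu> f"
proof -
  obtain M N where d: "decomposes M N \<mu>" using assms by (auto simp: finite_signed_measure_def)
  show ?thesis using signed_integral_eq[OF d] bounded_borel_cmult[OF assms(2)] assms(2)
    by (simp add: right_diff_distrib)
qed

lemma signed_integral_tendsto:
  assumes "finite_signed_measure \<mu>"
    and s: "\<And>i::nat. bounded_borel (s i)" "bounded_borel f" "\<And>i x. \<bar>s i x\<bar> \<le> C" "\<And>x. (\<lambda>i. s i x) \<longlonglongrightarrow> f x"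
  shows "(\<lambda>i. signed_integral \<mu> (s i)) \<longlonglongrightarrow> signed_integral \<mu> f"
proof -
  obtain M N where d: "decomposes M N \<mu>" using assms by (auto simp: finite_signed_measure_def)
  note D = d[unfolded decomposes_def]
  show ?thesis unfolding signed_integral_eq[OF d s(1)] signed_integral_eq[OF d s(2)]
    by (intro tendsto_diff integral_bounded_borel_tendsto[of _ _ _ C]; use D s in auto)
qed

section \<open>Approximation of Borel sets by squares of continuous functions\<close>

text \<open>The witness is the sum of the two measures. A common bound lets one cutoff function
  serve several measures at once.\<close>

lemma dominating_finite_measure:
  fixes M N :: "'a::topological_space measure"
  assumes "finite_measure M" "sets M = sets borel" "finite_measure N" "sets N = sets borel"
  shows "\<exists>K. finite_measure K \<and> sets K = sets borel \<and>
    (\<forall>A\<in>sets borel. measure M A \<le> measure K A \<and> measure N A \<le> measure K A)"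
proof -
  interpret M: finite_measure M by fact
  interpret N: finite_measure N by fact
  define K where "K = measure_of (UNIV :: 'a set) (sets borel) (\<lambda>A. emeasure M A + emeasure N A)"
  have sK: "sets K = sets borel"
    unfolding K_def by (metis sets.sets_measure_of_eq space_borel)
  have spK: "space K = UNIV" using sets_eq_imp_space_eq[OF sK] by simp
  have eK: "emeasure K A = emeasure M A + emeasure N A" if "A \<in> sets borel" for A
    unfolding K_def
  proof (rule emeasure_measure_of_sigma)
    show "sigma_algebra UNIV (sets borel)" using sets.sigma_algebra_axioms[of borel] by simp
    show "countably_additive (sets borel) (\<lambda>A. emeasure M A + emeasure N A)"
      unfolding countably_additive_def
    proof safe
      fix A :: "nat \<Rightarrow> 'a set" assume A: "range A \<subseteq> sets borel" "disjoint_family A"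
      have "(\<Sum>i. emeasure M (A i) + emeasure N (A i)) = (\<Sum>i. emeasure M (A i)) + (\<Sum>i. emeasure N (A i))"
        by (rule suminf_add[symmetric]) auto
      then show "(\<Sum>i. emeasure M (A i) + emeasure N (A i)) = emeasure M (\<Union> (range A)) + emeasure N (\<Union> (range A))"
        using A assms(2,4) by (simp add: suminf_emeasure)
    qed
  qed (use that in \<open>auto simp: positive_def\<close>)
  have fK: "finite_measure K"
    by (rule finite_measureI) (use eK[of UNIV] spK in simp)
  then interpret K: finite_measure K .
  have "measure M A \<le> measure K A \<and> measure N A \<le> measure K A" if "A \<in> sets borel" for A
  proof -
    have "ennreal (measure K A) = ennreal (measure M A) + ennreal (measure N A)"
      using eK[OF that] by (simp add: M.emeasure_eq_measure N.emeasure_eq_measure K.emeasure_eq_measure)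
    then have "ennreal (measure K A) = ennreal (measure M A + measure N A)" by simp
    then have "measure K A = measure M A + measure N A"
      by (subst (asm) ennreal_inj) auto
    then show ?thesis by simp
  qed
  then show ?thesis using fK sK by blast
qed

text \<open>The square of the cutoff lies between the indicators of a closed \<open>F\<close> inside
  \<open>A\<close> and an open \<open>U\<close> around it. Every measure below \<open>K\<close>
  gives \<open>U - F\<close> mass less than \<open>\<epsilon>\<close>, so \<open>h\<close> can be
  fixed before \<open>M\<close>.\<close>

lemma cutoff_approx:
  fixes K :: "'a::metric_space measure"
  assumes K: "finite_measure K" "sets K = sets borel" and A: "A \<in> sets borel" and "\<epsilon> > 0"
  obtains h where "bounded_cont h" "\<And>x. 0 \<le> h x" "\<And>x. h x \<le> 1"
    "\<And>M. finite_measure M \<Longrightarrow> sets M = sets borel \<Longrightarrow> (\<And>A. A \<in> sets borel \<Longrightarrow> measure M A \<le> measure K A) \<Longrightarrow>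
       \<bar>(\<integral>x. (h x)\<^sup>2 \<partial>M) - measure M A\<bar> < \<epsilon>"
proof -
  obtain F U where FU: "closed F" "open U" "F \<subseteq> A" "A \<subseteq> U" "measure K (U - F) < \<epsilon>"
    using closed_open_regular[OF K A \<open>\<epsilon> > 0\<close>] by blast
  obtain h :: "'a \<Rightarrow> real" where h: "continuous_on UNIV h" "\<And>x. 0 \<le> h x" "\<And>x. h x \<le> 1"
    "\<And>x. x \<in> F \<Longrightarrow> h x = 1" "\<And>x. x \<notin> U \<Longrightarrow> h x = 0"
    using continuous_cutoff[OF FU(1,2) order_trans[OF FU(3,4)]] by metis
  have bh: "bounded_cont h" using h by (auto simp: bounded_cont_def intro!: exI[of _ 1])
  show ?thesis
  proof (rule that[OF bh h(2,3)])
    fix M assume M: "finite_measure M" "sets M = sets borel"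
      and MK: "\<And>A. A \<in> sets borel \<Longrightarrow> measure M A \<le> measure K A"
    interpret finite_measure M by fact
    have sp: "space M = UNIV" using sets_eq_imp_space_eq[OF M(2)] by simp
    have hh: "bounded_borel (\<lambda>x. (h x)\<^sup>2)"
      using bounded_borel_mult[OF bounded_cont_imp_borel[OF bh] bounded_cont_imp_borel[OF bh]]
      by (simp add: power2_eq_square)
    have FU_sets: "F \<in> sets borel" "U \<in> sets borel" "U - F \<in> sets borel" using FU by auto
    have ind: "integrable M (indicator D :: 'a \<Rightarrow> real)" "(\<integral>x. indicator D x \<partial>M) = measure M D" if "D \<in> sets borel" for D
      using integrable_bounded_borel[OF M bounded_borel_indicator[OF that]] sp by auto
    have 1: "measure M F \<le> (\<integral>x. (h x)\<^sup>2 \<partial>M)"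
    proof -
      have "(\<integral>x. indicator F x \<partial>M) \<le> (\<integral>x. (h x)\<^sup>2 \<partial>M)"
        by (intro integral_mono ind integrable_bounded_borel[OF M] hh)
           (use h FU_sets in \<open>auto simp: indicator_def\<close>)
      then show ?thesis using ind[OF FU_sets(1)] by simp
    qed
    have 2: "(\<integral>x. (h x)\<^sup>2 \<partial>M) \<le> measure M U"
    proof -
      have "(\<integral>x. (h x)\<^sup>2 \<partial>M) \<le> (\<integral>x. indicator U x \<partial>M)"
        by (intro integral_mono ind integrable_bounded_borel[OF M] hh)
           (use h FU_sets in \<open>auto simp: indicator_def intro: power_le_one\<close>)
      then show ?thesis using ind[OF FU_sets(2)] by simp
    qed
    have "measure M (U - F) = measure M U - measure M F"
      by (rule finite_measure_Diff) (use FU FU_sets M in auto)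
    then have 3: "measure M U - measure M F < \<epsilon>" using MK[OF FU_sets(3)] FU(5) by simp
    have "measure M F \<le> measure M A" "measure M A \<le> measure M U"
      by (rule finite_measure_mono; use FU FU_sets M A in auto)+
    then show "\<bar>(\<integral>x. (h x)\<^sup>2 \<partial>M) - measure M A\<bar> < \<epsilon>" using 1 2 3 by linarith
  qed
qed

lemma signed_measure_approx:
  fixes \<mu> \<mu>' :: "'a::metric_space set \<Rightarrow> real"
  assumes "finite_signed_measure \<mu>" "finite_signed_measure \<mu>'" and A: "A \<in> sets borel" and "\<epsilon> > 0"
  obtains h where "bounded_cont h" "\<bar>signed_integral \<mu> (\<lambda>x. (h x)\<^sup>2) - \<mu> A\<bar> < \<epsilon>"
    "\<bar>signed_integral \<mu>' (\<lambda>x. (h x)\<^sup>2) - \<mu>' A\<bar> < \<epsilon>"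
proof -
  obtain M N where d: "decomposes M N \<mu>" using assms by (auto simp: finite_signed_measure_def)
  obtain M' N' where d': "decomposes M' N' \<mu>'" using assms by (auto simp: finite_signed_measure_def)
  note D = d[unfolded decomposes_def] d'[unfolded decomposes_def]
  obtain K where K: "finite_measure K" "sets K = sets borel"
    "\<forall>A\<in>sets borel. measure M A \<le> measure K A \<and> measure N A \<le> measure K A"
    using dominating_finite_measure[of M N] D by blast
  obtain K' where K': "finite_measure K'" "sets K' = sets borel"
    "\<forall>A\<in>sets borel. measure M' A \<le> measure K' A \<and> measure N' A \<le> measure K' A"
    using dominating_finite_measure[of M' N'] D by blast
  obtain Q where Q: "finite_measure Q" "sets Q = sets borel"
    "\<forall>A\<in>sets borel. measure K A \<le> measure Q A \<and> measure K' A \<le> measure Q A"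
    using dominating_finite_measure[OF K(1,2) K'(1,2)] by blast
  \<comment> \<open>Each signed measure is a difference of two finite measures, each of which
    contributes an error of \<open>\<epsilon> / 2\<close>.\<close>
  have "\<epsilon> / 2 > 0" using \<open>\<epsilon> > 0\<close> by simp
  from cutoff_approx[OF Q(1,2) A this]
  obtain h where h: "bounded_cont h"
    "\<And>M. finite_measure M \<Longrightarrow> sets M = sets borel \<Longrightarrow> (\<And>A. A \<in> sets borel \<Longrightarrow> measure M A \<le> measure Q A) \<Longrightarrow>
       \<bar>(\<integral>x. (h x)\<^sup>2 \<partial>M) - measure M A\<bar> < \<epsilon> / 2" by metis
  have hh: "bounded_borel (\<lambda>x. (h x)\<^sup>2)"
    using bounded_borel_mult[OF bounded_cont_imp_borel[OF h(1)] bounded_cont_imp_borel[OF h(1)]]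
    by (simp add: power2_eq_square)
  have b: "\<bar>(\<integral>x. (h x)\<^sup>2 \<partial>M) - measure M A\<bar> < \<epsilon> / 2" "\<bar>(\<integral>x. (h x)\<^sup>2 \<partial>N) - measure N A\<bar> < \<epsilon> / 2"
    "\<bar>(\<integral>x. (h x)\<^sup>2 \<partial>M') - measure M' A\<bar> < \<epsilon> / 2" "\<bar>(\<integral>x. (h x)\<^sup>2 \<partial>N') - measure N' A\<bar> < \<epsilon> / 2"
    by (rule h(2); use D K K' Q in \<open>auto intro: order_trans\<close>)+
  show ?thesis
  proof (rule that[OF h(1)])
    show "\<bar>signed_integral \<mu> (\<lambda>x. (h x)\<^sup>2) - \<mu> A\<bar> < \<epsilon>"
    proof -
      have "\<mu> A = measure M A - measure N A" using D(1) A by blast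
      then show ?thesis unfolding signed_integral_eq[OF d hh] using b(1,2) by linarith
    qed
    show "\<bar>signed_integral \<mu>' (\<lambda>x. (h x)\<^sup>2) - \<mu>' A\<bar> < \<epsilon>"
    proof -
      have "\<mu>' A = measure M' A - measure N' A" using D(2) A by blast
      then show ?thesis unfolding signed_integral_eq[OF d' hh] using b(3,4) by linarith
    qed
  qed
qed

text \<open>Squares are convenient test functions: against the measure of a finite sum of fields
  \<open>fld S g f\<close>, the integral of \<open>h^2\<close> is the squared norm of that sum
  multiplied by \<open>h\<close>, which is available before positivity is known.\<close>

lemma signed_measure_nonneg:
  fixes \<mu> :: "'a::metric_space set \<Rightarrow> real"
  assumes "finite_signed_measure \<mu>" "A \<in> sets borel"
    and "\<And>h. bounded_cont h \<Longrightarrow> signed_integral \<mu> (\<lambda>x. (h x)\<^sup>2) \<ge> 0"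
  shows "\<mu> A \<ge> 0"
proof (rule ccontr)
  assume "\<not> \<mu> A \<ge> 0"
  then obtain h where "bounded_cont h" "\<bar>signed_integral \<mu> (\<lambda>x. (h x)\<^sup>2) - \<mu> A\<bar> < - \<mu> A"
    using signed_measure_approx[OF assms(1,1,2), of "- \<mu> A"] by auto
  with assms(3)[of h] show False by simp
qed

lemma signed_measure_unique:
  fixes \<mu> \<mu>' :: "'a::metric_space set \<Rightarrow> real"
  assumes "finite_signed_measure \<mu>" "finite_signed_measure \<mu>'" "A \<in> sets borel"
    and "\<And>h. bounded_cont h \<Longrightarrow> signed_integral \<mu> (\<lambda>x. (h x)\<^sup>2) = signed_integral \<mu>' (\<lambda>x. (h x)\<^sup>2)"
  shows "\<mu> A = \<mu>' A"
proof (rule ccontr)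
  assume "\<mu> A \<noteq> \<mu>' A"
  then have "\<bar>\<mu> A - \<mu>' A\<bar> / 2 > 0" by simp
  from signed_measure_approx[OF assms(1-3) this]
  obtain h where "bounded_cont h" "\<bar>signed_integral \<mu> (\<lambda>x. (h x)\<^sup>2) - \<mu> A\<bar> < \<bar>\<mu> A - \<mu>' A\<bar> / 2"
    "\<bar>signed_integral \<mu>' (\<lambda>x. (h x)\<^sup>2) - \<mu>' A\<bar> < \<bar>\<mu> A - \<mu>' A\<bar> / 2" by metis
  moreover have "\<bar>\<mu> A - \<mu>' A\<bar> \<le> \<bar>c - \<mu> A\<bar> + \<bar>c - \<mu>' A\<bar>" for c by linarith
  ultimately show False using assms(4)[OF \<open>bounded_cont h\<close>] by (smt (verit) field_sum_of_halves)
qed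

section \<open>The Hilbert space of fields on a compact space\<close>

text \<open>The support of the function one is the whole space, so the space is compact,
  \<open>Cc\<close> consists of all continuous functions, and every gradient is a field with
  constant coefficient one.\<close>

locale compact_form =
  fixes S :: "('a::{metric_space,second_countable_topology},
               'h::{real_inner,complete_space}) form_data"
  assumes fos: "first_order_structure S" and one: "(\<lambda>x. 1) \<in> core S"
begin

lemma adm: "admissible_form (form S) (core S)" and en: "energy_measures S"
  and hc: "hilbert_completion S" and fm: "field_measures S"
  using fos by (auto simp: first_order_structure_def)

lemma core_Cc: "f \<in> core S \<Longrightarrow> f \<in> Cc"
  using adm by (auto simp: admissible_form_def)

lemma core_add: "f \<in> core S \<Longrightarrow> g \<in> core S \<Longrightarrow> (\<lambda>x. f x + g x) \<in> core S"
  and core_mult: "f \<in> core S \<Longrightarrow> g \<in> core S \<Longrightarrow> (\<lambda>x. f x * g x) \<in> core S"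
  using adm by (auto simp: admissible_form_def)

lemma compact_UNIV: "compact (UNIV :: 'a set)"
  using core_Cc[OF one] by (simp add: Cc_def tsupp_def)

lemma Cc_iff: "g \<in> Cc \<longleftrightarrow> continuous_on (UNIV :: 'a set) g"
proof -
  have "compact (tsupp g)" for g :: "'a \<Rightarrow> real"
    using compact_Int_closed[OF compact_UNIV closed_closure] by (simp add: tsupp_def)
  then show ?thesis by (simp add: Cc_def)
qed

lemma Cc_bounded_cont: "(g :: 'a \<Rightarrow> real) \<in> Cc \<longleftrightarrow> bounded_cont g"
proof -
  have "\<exists>K. \<forall>x. \<bar>g x\<bar> \<le> K" if "continuous_on UNIV g"
  proof -
    have "bounded (range g)" using compact_continuous_image[OF that compact_UNIV] compact_imp_bounded by blast
    then show ?thesis by (auto simp: bounded_iff)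
  qed
  then show ?thesis by (auto simp: Cc_iff bounded_cont_def)
qed

lemma Cc_borel: "(g :: 'a \<Rightarrow> real) \<in> Cc \<Longrightarrow> bounded_borel g"
  by (simp add: Cc_bounded_cont bounded_cont_imp_borel)

lemma Cc_const: "(\<lambda>x::'a. c) \<in> Cc"
  and Cc_diff: "g \<in> Cc \<Longrightarrow> h \<in> Cc \<Longrightarrow> (\<lambda>x::'a. g x - h x) \<in> Cc"
  and Cc_mult: "g \<in> Cc \<Longrightarrow> h \<in> Cc \<Longrightarrow> (\<lambda>x::'a. g x * h x) \<in> Cc"
  by (auto simp: Cc_iff intro!: continuous_intros)

section \<open>Measures of pairs of fields and integrals against them\<close>

lemma hmeas_signed: "finite_signed_measure (hmeas S v w)"
  using fm by (auto simp: field_measures_def)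

lemma hmeas_bilinear: "A \<in> sets borel \<Longrightarrow> bounded_bilinear (\<lambda>v w. hmeas S v w A)"
  using fm by (auto simp: field_measures_def)

lemma emeas_signed: "f1 \<in> core S \<Longrightarrow> f2 \<in> core S \<Longrightarrow> finite_signed_measure (emeas S f1 f2)"
  using en by (auto simp: energy_measures_def)

lemma hmeas_fld:
  "g1 \<in> Cc \<Longrightarrow> g2 \<in> Cc \<Longrightarrow> f1 \<in> core S \<Longrightarrow> f2 \<in> core S \<Longrightarrow> A \<in> sets borel \<Longrightarrow>
   hmeas S (fld S g1 f1) (fld S g2 f2) A = signed_integral (emeas S f1 f2) (\<lambda>x. indicator A x * (g1 x * g2 x))"
  using fm unfolding field_measures_def by blast

lemma inner_fld:
  "g1 \<in> Cc \<Longrightarrow> g2 \<in> Cc \<Longrightarrow> f1 \<in> core S \<Longrightarrow> f2 \<in> core S \<Longrightarrow>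
   inner (fld S g1 f1) (fld S g2 f2) = signed_integral (emeas S f1 f2) (\<lambda>x. g1 x * g2 x)"
  using hc unfolding hilbert_completion_def by blast

text \<open>\<open>hint v w g\<close> is the integral of \<open>g\<close> against the signed measure \<open>\<nu>\<^sub>v\<^sub>,\<^sub>w\<close>.\<close>

definition hint :: "'h \<Rightarrow> 'h \<Rightarrow> ('a \<Rightarrow> real) \<Rightarrow> real" where
  "hint v w g = signed_integral (hmeas S v w) g"

lemma hmeas_add_left: "A \<in> sets borel \<Longrightarrow> hmeas S (v + v') w A = hmeas S v w A + hmeas S v' w A"
  and hmeas_add_right: "A \<in> sets borel \<Longrightarrow> hmeas S v (w + w') A = hmeas S v w A + hmeas S v w' A"
  using bounded_bilinear.add_left[OF hmeas_bilinear] bounded_bilinear.add_right[OF hmeas_bilinear] by auto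

lemma hmeas_tendsto:
  "A \<in> sets borel \<Longrightarrow> v \<longlonglongrightarrow> v' \<Longrightarrow> w \<longlonglongrightarrow> w' \<Longrightarrow> (\<lambda>n::nat. hmeas S (v n) (w n) A) \<longlonglongrightarrow> hmeas S v' w' A"
  by (rule bounded_bilinear.tendsto[OF hmeas_bilinear])

lemma hint_indicator: "A \<in> sets borel \<Longrightarrow> hint v w (indicator A) = hmeas S v w A"
  by (simp add: hint_def signed_integral_indicator hmeas_signed)

lemma hint_add: "bounded_borel f \<Longrightarrow> bounded_borel g \<Longrightarrow> hint v w (\<lambda>x. f x + g x) = hint v w f + hint v w g"
  by (simp add: hint_def signed_integral_add hmeas_signed)

lemma hint_cmult: "bounded_borel f \<Longrightarrow> hint v w (\<lambda>x. c * f x) = c * hint v w f"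
  by (simp add: hint_def signed_integral_cmult hmeas_signed)

lemma hint_tendsto:
  assumes "\<And>i::nat. bounded_borel (s i)" "bounded_borel f" "\<And>i x. \<bar>s i x\<bar> \<le> C" "\<And>x. (\<lambda>i. s i x) \<longlonglongrightarrow> f x"
  shows "(\<lambda>i. hint v w (s i)) \<longlonglongrightarrow> hint v w f"
  unfolding hint_def by (rule signed_integral_tendsto[OF hmeas_signed assms])

text \<open>Bilinearity of \<open>hmeas\<close> is given set by set, that is, for indicators;
  induction on the integrand transfers it to bounded Borel functions. The next lemmas follow the
  same pattern.\<close>

lemma hint_add_left:
  assumes "bounded_borel g"
  shows "hint (v + v') w g = hint v w g + hint v' w g"
  using assms
proof (induction g rule: bounded_borel_induct)
  case (indicator A)
  then show ?case using bounded_bilinear.add_left[OF hmeas_bilinear] by (simp add: hint_indicator)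
next
  case (lim s f C)
  show ?case
    by (rule LIMSEQ_unique[OF hint_tendsto[OF lim.hyps]])
       (unfold lim.IH, intro tendsto_add hint_tendsto[OF lim.hyps])
qed (auto simp: hint_add hint_cmult algebra_simps)

lemma hint_add_right:
  assumes "bounded_borel g"
  shows "hint v (w + w') g = hint v w g + hint v w' g"
  using assms
proof (induction g rule: bounded_borel_induct)
  case (indicator A)
  then show ?case using bounded_bilinear.add_right[OF hmeas_bilinear] by (simp add: hint_indicator)
next
  case (lim s f C)
  show ?case
    by (rule LIMSEQ_unique[OF hint_tendsto[OF lim.hyps]])
       (unfold lim.IH, intro tendsto_add hint_tendsto[OF lim.hyps])
qed (auto simp: hint_add hint_cmult algebra_simps)

lemma hint_scale_left:
  assumes "bounded_borel g"
  shows "hint (c *\<^sub>R v) w g = c * hint v w g"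
  using assms
proof (induction g rule: bounded_borel_induct)
  case (indicator A)
  then show ?case using bounded_bilinear.scaleR_left[OF hmeas_bilinear] by (simp add: hint_indicator)
next
  case (lim s f C)
  show ?case
    by (rule LIMSEQ_unique[OF hint_tendsto[OF lim.hyps]])
       (unfold lim.IH, intro tendsto_mult tendsto_const hint_tendsto[OF lim.hyps])
qed (auto simp: hint_add hint_cmult algebra_simps)

lemma hint_fld:
  assumes "g1 \<in> Cc" "g2 \<in> Cc" "f1 \<in> core S" "f2 \<in> core S" and g: "bounded_borel g"
  shows "hint (fld S g1 f1) (fld S g2 f2) g = signed_integral (emeas S f1 f2) (\<lambda>x. g x * (g1 x * g2 x))"
  using g
proof (induction g rule: bounded_borel_induct)
  have gg: "bounded_borel (\<lambda>x. g1 x * g2 x)" using assms by (intro bounded_borel_mult Cc_borel)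
  note e = emeas_signed[OF assms(3,4)]
  {
    case (indicator A)
    then show ?case by (simp add: hint_indicator hmeas_fld assms)
  next
    case (add f g)
    then show ?case
      using signed_integral_add[OF e bounded_borel_mult[OF add(1) gg] bounded_borel_mult[OF add(2) gg]]
      by (simp add: hint_add algebra_simps)
  next
    case (cmult f c)
    then show ?case
      using signed_integral_cmult[OF e bounded_borel_mult[OF cmult(1) gg]]
      by (simp add: hint_cmult algebra_simps)
  next
    case (lim s f C)
    obtain K where K: "\<And>x. \<bar>g1 x * g2 x\<bar> \<le> K" using gg by (auto simp: bounded_borel_def)
    have "(\<lambda>i. signed_integral (emeas S f1 f2) (\<lambda>x. s i x * (g1 x * g2 x)))
        \<longlonglongrightarrow> signed_integral (emeas S f1 f2) (\<lambda>x. f x * (g1 x * g2 x))"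
    proof (rule signed_integral_tendsto[OF e, of _ _ "C * K"])
      show "\<bar>s i x * (g1 x * g2 x)\<bar> \<le> C * K" for i x
        using lim(3)[of i x] K[of x] unfolding abs_mult[of "s i x"]
        by (intro mult_mono) (auto intro: order_trans[OF abs_ge_zero])
      show "(\<lambda>i. s i x * (g1 x * g2 x)) \<longlonglongrightarrow> f x * (g1 x * g2 x)" for x
        by (intro tendsto_intros lim(4))
    qed (intro bounded_borel_mult lim(1,2) gg)+
    then show ?case by (intro LIMSEQ_unique[OF hint_tendsto[OF lim.hyps]]) (simp only: lim.IH)
  }
qed

text \<open>The integrand is split so that each factor enters one field. With \<open>g = k\<close>
  this produces Gram matrices, hence positivity; with \<open>k = 1\<close> it produces
  multiplication by \<open>g\<close>.\<close>

lemma hint_fld_Cc: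
  assumes "g1 \<in> Cc" "g2 \<in> Cc" "f1 \<in> core S" "f2 \<in> core S" "g \<in> Cc" "k \<in> Cc"
  shows "hint (fld S g1 f1) (fld S g2 f2) (\<lambda>x. g x * k x) = inner (fld S (\<lambda>x. g x * g1 x) f1) (fld S (\<lambda>x. k x * g2 x) f2)"
  using assms by (simp add: hint_fld inner_fld Cc_mult bounded_borel_mult Cc_borel mult_ac)

section \<open>Density of the simple fields\<close>

lemma fld_in_simple: "g \<in> Cc \<Longrightarrow> f \<in> core S \<Longrightarrow> (\<lambda>z. avg g z * d_u f z) \<in> simple_fields S"
  unfolding simple_fields_def mem_Collect_eq
  by (intro exI[of _ 1] exI[of _ "\<lambda>_. g"] exI[of _ "\<lambda>_. f"]) auto

lemma cls_add: "F \<in> simple_fields S \<Longrightarrow> G \<in> simple_fields S \<Longrightarrow> cls S (\<lambda>z. F z + G z) = cls S F + cls S G"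
  and cls_cmult: "F \<in> simple_fields S \<Longrightarrow> cls S (\<lambda>z. c * F z) = c *\<^sub>R cls S F"
  and cls_dense: "closure (cls S ` simple_fields S) = UNIV"
  using conjunct1[OF hc[unfolded hilbert_completion_def]]
    conjunct1[OF conjunct2[OF hc[unfolded hilbert_completion_def]]]
    conjunct2[OF conjunct2[OF conjunct2[OF hc[unfolded hilbert_completion_def]]]] by simp_all

lemma cls_simple:
  assumes "\<And>i. i < n \<Longrightarrow> g i \<in> Cc" "\<And>i. i < n \<Longrightarrow> f i \<in> core S"
  shows "cls S (\<lambda>z. \<Sum>i<(n::nat). avg (g i) z * d_u (f i) z) = (\<Sum>i<n. fld S (g i) (f i))"
  using assms
proof (induction n)
  case 0
  have "cls S (\<lambda>z. 0 * (avg (\<lambda>x. 1) z * d_u (\<lambda>x. 1) z)) = 0"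
    by (subst cls_cmult[OF fld_in_simple[OF Cc_const one]]) simp
  then show ?case by simp
next
  case (Suc n)
  have "(\<lambda>z. \<Sum>i<n. avg (g i) z * d_u (f i) z) \<in> simple_fields S"
    using Suc.prems unfolding simple_fields_def mem_Collect_eq
    by (intro exI[of _ n] exI[of _ g] exI[of _ f]) auto
  moreover have "(\<lambda>z. avg (g n) z * d_u (f n) z) \<in> simple_fields S"
    using Suc.prems by (intro fld_in_simple) auto
  ultimately show ?case using Suc by (simp add: cls_add fld_def)
qed

lemma simple_approx:
  obtains v where "\<And>k::nat. \<exists>n g f. (\<forall>i<n. g i \<in> Cc \<and> f i \<in> core S) \<and> v k = (\<Sum>i<(n::nat). fld S (g i) (f i))" "v \<longlonglongrightarrow> w"
proof -
  have "w \<in> closure (cls S ` simple_fields S)" using cls_dense by simp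
  then obtain v where v: "\<And>k. v k \<in> cls S ` simple_fields S" "v \<longlonglongrightarrow> w"
    unfolding closure_sequential by blast
  have "\<exists>n g f. (\<forall>i<n. g i \<in> Cc \<and> f i \<in> core S) \<and> v k = (\<Sum>i<(n::nat). fld S (g i) (f i))" for k
  proof -
    obtain F where F: "F \<in> simple_fields S" "v k = cls S F" using v(1) by blast
    obtain n g f where "\<forall>i<n. g i \<in> Cc \<and> f i \<in> core S" "F = (\<lambda>z. \<Sum>i<(n::nat). avg (g i) z * d_u (f i) z)"
      using F(1) unfolding simple_fields_def by blast
    moreover have "cls S F = (\<Sum>i<n. fld S (g i) (f i))"
      unfolding calculation(2) by (rule cls_simple) (use calculation(1) in auto)
    ultimately show ?thesis unfolding F(2) by blast
  qed
  then show ?thesis by (rule that[OF _ v(2)])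
qed

text \<open>The fields \<open>fld S g f\<close> span a dense subspace, and scalar factors are
  absorbed into \<open>g\<close>, so additivity and closedness under limits reduce a property to
  them.\<close>

lemma field_induct [case_names fld add lim]:
  assumes fld: "\<And>g f. g \<in> Cc \<Longrightarrow> f \<in> core S \<Longrightarrow> P (fld S g f)"
    and add: "\<And>v w. P v \<Longrightarrow> P w \<Longrightarrow> P (v + w)"
    and lim: "\<And>v w. (\<And>n::nat. P (v n)) \<Longrightarrow> v \<longlonglongrightarrow> w \<Longrightarrow> P w"
  shows "P v"
proof -
  have P0: "P 0"
  proof -
    have "fld S (\<lambda>x. 0) (\<lambda>x. 1) = cls S (\<lambda>z. 0 * (avg (\<lambda>x. 1) z * d_u (\<lambda>x. 1) z))"
      by (simp add: fld_def avg_def d_u_def case_prod_unfold)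
    also have "\<dots> = 0" by (subst cls_cmult[OF fld_in_simple[OF Cc_const one]]) simp
    finally show ?thesis using fld[OF Cc_const one, of 0] by simp
  qed
  have Ps: "P (\<Sum>i<(n::nat). fld S (g i) (f i))" if "\<forall>i<n. g i \<in> Cc \<and> f i \<in> core S" for n g f
    using that by (induction n) (auto simp: P0 fld add)
  obtain u where u: "\<And>k::nat. \<exists>n g f. (\<forall>i<n. g i \<in> Cc \<and> f i \<in> core S) \<and> u k = (\<Sum>i<(n::nat). fld S (g i) (f i))" "u \<longlonglongrightarrow> v"
    using simple_approx by blast
  have "P (u k)" for k using u(1)[of k] Ps by auto
  then show ?thesis using lim u(2) by blast
qed

lemma hint_sum_left: "bounded_borel g \<Longrightarrow> hint (\<Sum>i<(n::nat). v i) w g = (\<Sum>i<n. hint (v i) w g)"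
  by (induction n) (auto simp: hint_add_left hint_scale_left[of g 0 0, simplified])

lemma hint_zero_right: "bounded_borel g \<Longrightarrow> hint v 0 g = 0"
  using hint_add_right[of g v 0 0] by simp

lemma hint_sum_right: "bounded_borel g \<Longrightarrow> hint v (\<Sum>i<(n::nat). w i) g = (\<Sum>i<n. hint v (w i) g)"
  by (induction n) (auto simp: hint_add_right hint_zero_right)

section \<open>Positivity, symmetry and total mass of the field measures\<close>

text \<open>Positivity on the diagonal is quadratic in \<open>v\<close> and does not pass from two
  fields to their sum. It is therefore proved for entire finite sums, where the integral of
  \<open>h^2\<close> is a squared norm, before passing to the limit.\<close>

lemma hmeas_nonneg:
  assumes A: "A \<in> sets borel"
  shows "hmeas S v v A \<ge> 0"
proof -
  obtain u where u: "\<And>k::nat. \<exists>n g f. (\<forall>i<n. g i \<in> Cc \<and> f i \<in> core S) \<and> u k = (\<Sum>i<(n::nat). fld S (g i) (f i))" "u \<longlonglongrightarrow> v"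
    using simple_approx by blast
  have "hmeas S (u k) (u k) A \<ge> 0" for k
  proof (rule signed_measure_nonneg[OF hmeas_signed A])
    fix h :: "'a \<Rightarrow> real" assume "bounded_cont h"
    then have h: "h \<in> Cc" by (simp add: Cc_bounded_cont)
    obtain n g f where gf: "\<forall>i<n. g i \<in> Cc \<and> f i \<in> core S" "u k = (\<Sum>i<(n::nat). fld S (g i) (f i))"
      using u(1) by blast
    have b: "bounded_borel (\<lambda>x. h x * h x)" using h by (intro Cc_borel Cc_mult)
    have "hint (u k) (u k) (\<lambda>x. h x * h x) = (\<Sum>i<n. \<Sum>j<n. hint (fld S (g i) (f i)) (fld S (g j) (f j)) (\<lambda>x. h x * h x))"
      unfolding gf(2) hint_sum_left[OF b] hint_sum_right[OF b] by (rule sum.swap)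
    also have "\<dots> = (\<Sum>i<n. \<Sum>j<n. inner (fld S (\<lambda>x. h x * g i x) (f i)) (fld S (\<lambda>x. h x * g j x) (f j)))"
      using gf(1) h by (intro sum.cong refl hint_fld_Cc) auto
    also have "\<dots> = inner (\<Sum>i<n. fld S (\<lambda>x. h x * g i x) (f i)) (\<Sum>i<n. fld S (\<lambda>x. h x * g i x) (f i))"
      unfolding inner_sum_left inner_sum_right by (rule sum.swap)
    also have "\<dots> \<ge> 0" by simp
    finally show "signed_integral (hmeas S (u k) (u k)) (\<lambda>x. (h x)\<^sup>2) \<ge> 0"
      by (simp add: hint_def power2_eq_square)
  qed
  moreover have "(\<lambda>k. hmeas S (u k) (u k) A) \<longlonglongrightarrow> hmeas S v v A"
    by (rule bounded_bilinear.tendsto[OF hmeas_bilinear[OF A] u(2) u(2)])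
  ultimately show ?thesis by (intro LIMSEQ_le_const) auto
qed

lemma hmeas_sym:
  assumes A: "A \<in> sets borel"
  shows "hmeas S v w A = hmeas S w v A"
proof (induction v rule: field_induct)
  case (fld g f)
  show ?case
  proof (induction w rule: field_induct)
    case (fld g' f')
    show ?case
    proof (rule signed_measure_unique[OF hmeas_signed hmeas_signed A])
      fix h :: "'a \<Rightarrow> real" assume "bounded_cont h"
      then have h: "h \<in> Cc" by (simp add: Cc_bounded_cont)
      show "signed_integral (hmeas S (fld S g f) (fld S g' f')) (\<lambda>x. (h x)\<^sup>2) =
         signed_integral (hmeas S (fld S g' f') (fld S g f)) (\<lambda>x. (h x)\<^sup>2)"
        using hint_fld_Cc[of g g' f f' h h] hint_fld_Cc[of g' g f' f h h] h fld \<open>g \<in> Cc\<close> \<open>f \<in> core S\<close>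
        by (simp add: hint_def power2_eq_square inner_commute)
    qed
  next
    case (add v w)
    then show ?case by (simp add: A hmeas_add_left hmeas_add_right)
  next
    case (lim v w)
    show ?case
      using hmeas_tendsto[OF A tendsto_const lim(2), of "fld S g f"]
        hmeas_tendsto[OF A lim(2) tendsto_const, of "fld S g f"]
      unfolding lim(1) by (rule LIMSEQ_unique)
  qed
next
  case (add v v')
  then show ?case by (simp add: A hmeas_add_left hmeas_add_right)
next
  case (lim v v')
  show ?case
    using hmeas_tendsto[OF A lim(2) tendsto_const, of w] hmeas_tendsto[OF A tendsto_const lim(2), of w]
    unfolding lim(1) by (rule LIMSEQ_unique)
qed

lemma hmeas_UNIV: "hmeas S v w UNIV = inner v w"
proof -
  have U: "(UNIV :: 'a set) \<in> sets borel" by simp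
  show ?thesis
proof (induction v rule: field_induct)
  case (fld g f)
  show ?case
  proof (induction w rule: field_induct)
    case (fld g' f')
    then show ?case using \<open>g \<in> Cc\<close> \<open>f \<in> core S\<close> by (simp add: hmeas_fld inner_fld)
  next
    case (add v w)
    then show ?case by (simp add: hmeas_add_right inner_add_right)
  next
    case (lim v w)
    have "(\<lambda>n. inner (fld S g f) (v n)) \<longlonglongrightarrow> hmeas S (fld S g f) w UNIV"
      using hmeas_tendsto[OF U tendsto_const lim(2), of "fld S g f"] unfolding lim(1) .
    moreover have "(\<lambda>n. inner (fld S g f) (v n)) \<longlonglongrightarrow> inner (fld S g f) w"
      by (intro tendsto_intros lim(2))
    ultimately show ?case by (rule LIMSEQ_unique)
  qed
next
  case (add v v')
  then show ?case by (simp add: hmeas_add_left inner_add_left)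
next
  case (lim v v')
  have "(\<lambda>n. inner (v n) w) \<longlonglongrightarrow> hmeas S v' w UNIV"
    using hmeas_tendsto[OF U lim(2) tendsto_const, of w] unfolding lim(1) .
  moreover have "(\<lambda>n. inner (v n) w) \<longlonglongrightarrow> inner v' w"
    by (intro tendsto_intros lim(2))
  ultimately show ?case by (rule LIMSEQ_unique)
qed
qed

text \<open>\<open>ennreal\<close> sends negative numbers to zero, so it is positivity that gives
  \<open>vmeas\<close> the values of \<open>hmeas S v v\<close>. Countable additivity comes from a
  decomposition into two finite measures.\<close>

lemma
  shows sets_vmeas: "sets (vmeas S v) = sets borel"
    and emeasure_vmeas: "A \<in> sets borel \<Longrightarrow> emeasure (vmeas S v) A = ennreal (hmeas S v v A)"
proof -
  show "sets (vmeas S v) = sets borel"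
    unfolding vmeas_def to_measure_def using sets.sets_measure_of_eq[of borel] by simp
  obtain M N where d: "decomposes M N (hmeas S v v)" using hmeas_signed[of v v] unfolding finite_signed_measure_def by blast
  note D = d[unfolded decomposes_def]
  interpret M: finite_measure M using D by simp
  interpret N: finite_measure N using D by simp
  show "emeasure (vmeas S v) A = ennreal (hmeas S v v A)" if "A \<in> sets borel"
    unfolding vmeas_def to_measure_def
  proof (rule emeasure_measure_of_sigma)
    show "sigma_algebra UNIV (sets (borel :: 'a measure))"
      using sets.sigma_algebra_axioms[of "borel :: 'a measure"] by simp
    show "positive (sets borel) (\<lambda>A. ennreal (hmeas S v v A))"
      using D by (simp add: positive_def)
    show "countably_additive (sets borel) (\<lambda>A. ennreal (hmeas S v v A))"
      unfolding countably_additive_def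
    proof safe
      fix A :: "nat \<Rightarrow> 'a set"
      assume A: "range A \<subseteq> sets borel" "disjoint_family A" "\<Union> (range A) \<in> sets borel"
      have "(\<lambda>i. measure M (A i) - measure N (A i)) sums (measure M (\<Union> (range A)) - measure N (\<Union> (range A)))"
        by (intro sums_diff M.finite_measure_UNION N.finite_measure_UNION) (use A D in auto)
      moreover have "hmeas S v v (A i) = measure M (A i) - measure N (A i)" for i using A D by auto
      ultimately have "(\<lambda>i. hmeas S v v (A i)) sums hmeas S v v (\<Union> (range A))" using A D by auto
      moreover have "\<And>i. hmeas S v v (A i) \<ge> 0" "hmeas S v v (\<Union> (range A)) \<ge> 0"
        using A by (auto intro: hmeas_nonneg)
      ultimately show "(\<Sum>i. ennreal (hmeas S v v (A i))) = ennreal (hmeas S v v (\<Union> (range A)))"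
        by (intro sums_unique[symmetric]) simp
    qed
  qed (rule that)
qed

lemma space_vmeas: "space (vmeas S v) = UNIV"
  using sets_eq_imp_space_eq[OF sets_vmeas, of v] by simp

lemma finite_vmeas: "finite_measure (vmeas S v)"
  by (rule finite_measureI) (simp add: space_vmeas emeasure_vmeas)

lemma measure_vmeas: "A \<in> sets borel \<Longrightarrow> measure (vmeas S v) A = hmeas S v v A"
  by (simp add: measure_def emeasure_vmeas hmeas_nonneg)

lemma hint_vmeas:
  assumes "bounded_borel g"
  shows "hint v v g = (\<integral>x. g x \<partial>(vmeas S v))"
proof -
  have "finite_measure (null_measure (borel :: 'a measure))" by (rule finite_measureI) simp
  then have "decomposes (vmeas S v) (null_measure borel) (hmeas S v v)"
    by (simp add: decomposes_def finite_vmeas sets_vmeas measure_vmeas)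
  from signed_integral_eq[OF this assms] show ?thesis by (simp add: hint_def)
qed

lemma integrable_vmeas: "bounded_borel g \<Longrightarrow> integrable (vmeas S v) g"
  by (rule integrable_bounded_borel[OF finite_vmeas sets_vmeas])

lemma hint_nonneg: "bounded_borel g \<Longrightarrow> (\<And>x. g x \<ge> 0) \<Longrightarrow> hint v v g \<ge> 0"
  by (simp add: hint_vmeas Bochner_Integration.integral_nonneg)

lemma hint_one: "hint v w (\<lambda>x. 1) = inner v w"
  using hint_indicator[of UNIV v w] by (simp add: hmeas_UNIV)

lemma hint_le:
  assumes "bounded_borel g" "\<And>x. g x \<le> K"
  shows "hint v v g \<le> K * (norm v)\<^sup>2"
proof -
  have "hint v v g \<le> (\<integral>x. K * 1 \<partial>(vmeas S v))"
    unfolding hint_vmeas[OF assms(1)]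
    by (intro integral_mono integrable_vmeas assms bounded_borel_const) (simp add: assms)
  also have "\<dots> = K * hint v v (\<lambda>x. 1)"
    using hint_vmeas[OF bounded_borel_const, of v 1] by simp
  finally show ?thesis by (simp add: hint_one dot_square_norm)
qed

lemma hint_sym: "hint v w g = hint w v g"
  unfolding hint_def by (rule signed_integral_cong[OF hmeas_sym])

lemma hint_scale_right: "bounded_borel g \<Longrightarrow> hint v (c *\<^sub>R w) g = c * hint v w g"
  by (rule trans[OF hint_sym trans[OF hint_scale_left]]) (simp_all only: hint_sym[of w v])

section \<open>Cauchy-Schwarz inequality and boundedness of the integrals\<close>

lemma hint_Cauchy_Schwarz:
  assumes g: "bounded_borel g" "\<And>x. g x \<ge> 0"
  shows "(hint v w g)\<^sup>2 \<le> hint v v g * hint w w g"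
proof (rule quadratic_nonneg_imp)
  fix t :: real
  have "0 \<le> hint (v + t *\<^sub>R w) (v + t *\<^sub>R w) g" by (rule hint_nonneg[OF g])
  also have "\<dots> = hint v v g + 2 * t * hint v w g + t\<^sup>2 * hint w w g"
    using hint_sym[of w v g] g(1)
    by (simp add: hint_add_left hint_add_right hint_scale_left hint_scale_right power2_eq_square algebra_simps)
  finally show "0 \<le> hint v v g + 2 * t * hint v w g + t\<^sup>2 * hint w w g" .
qed

text \<open>Cauchy-Schwarz asks for a nonnegative weight. Shifting \<open>g\<close> by
  \<open>K\<close> gives a weight between 0 and \<open>2 * K\<close>, and removing the shift costs
  another \<open>K\<close> times the norms, whence the factor 3.\<close>

lemma hint_bound:
  assumes g: "bounded_borel g" and K: "\<And>x. \<bar>g x\<bar> \<le> K"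
  shows "\<bar>hint v w g\<bar> \<le> 3 * K * (norm v * norm w)"
proof -
  have K0: "K \<ge> 0" using K[of undefined] by linarith
  have gK: "bounded_borel (\<lambda>x. g x + K)" by (intro bounded_borel_add g bounded_borel_const)
  have n: "g x + K \<ge> 0" for x using K[of x] by linarith
  have le: "g x + K \<le> 2 * K" for x using K[of x] by linarith
  have "(hint v w (\<lambda>x. g x + K))\<^sup>2 \<le> hint v v (\<lambda>x. g x + K) * hint w w (\<lambda>x. g x + K)"
    by (rule hint_Cauchy_Schwarz[OF gK n])
  also have "\<dots> \<le> (2 * K * (norm v)\<^sup>2) * (2 * K * (norm w)\<^sup>2)"
    by (intro mult_mono hint_le[OF gK le] hint_nonneg[OF gK n]) (use K0 in auto)
  also have "\<dots> = (2 * K * (norm v * norm w))\<^sup>2" by (simp add: power2_eq_square)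
  finally have 1: "\<bar>hint v w (\<lambda>x. g x + K)\<bar> \<le> 2 * K * (norm v * norm w)"
    using K0 by (intro power2_le_imp_le[of "\<bar>hint v w (\<lambda>x. g x + K)\<bar>"]) (auto)
  have "hint v w (\<lambda>x. K) = K * inner v w"
    using hint_cmult[OF bounded_borel_const, of v w K 1] by (simp add: hint_one)
  then have "hint v w (\<lambda>x. g x + K) = hint v w g + K * inner v w"
    by (simp add: hint_add[OF g bounded_borel_const])
  moreover have "\<bar>K * inner v w\<bar> \<le> K * (norm v * norm w)"
    using K0 Cauchy_Schwarz_ineq2[of v w] by (simp add: abs_mult mult_left_mono)
  ultimately show ?thesis using 1 by simp
qed

lemma hint_bilinear:
  assumes g: "bounded_borel g"
  shows "bounded_bilinear (\<lambda>v w. hint v w g)"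
proof
  obtain K where K: "\<And>x. \<bar>g x\<bar> \<le> K" using g by (auto simp: bounded_borel_def)
  show "\<exists>K. \<forall>a b. norm (hint a b g) \<le> norm a * norm b * K"
    using hint_bound[OF g K] by (intro exI[of _ "3 * K"]) (simp add: mult_ac)
qed (auto simp: hint_add_left hint_add_right hint_scale_left hint_scale_right g)

section \<open>Multiplication operators and the isometry into the space of fields\<close>

text \<open>For \<open>fld S h f\<close> the representing vector is explicit, namely the field with
  coefficient \<open>g x * h x\<close>. Sums of representing vectors represent sums, and boundedness
  of \<open>hint\<close> makes the representing vectors of a convergent sequence Cauchy, so
  completeness supplies the limit.\<close>

lemma mop_ex:
  assumes g: "g \<in> Cc"
  shows "\<exists>t. \<forall>w. inner t w = hint v w g"
proof (induction v rule: field_induct)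
  case (fld h f)
  have "inner (fld S (\<lambda>x. g x * h x) f) w = hint (fld S h f) w g" for w
  proof (induction w rule: field_induct)
    case (fld h' f')
    then show ?case
      using hint_fld_Cc[of h h' f f' g "\<lambda>x. 1"] \<open>h \<in> Cc\<close> \<open>f \<in> core S\<close> g Cc_const by simp
  next
    case (add v w)
    then show ?case by (simp add: inner_add_right hint_add_right Cc_borel g)
  next
    case (lim v w)
    have "(\<lambda>n. inner (fld S (\<lambda>x. g x * h x) f) (v n)) \<longlonglongrightarrow> inner (fld S (\<lambda>x. g x * h x) f) w"
      by (intro tendsto_intros lim(2))
    moreover have "(\<lambda>n. hint (fld S h f) (v n) g) \<longlonglongrightarrow> hint (fld S h f) w g"
      by (rule bounded_bilinear.tendsto[OF hint_bilinear[OF Cc_borel[OF g]] tendsto_const lim(2)])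
    ultimately show ?case unfolding lim(1) by (rule LIMSEQ_unique)
  qed
  then show ?case by blast
next
  case (add v v')
  then obtain t t' where "\<forall>w. inner t w = hint v w g" "\<forall>w. inner t' w = hint v' w g" by blast
  then have "\<forall>w. inner (t + t') w = hint (v + v') w g"
    by (simp add: inner_add_left hint_add_left Cc_borel g)
  then show ?case by blast
next
  case (lim v v')
  then obtain t where t: "\<And>n w. inner (t n) w = hint (v n) w g" by metis
  interpret bb: bounded_bilinear "\<lambda>v w. hint v w g" by (rule hint_bilinear[OF Cc_borel[OF g]])
  obtain K where K: "K > 0" "\<And>a b. norm (hint a b g) \<le> norm a * norm b * K" using bb.pos_bounded by blast
  have le: "norm (t m - t n) \<le> K * norm (v m - v n)" for m n
  proof -
    have "(norm (t m - t n))\<^sup>2 = inner (t m) (t m - t n) - inner (t n) (t m - t n)"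
      by (simp add: dot_square_norm[symmetric] inner_diff_left)
    also have "\<dots> = hint (v m - v n) (t m - t n) g" by (simp only: t bb.diff_left)
    also have "\<dots> \<le> norm (v m - v n) * norm (t m - t n) * K" using K(2)[of "v m - v n" "t m - t n"] by simp
    finally have "norm (t m - t n) * norm (t m - t n) \<le> (K * norm (v m - v n)) * norm (t m - t n)"
      by (simp add: power2_eq_square mult_ac)
    then show ?thesis
      using K(1) by (cases "norm (t m - t n) = 0") (simp_all add: mult_le_cancel_right)
  qed
  have "Cauchy t"
    unfolding Cauchy_iff
  proof safe
    fix e :: real assume "e > 0"
    then have "e / K > 0" using K by simp
    then obtain M where M: "\<forall>m\<ge>M. \<forall>n\<ge>M. norm (v m - v n) < e / K"
      using LIMSEQ_imp_Cauchy[OF lim(2)] unfolding Cauchy_iff by blast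
    have "norm (t m - t n) < e" if "m \<ge> M" "n \<ge> M" for m n
    proof -
      have "K * norm (v m - v n) < e"
        using M that K(1) by (simp add: pos_less_divide_eq mult.commute)
      with le[of m n] show ?thesis by linarith
    qed
    then show "\<exists>M. \<forall>m\<ge>M. \<forall>n\<ge>M. norm (t m - t n) < e" by blast
  qed
  then obtain t' where t': "t \<longlonglongrightarrow> t'" using Cauchy_convergent convergent_def by blast
  have "inner t' w = hint v' w g" for w
  proof -
    have "(\<lambda>n. inner (t n) w) \<longlonglongrightarrow> inner t' w" by (intro tendsto_intros t')
    moreover have "(\<lambda>n. hint (v n) w g) \<longlonglongrightarrow> hint v' w g" by (rule bb.tendsto[OF lim(2) tendsto_const])
    ultimately show ?thesis unfolding t by (rule LIMSEQ_unique)
  qed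
  then show ?case by blast
qed

text \<open>Multiplication by \<open>g\<close>, described by duality so that linearity, boundedness
  and self-adjointness can be read off from the measures.\<close>

definition mop :: "('a \<Rightarrow> real) \<Rightarrow> 'h \<Rightarrow> 'h" where
  "mop g v = (SOME t. \<forall>w. inner t w = hint v w g)"

lemma inner_mop: "g \<in> Cc \<Longrightarrow> inner (mop g v) w = hint v w g"
  using someI_ex[OF mop_ex, of g v] unfolding mop_def by blast

lemma mop_eqI: "g \<in> Cc \<Longrightarrow> (\<And>w. inner t w = hint v w g) \<Longrightarrow> mop g v = t"
  using vector_eq_rdot[of "mop g v" t] by (simp add: inner_mop)

lemma mop_bounded_linear:
  assumes g: "g \<in> Cc"
  shows "bounded_linear (mop g)"
proof -
  interpret bb: bounded_bilinear "\<lambda>v w. hint v w g" by (rule hint_bilinear[OF Cc_borel[OF g]])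
  obtain K where K: "K > 0" "\<And>a b. norm (hint a b g) \<le> norm a * norm b * K" using bb.pos_bounded by blast
  show ?thesis
  proof (rule bounded_linear_intro)
    show "mop g (v + w) = mop g v + mop g w" for v w
      by (rule mop_eqI[OF g]) (simp add: inner_add_left inner_mop g bb.add_left)
    show "mop g (c *\<^sub>R v) = c *\<^sub>R mop g v" for c v
      by (rule mop_eqI[OF g]) (simp add: inner_mop g bb.scaleR_left)
    show "norm (mop g v) \<le> norm v * K" for v
    proof -
      have "(norm (mop g v))\<^sup>2 = hint v (mop g v) g" by (simp add: dot_square_norm[symmetric] inner_mop g)
      also have "\<dots> \<le> norm v * norm (mop g v) * K" using K(2)[of v "mop g v"] by simp
      finally have "norm (mop g v) * norm (mop g v) \<le> (norm v * K) * norm (mop g v)"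
        by (simp add: power2_eq_square mult_ac)
      then show ?thesis
        using K(1) by (cases "norm (mop g v) = 0") (simp_all add: mult_le_cancel_right)
    qed
  qed
qed

lemma mop_tendsto: "g \<in> Cc \<Longrightarrow> v \<longlonglongrightarrow> v' \<Longrightarrow> (\<lambda>n::nat. mop g (v n)) \<longlonglongrightarrow> mop g v'"
  by (rule bounded_linear.tendsto[OF mop_bounded_linear])

lemma mop_add_right: "g \<in> Cc \<Longrightarrow> mop g (v + w) = mop g v + mop g w"
  using bounded_linear.linear[OF mop_bounded_linear] by (auto simp: linear_add)

lemma mop_fld:
  assumes "g \<in> Cc" "h \<in> Cc" "f \<in> core S"
  shows "mop g (fld S h f) = fld S (\<lambda>x. g x * h x) f"
proof (rule mop_eqI[OF assms(1)])
  fix w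
  show "inner (fld S (\<lambda>x. g x * h x) f) w = hint (fld S h f) w g"
  proof (induction w rule: field_induct)
    case (fld h' f')
    then show ?case
      using hint_fld_Cc[of h h' f f' g "\<lambda>x. 1"] assms Cc_const by simp
  next
    case (add v w)
    then show ?case by (simp add: inner_add_right hint_add_right Cc_borel assms)
  next
    case (lim v w)
    have "(\<lambda>n. inner (fld S (\<lambda>x. g x * h x) f) (v n)) \<longlonglongrightarrow> inner (fld S (\<lambda>x. g x * h x) f) w"
      by (intro tendsto_intros lim(2))
    moreover have "(\<lambda>n. hint (fld S h f) (v n) g) \<longlonglongrightarrow> hint (fld S h f) w g"
      by (rule bounded_bilinear.tendsto[OF hint_bilinear[OF Cc_borel[OF assms(1)]] tendsto_const lim(2)])
    ultimately show ?case unfolding lim(1) by (rule LIMSEQ_unique)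
  qed
qed

text \<open>\<open>mop g\<close> has the properties that define \<open>cc_mult S g\<close>, and a
  bounded linear operator is determined by its values on the fields
  \<open>fld S h f\<close>.\<close>

lemma cc_mult_eq_mop:
  assumes g: "g \<in> Cc"
  shows "cc_mult S g = mop g"
  unfolding cc_mult_def
proof (rule the_equality)
  show "bounded_linear (mop g) \<and> (\<forall>h\<in>Cc. \<forall>f\<in>core S. mop g (fld S h f) = fld S (\<lambda>x. g x * h x) f)"
    using mop_bounded_linear mop_fld g by blast
next
  fix T assume T: "bounded_linear T \<and> (\<forall>h\<in>Cc. \<forall>f\<in>core S. T (fld S h f) = fld S (\<lambda>x. g x * h x) f)"
  then interpret T: bounded_linear T by blast
  have "T v = mop g v" for v
  proof (induction v rule: field_induct)
    case (fld h f)
    then show ?case using T mop_fld g by auto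
  next
    case (add v w)
    then show ?case by (simp add: T.add mop_add_right g)
  next
    case (lim v w)
    show ?case using T.tendsto[OF lim(2)] mop_tendsto[OF g lim(2)] unfolding lim(1) by (rule LIMSEQ_unique)
  qed
  then show "T = mop g" by blast
qed

lemma mop_mop:
  assumes "g \<in> Cc" "k \<in> Cc"
  shows "mop k (mop g v) = mop (\<lambda>x. k x * g x) v"
proof (induction v rule: field_induct)
  case (fld h f)
  then show ?case using assms by (simp add: mop_fld Cc_mult mult_ac)
next
  case (add v w)
  then show ?case using assms by (simp add: mop_add_right Cc_mult)
next
  case (lim v w)
  show ?case
    using mop_tendsto[OF assms(2) mop_tendsto[OF assms(1) lim(2)]]
      mop_tendsto[OF Cc_mult[OF assms(2,1)] lim(2)]
    unfolding lim(1) by (rule LIMSEQ_unique)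
qed

lemma mop_selfadjoint: "g \<in> Cc \<Longrightarrow> inner (mop g v) w = inner v (mop g w)"
  by (simp add: inner_mop hint_sym[of w v] inner_commute[of v])

text \<open>Self-adjointness moves one factor across and multiplicativity merges the two; this is
  the isometry property of \<open>star\<close> on continuous functions.\<close>

lemma inner_mop_mop:
  assumes "g \<in> Cc" "k \<in> Cc"
  shows "inner (mop g v) (mop k v) = (\<integral>x. g x * k x \<partial>(vmeas S v))"
proof -
  have "inner (mop g v) (mop k v) = inner (mop k (mop g v)) v"
    by (rule mop_selfadjoint[symmetric, OF assms(2)])
  also have "\<dots> = (\<integral>x. k x * g x \<partial>(vmeas S v))"
    using assms by (simp add: mop_mop inner_mop Cc_mult hint_vmeas Cc_borel)
  finally show ?thesis by (simp add: mult.commute)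
qed

lemma mop_diff_left:
  assumes "g \<in> Cc" "k \<in> Cc"
  shows "mop (\<lambda>x. g x - k x) v = mop g v - mop k v"
proof (rule mop_eqI[OF Cc_diff[OF assms]])
  fix w
  have "hint v w (\<lambda>x. g x + (-1) * k x) = hint v w g + (-1) * hint v w k"
    using assms by (simp only: hint_add hint_cmult Cc_borel bounded_borel_cmult)
  then show "inner (mop g v - mop k v) w = hint v w (\<lambda>x. g x - k x)"
    using assms by (simp add: inner_diff_left inner_mop)
qed

lemma norm_mop_diff:
  assumes "g \<in> Cc" "k \<in> Cc"
  shows "(norm (mop g v - mop k v))\<^sup>2 = (\<integral>x. (g x - k x)\<^sup>2 \<partial>(vmeas S v))"
  using inner_mop_mop[OF Cc_diff[OF assms] Cc_diff[OF assms], of v]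
  by (simp add: mop_diff_left[OF assms] power2_norm_eq_inner flip: power2_eq_square)

section \<open>Extension of the multiplication to square-integrable functions\<close>

lemma Cc_L2:
  assumes "g \<in> Cc"
  shows "g \<in> L2 (vmeas S v)"
proof -
  have m: "borel_measurable (vmeas S v) = borel_measurable borel"
    by (rule measurable_cong_sets) (simp_all add: sets_vmeas)
  obtain K where "g \<in> borel_measurable borel" "\<And>x. \<bar>g x\<bar> \<le> K"
    using Cc_borel[OF assms] unfolding bounded_borel_def by blast
  then show ?thesis unfolding m[symmetric] by (rule L2_bounded[OF finite_vmeas])
qed

lemma Cc_approx_seq:
  assumes f: "f \<in> L2 (vmeas S b)"
  obtains h where "\<And>n. h n \<in> Cc" "(\<lambda>n::nat. \<integral>x. (h n x - f x)\<^sup>2 \<partial>(vmeas S b)) \<longlonglongrightarrow> 0"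
proof -
  have "\<exists>h. h \<in> Cc \<and> (\<integral>x. (h x - f x)\<^sup>2 \<partial>(vmeas S b)) < 1 / real (Suc n)" for n
    using L2_continuous_approx[OF finite_vmeas sets_vmeas f, of "1 / real (Suc n)"] by (simp add: Cc_bounded_cont)
  then obtain h where h: "\<And>n. h n \<in> Cc" "\<And>n. (\<integral>x. (h n x - f x)\<^sup>2 \<partial>(vmeas S b)) < 1 / real (Suc n)" by metis
  have "(\<lambda>n. \<integral>x. (h n x - f x)\<^sup>2 \<partial>(vmeas S b)) \<longlonglongrightarrow> 0"
    by (rule tendsto_sandwich[OF _ _ tendsto_const LIMSEQ_Suc[OF lim_1_over_n]])
       (use h(2) less_imp_le in \<open>auto intro!: always_eventually Bochner_Integration.integral_nonneg\<close>)
  then show ?thesis using that h(1) by blast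
qed

lemma mop_tendsto_same_limit:
  assumes f: "f \<in> L2 (vmeas S b)"
    and h: "\<And>n. h n \<in> Cc" "(\<lambda>n::nat. \<integral>x. (h n x - f x)\<^sup>2 \<partial>(vmeas S b)) \<longlonglongrightarrow> 0"
    and k: "\<And>n. k n \<in> Cc" "(\<lambda>n::nat. \<integral>x. (k n x - f x)\<^sup>2 \<partial>(vmeas S b)) \<longlonglongrightarrow> 0"
    and lim: "(\<lambda>n. mop (h n) b) \<longlonglongrightarrow> w"
  shows "(\<lambda>n. mop (k n) b) \<longlonglongrightarrow> w"
proof -
  let ?I = "\<lambda>n. \<integral>x. (h n x - f x)\<^sup>2 \<partial>(vmeas S b)"
  let ?J = "\<lambda>n. \<integral>x. (k n x - f x)\<^sup>2 \<partial>(vmeas S b)"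
  have le: "(norm (mop (k n) b - mop (h n) b))\<^sup>2 \<le> 2 * ?J n + 2 * ?I n" for n
    using L2_dist_triangle[OF Cc_L2[OF k(1)] f Cc_L2[OF h(1)], of n n]
    by (simp add: norm_mop_diff h(1) k(1) power2_commute[of "f _"])
  have lim0: "(\<lambda>n. 2 * ?J n + 2 * ?I n) \<longlonglongrightarrow> 0"
    using tendsto_add[OF tendsto_mult[OF tendsto_const k(2), of 2] tendsto_mult[OF tendsto_const h(2), of 2]] by simp
  have "(\<lambda>n. (norm (mop (k n) b - mop (h n) b))\<^sup>2) \<longlonglongrightarrow> 0"
    by (rule tendsto_sandwich[OF _ _ tendsto_const lim0]) (simp_all add: le always_eventually)
  from tendsto_real_sqrt[OF this] have "(\<lambda>n. norm (mop (k n) b - mop (h n) b)) \<longlonglongrightarrow> 0" by simp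
  then have "(\<lambda>n. mop (k n) b - mop (h n) b) \<longlonglongrightarrow> 0" by (rule tendsto_norm_zero_cancel)
  from tendsto_add[OF this lim] show ?thesis by simp
qed

text \<open>Uniqueness for the definite description in \<open>l2_mult\<close>: two sequences
  approximating the same function yield the same limit, since \<open>mop\<close> turns
  \<open>L2\<close> distances into distances of fields.\<close>

lemma star_eqI:
  assumes f: "f \<in> L2 (vmeas S b)"
    and h: "\<And>n. h n \<in> Cc" "(\<lambda>n::nat. \<integral>x. (h n x - f x)\<^sup>2 \<partial>(vmeas S b)) \<longlonglongrightarrow> 0"
    and lim: "(\<lambda>n. mop (h n) b) \<longlonglongrightarrow> w"
  shows "star S b f = w"
  unfolding star_def l2_mult_def
proof (rule the_equality)
  show "\<exists>h. (\<forall>n. h n \<in> Cc) \<and> (\<lambda>n. \<integral>x. (h n x - f x)\<^sup>2 \<partial>(vmeas S b)) \<longlonglongrightarrow> 0 \<and> (\<lambda>n. cc_mult S (h n) b) \<longlonglongrightarrow> w"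
    using h lim by (intro exI[of _ h]) (simp add: cc_mult_eq_mop)
next
  fix w' assume "\<exists>h. (\<forall>n. h n \<in> Cc) \<and> (\<lambda>n. \<integral>x. (h n x - f x)\<^sup>2 \<partial>(vmeas S b)) \<longlonglongrightarrow> 0 \<and> (\<lambda>n. cc_mult S (h n) b) \<longlonglongrightarrow> w'"
  then obtain k where k: "\<And>n. k n \<in> Cc" "(\<lambda>n::nat. \<integral>x. (k n x - f x)\<^sup>2 \<partial>(vmeas S b)) \<longlonglongrightarrow> 0"
    "(\<lambda>n. cc_mult S (k n) b) \<longlonglongrightarrow> w'" by blast
  from k(3) have "(\<lambda>n. mop (k n) b) \<longlonglongrightarrow> w'" by (simp add: cc_mult_eq_mop k(1))
  with mop_tendsto_same_limit[OF f h k(1,2) lim] show "w' = w" using LIMSEQ_unique by blast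
qed

text \<open>Existence of the limit: a sequence that converges in \<open>L2\<close> is Cauchy there,
  and so are its images, because distances are preserved.\<close>

lemma star_seq:
  assumes f: "f \<in> L2 (vmeas S b)"
    and h: "\<And>n. h n \<in> Cc" "(\<lambda>n::nat. \<integral>x. (h n x - f x)\<^sup>2 \<partial>(vmeas S b)) \<longlonglongrightarrow> 0"
  shows "(\<lambda>n. mop (h n) b) \<longlonglongrightarrow> star S b f"
proof -
  let ?I = "\<lambda>n. \<integral>x. (h n x - f x)\<^sup>2 \<partial>(vmeas S b)"
  have le: "(norm (mop (h m) b - mop (h n) b))\<^sup>2 \<le> 2 * ?I m + 2 * ?I n" for m n
    using L2_dist_triangle[OF Cc_L2[OF h(1)] f Cc_L2[OF h(1)], of m n]
    by (simp add: norm_mop_diff h(1) power2_commute[of "f _"])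
  have "Cauchy (\<lambda>n. mop (h n) b)"
    unfolding Cauchy_iff
  proof safe
    fix e :: real assume "e > 0"
    then have "e\<^sup>2 / 4 > 0" by simp
    from order_tendstoD(2)[OF h(2) this] obtain M where M: "\<And>n. n \<ge> M \<Longrightarrow> ?I n < e\<^sup>2 / 4"
      by (auto simp: eventually_sequentially)
    have "norm (mop (h m) b - mop (h n) b) < e" if "m \<ge> M" "n \<ge> M" for m n
    proof (rule power2_less_imp_less)
      show "(norm (mop (h m) b - mop (h n) b))\<^sup>2 < e\<^sup>2" using le[of m n] M[OF that(1)] M[OF that(2)] by linarith
    qed (use \<open>e > 0\<close> in simp)
    then show "\<exists>M. \<forall>m\<ge>M. \<forall>n\<ge>M. norm (mop (h m) b - mop (h n) b) < e" by blast
  qed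
  then obtain w where w: "(\<lambda>n. mop (h n) b) \<longlonglongrightarrow> w" using Cauchy_convergent convergent_def by blast
  then show ?thesis using star_eqI[OF f h w] by simp
qed

lemma star_Cc:
  assumes "g \<in> Cc"
  shows "star S b g = mop g b"
  by (rule star_eqI[OF Cc_L2[OF assms], of "\<lambda>_. g"]) (simp_all add: assms)

lemma inner_star:
  assumes f: "f \<in> L2 (vmeas S b)" and g: "g \<in> L2 (vmeas S b)"
  shows "inner (star S b f) (star S b g) = l2_inner (vmeas S b) f g"
proof -
  obtain h where h: "\<And>n. h n \<in> Cc" "(\<lambda>n::nat. \<integral>x. (h n x - f x)\<^sup>2 \<partial>(vmeas S b)) \<longlonglongrightarrow> 0"
    using Cc_approx_seq[OF f] by blast
  obtain k where k: "\<And>n. k n \<in> Cc" "(\<lambda>n::nat. \<integral>x. (k n x - g x)\<^sup>2 \<partial>(vmeas S b)) \<longlonglongrightarrow> 0"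
    using Cc_approx_seq[OF g] by blast
  have "(\<lambda>n. inner (mop (h n) b) (mop (k n) b)) \<longlonglongrightarrow> inner (star S b f) (star S b g)"
    by (intro tendsto_inner star_seq f g h k)
  moreover have "(\<lambda>n. inner (mop (h n) b) (mop (k n) b)) \<longlonglongrightarrow> l2_inner (vmeas S b) f g"
    using L2_inner_tendsto[OF Cc_L2[OF h(1)] Cc_L2[OF k(1)] f g h(2) k(2)]
    by (simp add: inner_mop_mop h(1) k(1) l2_inner_def)
  ultimately show ?thesis by (rule LIMSEQ_unique)
qed

section \<open>Gradients and the Leibniz rule\<close>

lemma partial_fld: "partial S f = fld S (\<lambda>x. 1) f"
  by (simp add: partial_def fld_def avg_def case_prod_unfold)

lemma partial_add:
  assumes "f \<in> core S" "g \<in> core S"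
  shows "partial S (\<lambda>x. f x + g x) = partial S f + partial S g"
proof -
  have "(\<lambda>z. avg (\<lambda>x. 1) z * d_u (\<lambda>x. f x + g x) z) =
     (\<lambda>z. avg (\<lambda>x. 1) z * d_u f z + avg (\<lambda>x. 1) z * d_u g z)"
    by (auto simp: fun_eq_iff avg_def d_u_def)
  then show ?thesis
    using cls_add[OF fld_in_simple[OF Cc_const[of 1] assms(1)] fld_in_simple[OF Cc_const[of 1] assms(2)]]
    by (simp add: partial_fld fld_def)
qed

text \<open>The averages in the definition of fields make the Leibniz rule an exact pointwise
  identity: the mixed products \<open>f x * g y\<close> and \<open>f y * g x\<close> cancel between
  the two terms.\<close>

lemma partial_mult:
  assumes "f \<in> core S" "g \<in> core S"
  shows "partial S (\<lambda>x. f x * g x) = fld S f g + fld S g f"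
proof -
  have "d_u (\<lambda>x. f x * g x) = (\<lambda>z. avg f z * d_u g z + avg g z * d_u f z)"
    by (auto simp: fun_eq_iff avg_def d_u_def field_simps)
  then show ?thesis
    using cls_add[OF fld_in_simple[OF core_Cc[OF assms(1)] assms(2)] fld_in_simple[OF core_Cc[OF assms(2)] assms(1)]]
    by (simp add: partial_def fld_def)
qed

lemma fld_eq_mop_partial: "g \<in> Cc \<Longrightarrow> f \<in> core S \<Longrightarrow> fld S g f = mop g (partial S f)"
  by (simp add: partial_fld mop_fld Cc_const)

text \<open>The energy measure is tested with the function one: the first two terms both equal
  \<open>form S f g\<close>, and the third vanishes by strong locality because one is constant on
  the whole space.\<close>

lemma inner_partial:
  assumes "f \<in> core S" "g \<in> core S"
  shows "inner (partial S f) (partial S g) = form S f g"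
proof -
  have "form S (\<lambda>x. f x * g x) (\<lambda>x. 1) = 0"
  proof -
    have "\<forall>f\<in>core S. \<forall>g\<in>core S. (\<exists>U c. open U \<and> tsupp f \<subseteq> U \<and> (\<forall>x\<in>U. g x = c)) \<longrightarrow> form S f g = 0"
      using adm unfolding admissible_form_def by (elim conjE) assumption
    from this[rule_format, OF core_mult[OF assms] one] show ?thesis
      by (metis open_UNIV subset_UNIV)
  qed
  moreover have "signed_integral (emeas S f g) (\<lambda>x. 1) =
      (form S (\<lambda>x. f x * 1) g + form S f (\<lambda>x. g x * 1) - form S (\<lambda>x. f x * g x) (\<lambda>x. 1)) / 2"
    using en assms one unfolding energy_measures_def by simp
  ultimately show ?thesis
    using inner_fld[OF Cc_const Cc_const assms, of 1 1] by (simp add: partial_fld)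
qed

lemma hmeas_partial:
  assumes "f \<in> core S" "g \<in> core S" "A \<in> sets borel"
  shows "hmeas S (partial S f) (partial S g) A = emeas S f g A"
  using hmeas_fld[OF Cc_const Cc_const assms, of 1 1]
  by (simp add: partial_fld signed_integral_indicator emeas_signed assms)

end

section \<open>Surjectivity of the isometry in martingale dimension one\<close>

lemma rank_le_one_det:
  fixes M :: "nat \<Rightarrow> nat \<Rightarrow> real"
  assumes "vec_space.rank 2 (mat 2 2 (\<lambda>(i, j). M i j)) \<le> (1 :: nat)"
  shows "M 0 0 * M 1 1 = M 0 1 * M 1 0"
proof -
  have c: "mat 2 2 (\<lambda>(i, j). M i j) \<in> carrier_mat 2 2" by simp
  have "Determinant.det (mat 2 2 (\<lambda>(i, j). M i j)) = 0"
    using vec_space.det_rank_iff[OF c] assms by fastforce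
  moreover have "Determinant.det (mat 2 2 (\<lambda>(i, j). M i j)) = M 0 0 * M 1 1 - M 0 1 * M 1 0"
    by (subst laplace_expansion_column[OF c, of 0])
       (simp_all add: numeral_2_eq_2 cofactor_def mat_delete_def det_single mult.commute)
  ultimately show ?thesis by simp
qed

locale dominated_form = compact_form S
  for S :: "('a::{metric_space,second_countable_topology},
             'h::{real_inner,complete_space}) form_data" +
  fixes nu :: "'a measure"
  assumes ed: "energy_dominant S nu"

sublocale dominated_form \<subseteq> sigma_finite_measure nu
  using ed by (simp add: energy_dominant_def)

context compact_form
begin

lemma to_measure_emeas:
  assumes "f \<in> core S"
  shows "to_measure (emeas S f f) = vmeas S (partial S f)"
  unfolding to_measure_def vmeas_def
  by (rule measure_of_eq) (use sets.sigma_sets_eq[of "borel :: 'a measure"] hmeas_partial[OF assms assms] in auto)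

lemma hmeas_Cauchy_Schwarz:
  assumes "A \<in> sets borel"
  shows "(hmeas S v w A)\<^sup>2 \<le> hmeas S v v A * hmeas S w w A"
  using hint_Cauchy_Schwarz[OF bounded_borel_indicator[OF assms], of v w]
  by (simp add: hint_indicator assms)

lemma hmeas_bound: "A \<in> sets borel \<Longrightarrow> \<bar>hmeas S v w A\<bar> \<le> 3 * (norm v * norm w)"
  using hint_bound[OF bounded_borel_indicator, of A 1 v w] by (simp add: hint_indicator indicator_def)

end

section \<open>Densities of the field measures\<close>

context dominated_form
begin

lemma sets_nu: "sets nu = sets borel"
  using ed by (simp add: energy_dominant_def)

lemma bounded_borel_nu: "bounded_borel g \<Longrightarrow> g \<in> borel_measurable nu"
  unfolding bounded_borel_def measurable_cong_sets[OF sets_nu refl] by blast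

text \<open>Energy dominance speaks of gradients. Multiplication by a function keeps null sets, and
  for a sum the mixed terms vanish by Cauchy-Schwarz.\<close>

lemma hmeas_null:
  assumes N: "N \<in> null_sets nu"
  shows "hmeas S v v N = 0"
proof -
  have NB: "N \<in> sets borel" using N sets_nu by auto
  show ?thesis
  proof (induction v rule: field_induct)
    case (fld h f)
    have "N \<in> null_sets (vmeas S (partial S f))"
      using ed N fld(2) to_measure_emeas unfolding energy_dominant_def absolutely_continuous_def by auto
    then have ae: "AE x in vmeas S (partial S f). x \<notin> N" by (rule AE_not_in)
    have b: "bounded_borel (\<lambda>x. indicator N x * (h x * h x))"
      by (intro bounded_borel_mult bounded_borel_indicator NB Cc_borel fld)
    have "hmeas S (fld S h f) (fld S h f) N = hint (partial S f) (partial S f) (\<lambda>x. indicator N x * (h x * h x))"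
      using hint_fld[OF Cc_const Cc_const fld(2) fld(2) b, of 1 1]
      by (simp add: hmeas_fld fld NB partial_fld)
    also have "\<dots> = (\<integral>x. indicator N x * (h x * h x) \<partial>(vmeas S (partial S f)))" by (rule hint_vmeas[OF b])
    also have "\<dots> = 0"
      by (rule integral_eq_zero_AE) (use ae in \<open>auto simp: indicator_def\<close>)
    finally show ?case .
  next
    case (add v w)
    then have "hmeas S v w N = 0" "hmeas S w v N = 0"
      using hmeas_Cauchy_Schwarz[OF NB, of v w] hmeas_Cauchy_Schwarz[OF NB, of w v] by auto
    then show ?case using add by (simp add: hmeas_add_left hmeas_add_right NB)
  next
    case (lim v w)
    show ?case using hmeas_tendsto[OF NB lim(2) lim(2)] unfolding lim(1) by (simp add: LIMSEQ_const_iff)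
  qed
qed

lemma vmeas_ac: "absolutely_continuous nu (vmeas S v)"
  unfolding absolutely_continuous_def
proof
  fix N assume N: "N \<in> null_sets nu"
  then have "N \<in> sets borel" using sets_nu by auto
  then show "N \<in> null_sets (vmeas S v)"
    using hmeas_null[OF N, of v] by (simp add: null_sets_def sets_vmeas emeasure_vmeas)
qed

text \<open>A relation rather than a chosen density: algebraic rules produce densities of sums and
  multiples explicitly, and uniqueness turns them into almost everywhere identities for
  \<open>dens\<close>.\<close>

definition is_dens :: "'h \<Rightarrow> 'h \<Rightarrow> ('a \<Rightarrow> real) \<Rightarrow> bool" where
  "is_dens v w r \<longleftrightarrow> integrable nu r \<and> (\<forall>A\<in>sets borel. hmeas S v w A = (\<integral>x. indicator A x * r x \<partial>nu))"

lemma vmeas_density: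
  obtains D where "D \<in> borel_measurable nu" "\<And>x. 0 \<le> D x" "vmeas S v = density nu (\<lambda>x. ennreal (D x))"
    "is_dens v v D"
proof -
  obtain D where D: "D \<in> borel_measurable nu" "AE x in nu. RN_deriv nu (vmeas S v) x = ennreal (D x)"
    "\<And>x. 0 \<le> D x"
    using real_RN_deriv[OF finite_vmeas vmeas_ac trans[OF sets_vmeas sets_nu[symmetric]]] by metis
  have dv: "density nu (\<lambda>x. ennreal (D x)) = vmeas S v"
  proof -
    have "density nu (\<lambda>x. ennreal (D x)) = density nu (RN_deriv nu (vmeas S v))"
      by (rule density_cong) (use D in auto)
    also have "\<dots> = vmeas S v" by (rule density_RN_deriv[OF vmeas_ac]) (simp add: sets_vmeas sets_nu)
    finally show ?thesis .
  qed
  interpret V: finite_measure "vmeas S v" by (rule finite_vmeas)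
  have i: "integrable nu (\<lambda>x. D x * f x)" "(\<integral>x. f x \<partial>(vmeas S v)) = (\<integral>x. D x * f x \<partial>nu)"
    if "bounded_borel f" for f
  proof -
    have m: "f \<in> borel_measurable nu" by (rule bounded_borel_nu[OF that])
    show "integrable nu (\<lambda>x. D x * f x)"
      using integrable_real_density[OF D(1) _ m] D(3) integrable_vmeas[OF that, of v] dv by simp
    show "(\<integral>x. f x \<partial>(vmeas S v)) = (\<integral>x. D x * f x \<partial>nu)"
      using integral_real_density[OF D(1) _ m] D(3) dv by simp
  qed
  have "is_dens v v D"
    unfolding is_dens_def
  proof safe
    show "integrable nu D" using i(1)[OF bounded_borel_const, of 1] by simp
    fix A :: "'a set" assume A: "A \<in> sets borel"
    show "hmeas S v v A = (\<integral>x. indicator A x * D x \<partial>nu)"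
      using i(2)[OF bounded_borel_indicator[OF A]] A hint_vmeas[OF bounded_borel_indicator[OF A], of v]
      by (simp add: hint_indicator mult.commute)
  qed
  then show ?thesis using that D(1,3) dv by metis
qed

lemma is_dens_indicator_integrable: "is_dens v w r \<Longrightarrow> A \<in> sets borel \<Longrightarrow> integrable nu (\<lambda>x. indicator A x * r x)"
  using integrable_mult_indicator[of A nu r] sets_nu by (simp add: is_dens_def)

lemma is_dens_add_left:
  assumes "is_dens v w r" "is_dens v' w r'"
  shows "is_dens (v + v') w (\<lambda>x. r x + r' x)"
  using assms is_dens_indicator_integrable[OF assms(1)] is_dens_indicator_integrable[OF assms(2)]
  by (auto simp: is_dens_def hmeas_add_left distrib_left)

lemma is_dens_sym: "is_dens v w r \<Longrightarrow> is_dens w v r"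
  by (simp add: is_dens_def hmeas_sym[of _ w v])

lemma is_dens_add_right: "is_dens v w r \<Longrightarrow> is_dens v w' r' \<Longrightarrow> is_dens v (w + w') (\<lambda>x. r x + r' x)"
  by (intro is_dens_sym[OF is_dens_add_left] is_dens_sym[of v])

lemma is_dens_scale_left: "is_dens v w r \<Longrightarrow> is_dens (c *\<^sub>R v) w (\<lambda>x. c * r x)"
  using bounded_bilinear.scaleR_left[OF hmeas_bilinear]
  by (auto simp: is_dens_def mult.left_commute)

lemma is_dens_unique:
  assumes "is_dens v w r" "is_dens v w r'"
  shows "AE x in nu. r x = r' x"
  by (rule density_unique_real)
     (use assms sets_nu in \<open>auto simp: is_dens_def set_lebesgue_integral_def\<close>)

text \<open>Polarisation: Radon-Nikodym applies to the positive measures of \<open>v + w\<close> and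
  \<open>v - w\<close>, and a quarter of their difference is the mixed measure.\<close>

lemma is_dens_ex: "\<exists>r. is_dens v w r"
proof -
  obtain r s where rs: "is_dens (v + w) (v + w) r" "is_dens (v - w) (v - w) s"
    using vmeas_density by metis
  have "hmeas S v w A = (\<integral>x. indicator A x * ((r x - s x) / 4) \<partial>nu)" if "A \<in> sets borel" for A
  proof -
    interpret bb: bounded_bilinear "\<lambda>v w. hmeas S v w A" by (rule hmeas_bilinear[OF that])
    have "hmeas S (v + w) (v + w) A - hmeas S (v - w) (v - w) A = 4 * hmeas S v w A"
      using hmeas_sym[OF that, of w v]
      by (simp add: bb.add_left bb.add_right bb.diff_left bb.diff_right)
    then have "hmeas S v w A = ((\<integral>x. indicator A x * r x \<partial>nu) - (\<integral>x. indicator A x * s x \<partial>nu)) / 4"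
      using rs that by (simp add: is_dens_def)
    also have "\<dots> = (\<integral>x. (indicator A x * r x - indicator A x * s x) / 4 \<partial>nu)"
      using is_dens_indicator_integrable[OF rs(1) that] is_dens_indicator_integrable[OF rs(2) that] by simp
    finally show ?thesis by (simp add: right_diff_distrib)
  qed
  moreover have "integrable nu (\<lambda>x. (r x - s x) / 4)" using rs by (simp add: is_dens_def)
  ultimately show ?thesis unfolding is_dens_def by blast
qed

definition dens :: "'h \<Rightarrow> 'h \<Rightarrow> 'a \<Rightarrow> real" where
  "dens v w = (SOME r. is_dens v w r)"

lemma is_dens: "is_dens v w (dens v w)"
  unfolding dens_def by (rule someI_ex[OF is_dens_ex])

lemma dens_integrable: "integrable nu (dens v w)"
  using is_dens by (simp add: is_dens_def)

lemma dens_add_left: "AE x in nu. dens (v + v') w x = dens v w x + dens v' w x"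
  by (rule is_dens_unique[OF is_dens is_dens_add_left[OF is_dens is_dens]])

lemma dens_sym: "AE x in nu. dens v w x = dens w v x"
  by (rule is_dens_unique[OF is_dens is_dens_sym[OF is_dens]])

lemma dens_diff_left: "AE x in nu. dens (v - v') w x = dens v w x - dens v' w x"
proof -
  have "is_dens (v + (-1) *\<^sub>R v') w (\<lambda>x. dens v w x + (-1) * dens v' w x)"
    by (intro is_dens_add_left is_dens_scale_left is_dens)
  then have "is_dens (v - v') w (\<lambda>x. dens v w x - dens v' w x)" by simp
  then show ?thesis by (rule is_dens_unique[OF is_dens])
qed

lemma is_dens_mult_integrable:
  assumes "is_dens v w r" "bounded_borel g"
  shows "integrable nu (\<lambda>x. g x * r x)"
proof -
  obtain K where K: "\<And>x. \<bar>g x\<bar> \<le> K" using assms(2) by (auto simp: bounded_borel_def)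
  have r: "integrable nu r" using assms by (simp add: is_dens_def)
  show ?thesis
  proof (rule Bochner_Integration.integrable_bound)
    show "integrable nu (\<lambda>x. K * r x)" using r by simp
    show "(\<lambda>x. g x * r x) \<in> borel_measurable nu" using r bounded_borel_nu[OF assms(2)] by auto
    show "AE x in nu. norm (g x * r x) \<le> norm (K * r x)"
      using K by (auto simp: abs_mult intro!: mult_right_mono intro: order_trans[OF K abs_ge_self])
  qed
qed

lemma hint_is_dens:
  assumes r: "is_dens v w r" and "bounded_borel g"
  shows "hint v w g = (\<integral>x. g x * r x \<partial>nu)"
  using assms(2)
proof (induction g rule: bounded_borel_induct)
  case (indicator A)
  then show ?case using r by (simp add: hint_indicator is_dens_def)
next
  case (add f g)
  then show ?case using is_dens_mult_integrable[OF r] by (simp add: hint_add distrib_right)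
next
  case (cmult f c)
  then show ?case by (simp add: hint_cmult mult.assoc)
next
  case (lim s f C)
  have ri: "integrable nu r" using r by (simp add: is_dens_def)
  have "(\<lambda>i. \<integral>x. s i x * r x \<partial>nu) \<longlonglongrightarrow> (\<integral>x. f x * r x \<partial>nu)"
  proof (rule integral_dominated_convergence[where w = "\<lambda>x. C * \<bar>r x\<bar>"])
    show "(\<lambda>x. f x * r x) \<in> borel_measurable nu" "\<And>i. (\<lambda>x. s i x * r x) \<in> borel_measurable nu"
      using ri bounded_borel_nu lim(1,2) by auto
    show "integrable nu (\<lambda>x. C * \<bar>r x\<bar>)" using ri by simp
    show "AE x in nu. (\<lambda>i. s i x * r x) \<longlonglongrightarrow> f x * r x" by (intro AE_I2 tendsto_intros lim(4))
    show "AE x in nu. norm (s i x * r x) \<le> C * \<bar>r x\<bar>" for i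
      by (intro AE_I2) (simp add: abs_mult mult_right_mono lim(3))
  qed
  then show ?case by (intro LIMSEQ_unique[OF hint_tendsto[OF lim.hyps]]) (simp only: lim.IH)
qed

text \<open>Splitting the space by the sign of the density turns its \<open>L1\<close> norm into a
  difference of two values of \<open>hmeas\<close>, each at most
  \<open>3 * (norm v * norm w)\<close> in modulus.\<close>

lemma dens_L1: "(\<integral>x. \<bar>dens v w x\<bar> \<partial>nu) \<le> 6 * (norm v * norm w)"
proof -
  define P where "P = {x. dens v w x \<ge> 0}"
  have m: "dens v w \<in> borel_measurable borel"
    using borel_measurable_integrable[OF dens_integrable[of v w]] measurable_cong_sets[OF sets_nu refl, of borel] by blast
  have P: "P \<in> sets borel" unfolding P_def using m by measurable
  have i: "integrable nu (\<lambda>x. indicator A x * dens v w x)" if "A \<in> sets borel" for A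
    by (rule is_dens_indicator_integrable[OF is_dens that])
  have "(\<integral>x. \<bar>dens v w x\<bar> \<partial>nu) = (\<integral>x. indicator P x * dens v w x - indicator (- P) x * dens v w x \<partial>nu)"
    by (intro Bochner_Integration.integral_cong) (auto simp: P_def indicator_def)
  also have "\<dots> = hmeas S v w P - hmeas S v w (- P)"
    using is_dens[of v w] P i[OF P] i[OF borel_comp[OF P]] by (simp add: is_dens_def)
  also have "\<dots> \<le> 6 * (norm v * norm w)"
    using hmeas_bound[OF P, of v w] hmeas_bound[OF borel_comp[OF P], of v w] by linarith
  finally show ?thesis .
qed

text \<open>By the \<open>L1\<close> bound, convergence of fields gives convergence of the densities
  in mean, hence almost everywhere along a subsequence.\<close>

lemma dens_subseq:
  assumes "v \<longlonglongrightarrow> v'"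
  shows "\<exists>r::nat\<Rightarrow>nat. strict_mono r \<and> (AE x in nu. (\<lambda>n. dens (v (r n)) w x) \<longlonglongrightarrow> dens v' w x)"
proof -
  have "(\<lambda>n. \<integral>x. norm (dens (v n - v') w x) \<partial>nu) \<longlonglongrightarrow> 0"
  proof (rule tendsto_sandwich[OF _ _ tendsto_const])
    show "(\<lambda>n. 6 * (norm (v n - v') * norm w)) \<longlonglongrightarrow> 0"
      using tendsto_mult[OF tendsto_const tendsto_mult[OF tendsto_norm[OF tendsto_diff[OF assms tendsto_const]] tendsto_const], of 6 v' "norm w"]
      by simp
  qed (simp_all add: dens_L1)
  from tendsto_L1_AE_subseq[OF dens_integrable this]
  obtain r :: "nat \<Rightarrow> nat" where r: "strict_mono r" "AE x in nu. (\<lambda>n. dens (v (r n) - v') w x) \<longlonglongrightarrow> 0" by blast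
  have "AE x in nu. \<forall>n. dens (v (r n) - v') w x = dens (v (r n)) w x - dens v' w x"
    unfolding AE_all_countable using dens_diff_left by blast
  with r(2) have "AE x in nu. (\<lambda>n. dens (v (r n)) w x) \<longlonglongrightarrow> dens v' w x"
  proof eventually_elim
    case (elim x)
    then show ?case using LIM_zero_iff[of "\<lambda>n. dens (v (r n)) w x" "dens v' w x"] by simp
  qed
  with r(1) show ?thesis by blast
qed

lemma is_dens_fld:
  assumes "h \<in> Cc" "k \<in> Cc" "f \<in> core S" "g \<in> core S"
  shows "is_dens (fld S h f) (fld S k g) (\<lambda>x. h x * k x * dens (partial S f) (partial S g) x)"
  unfolding is_dens_def
proof safe
  have hk: "bounded_borel (\<lambda>x. h x * k x)" by (intro Cc_borel Cc_mult assms)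
  show "integrable nu (\<lambda>x. h x * k x * dens (partial S f) (partial S g) x)"
    by (rule is_dens_mult_integrable[OF is_dens hk])
  fix A :: "'a set" assume A: "A \<in> sets borel"
  have b: "bounded_borel (\<lambda>x. indicator A x * (h x * k x))"
    by (intro bounded_borel_mult[OF bounded_borel_indicator[OF A]] hk)
  have "hmeas S (fld S h f) (fld S k g) A = hint (partial S f) (partial S g) (\<lambda>x. indicator A x * (h x * k x))"
    using hint_fld[OF Cc_const Cc_const assms(3,4) b, of 1 1] by (simp add: hmeas_fld assms A partial_fld)
  also have "\<dots> = (\<integral>x. (indicator A x * (h x * k x)) * dens (partial S f) (partial S g) x \<partial>nu)"
    by (rule hint_is_dens[OF is_dens b])
  finally show "hmeas S (fld S h f) (fld S k g) A = (\<integral>x. indicator A x * (h x * k x * dens (partial S f) (partial S g) x) \<partial>nu)"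
    by (simp add: mult.assoc)
qed

lemma signed_RN_deriv_is_dens:
  assumes "f \<in> core S" "g \<in> core S"
  shows "is_dens (partial S f) (partial S g) (signed_RN_deriv nu (emeas S f g))"
proof -
  have "\<exists>r. integrable nu r \<and> (\<forall>A\<in>sets borel. emeas S f g A = (\<integral>x. indicator A x * r x \<partial>nu))"
    using is_dens[of "partial S f" "partial S g"] hmeas_partial[OF assms] by (auto simp: is_dens_def)
  then have "integrable nu (signed_RN_deriv nu (emeas S f g)) \<and>
     (\<forall>A\<in>sets borel. emeas S f g A = (\<integral>x. indicator A x * signed_RN_deriv nu (emeas S f g) x \<partial>nu))"
    unfolding signed_RN_deriv_def by (rule someI_ex)
  then show ?thesis unfolding is_dens_def using hmeas_partial[OF assms] by simp
qed

end

section \<open>Vanishing of the two by two minors and the range of the isometry\<close>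

locale one_dim_form = dominated_form S nu
  for S :: "('a::{metric_space,second_countable_topology},
             'h::{real_inner,complete_space}) form_data" and nu +
  assumes rank1: "\<And>N f. (\<forall>i<N. f i \<in> core S) \<Longrightarrow>
    AE x in nu. vec_space.rank N (mat N N (\<lambda>(i, j). signed_RN_deriv nu (emeas S (f i) (f j)) x)) \<le> 1"
begin

lemma dens_det:
  assumes "f \<in> core S" "u \<in> core S"
  shows "AE x in nu. dens (partial S f) (partial S f) x * dens (partial S u) (partial S u) x = (dens (partial S f) (partial S u) x)\<^sup>2"
proof -
  define F where "F i = (if i = 0 then f else u)" for i :: nat
  have F: "F i \<in> core S" for i using assms by (simp add: F_def)
  have "AE x in nu. vec_space.rank 2 (mat 2 2 (\<lambda>(i, j). signed_RN_deriv nu (emeas S (F i) (F j)) x)) \<le> 1"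
    by (rule rank1) (simp add: F)
  moreover have "AE x in nu. signed_RN_deriv nu (emeas S (F i) (F j)) x = dens (partial S (F i)) (partial S (F j)) x" for i j
    by (rule is_dens_unique[OF signed_RN_deriv_is_dens[OF F F] is_dens])
  note this[of 0 0] this[of 0 1] this[of 1 0] this[of 1 1]
  moreover note dens_sym[of "partial S f" "partial S u"]
  ultimately show ?thesis
  proof eventually_elim
    case (elim x)
    from rank_le_one_det[OF elim(1)] show ?case using elim(2-) by (simp add: F_def power2_eq_square)
  qed
qed

text \<open>Polarisation in the first argument: the determinant identity for \<open>f + g\<close>
  minus those for \<open>f\<close> and \<open>g\<close> leaves twice the mixed minor.\<close>

lemma dens_minor_core:
  assumes "f \<in> core S" "g \<in> core S" "u \<in> core S"
  shows "AE x in nu. dens (partial S f) (partial S g) x * dens (partial S u) (partial S u) x =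
    dens (partial S f) (partial S u) x * dens (partial S g) (partial S u) x"
proof -
  have "is_dens (partial S f + partial S g) (partial S f + partial S g)
     (\<lambda>x. (dens (partial S f) (partial S f) x + dens (partial S g) (partial S f) x) +
          (dens (partial S f) (partial S g) x + dens (partial S g) (partial S g) x))"
    by (intro is_dens_add_right is_dens_add_left is_dens)
  from is_dens_unique[OF is_dens this]
  have "AE x in nu. dens (partial S f + partial S g) (partial S f + partial S g) x =
     (dens (partial S f) (partial S f) x + dens (partial S g) (partial S f) x) +
          (dens (partial S f) (partial S g) x + dens (partial S g) (partial S g) x)" .
  with dens_det[OF core_add[OF assms(1,2)] assms(3), unfolded partial_add[OF assms(1,2)]]
    dens_det[OF assms(1,3)] dens_det[OF assms(2,3)] dens_sym[of "partial S g" "partial S f"]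
    dens_add_left[of "partial S f" "partial S g" "partial S u"]
  show ?thesis
  proof eventually_elim
    case (elim x)
    then show ?case by (simp add: power2_eq_square algebra_simps)
  qed
qed

text \<open>
  The relation is linear and closed under \<open>L\<^sup>1\<close> limits of densities separately in \<open>v\<close> and in
  \<open>w\<close>, which is why it is stated for two vectors although only \<open>v = w\<close> is used.
\<close>

lemma dens_minor:
  assumes "u \<in> core S"
  shows "AE x in nu. dens v w x * dens (partial S u) (partial S u) x = dens v (partial S u) x * dens w (partial S u) x"
proof (induction v rule: field_induct)
  case (fld h f)
  let ?u = "partial S u"
  have fu: "AE x in nu. dens (fld S h f) ?u x = h x * dens (partial S f) ?u x" if "h \<in> Cc" "f \<in> core S" for h f
    using is_dens_unique[OF is_dens is_dens_fld[OF that(1) Cc_const[of 1] that(2) assms]] by (simp add: partial_fld)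
  show ?case
  proof (induction w rule: field_induct)
    case (fld k g)
    from is_dens_unique[OF is_dens is_dens_fld[OF \<open>h \<in> Cc\<close> fld(1) \<open>f \<in> core S\<close> fld(2)]]
      fu[OF \<open>h \<in> Cc\<close> \<open>f \<in> core S\<close>] fu[OF fld] dens_minor_core[OF \<open>f \<in> core S\<close> fld(2) assms]
    show ?case
    proof eventually_elim
      case (elim x)
      then show ?case by (simp add: mult.assoc)
    qed
  next
    case (add v w)
    from add dens_add_left[of v w ?u] dens_add_left[of v w "fld S h f"] dens_sym[of v "fld S h f"] dens_sym[of w "fld S h f"]
      dens_sym[of "v + w" "fld S h f"]
    show ?case
      by eventually_elim (simp add: algebra_simps)
  next
    case (lim v w)
    \<comment> \<open>The densities against \<open>fld S h f\<close> and against \<open>?u\<close>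
      must converge at the same points, so a second subsequence is extracted from the first.\<close>
    obtain r where r: "strict_mono r" "AE x in nu. (\<lambda>n. dens (v (r n)) (fld S h f) x) \<longlonglongrightarrow> dens w (fld S h f) x"
      using dens_subseq[OF lim(2)] by blast
    have "(\<lambda>n. v (r n)) \<longlonglongrightarrow> w" using LIMSEQ_subseq_LIMSEQ[OF lim(2) r(1)] by (simp add: o_def)
    from dens_subseq[OF this] obtain s where s: "strict_mono s" "AE x in nu. (\<lambda>n. dens (v (r (s n))) ?u x) \<longlonglongrightarrow> dens w ?u x"
      by blast
    have "AE x in nu. \<forall>n. dens (fld S h f) (v n) x * dens ?u ?u x = dens (fld S h f) ?u x * dens (v n) ?u x"
      unfolding AE_all_countable using lim(1) by blast
    moreover have "AE x in nu. \<forall>n. dens (v n) (fld S h f) x = dens (fld S h f) (v n) x"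
      unfolding AE_all_countable using dens_sym by blast
    ultimately show ?case using r(2) s(2) dens_sym[of w "fld S h f"]
    proof eventually_elim
      case (elim x)
      have "(\<lambda>n. dens (v (r (s n))) (fld S h f) x) \<longlonglongrightarrow> dens w (fld S h f) x"
        using LIMSEQ_subseq_LIMSEQ[OF elim(3) s(1)] by (simp add: o_def)
      then have "(\<lambda>n. dens (v (r (s n))) (fld S h f) x * dens ?u ?u x) \<longlonglongrightarrow> dens w (fld S h f) x * dens ?u ?u x"
        by (intro tendsto_intros)
      moreover have "(\<lambda>n. dens (fld S h f) ?u x * dens (v (r (s n))) ?u x) \<longlonglongrightarrow> dens (fld S h f) ?u x * dens w ?u x"
        by (intro tendsto_intros elim(4))
      ultimately show ?case using LIMSEQ_unique elim(1,2,5) by simp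
    qed
  qed
next
  case (add v v')
  from add dens_add_left[of v v' "partial S u"] dens_add_left[of v v' w]
  show ?case
    by eventually_elim (simp add: algebra_simps)
next
  case (lim v v')
  let ?u = "partial S u"
  obtain r where r: "strict_mono r" "AE x in nu. (\<lambda>n. dens (v (r n)) w x) \<longlonglongrightarrow> dens v' w x"
    using dens_subseq[OF lim(2)] by blast
  have "(\<lambda>n. v (r n)) \<longlonglongrightarrow> v'" using LIMSEQ_subseq_LIMSEQ[OF lim(2) r(1)] by (simp add: o_def)
  from dens_subseq[OF this] obtain s where s: "strict_mono s" "AE x in nu. (\<lambda>n. dens (v (r (s n))) ?u x) \<longlonglongrightarrow> dens v' ?u x"
    by blast
  have "AE x in nu. \<forall>n. dens (v n) w x * dens ?u ?u x = dens (v n) ?u x * dens w ?u x"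
    unfolding AE_all_countable using lim(1) by blast
  then show ?case using r(2) s(2)
  proof eventually_elim
    case (elim x)
    have "(\<lambda>n. dens (v (r (s n))) w x) \<longlonglongrightarrow> dens v' w x"
      using LIMSEQ_subseq_LIMSEQ[OF elim(2) s(1)] by (simp add: o_def)
    then have "(\<lambda>n. dens (v (r (s n))) w x * dens ?u ?u x) \<longlonglongrightarrow> dens v' w x * dens ?u ?u x"
      by (intro tendsto_intros)
    moreover have "(\<lambda>n. dens (v (r (s n))) ?u x * dens w ?u x) \<longlonglongrightarrow> dens v' ?u x * dens w ?u x"
      by (intro tendsto_intros elim(3))
    ultimately show ?case using LIMSEQ_unique elim(1) by simp
  qed
qed

lemma partial_in_range_star:
  assumes u: "u \<in> core S" and b: "absolutely_continuous (vmeas S b) nu"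
  shows "\<exists>f\<in>L2 (vmeas S b). star S b f = partial S u"
proof -
  let ?u = "partial S u"
  obtain c where c: "c \<in> borel_measurable nu" "\<And>x. 0 \<le> c x" "vmeas S b = density nu (\<lambda>x. ennreal (c x))"
    "is_dens b b c" using vmeas_density by blast
  define a where "a = dens ?u ?u"
  define e where "e = dens b ?u"
  \<comment> \<open>If \<open>partial S u\<close> is \<open>r\<close> times \<open>b\<close>, then
    the mutual density of \<open>b\<close> and \<open>partial S u\<close> is
    \<open>r x * c x\<close>; this dictates \<open>r\<close>.\<close>
  define r where "r x = e x / c x" for x
  \<comment> \<open>The zero set of \<open>c\<close> is null for \<open>vmeas S b\<close>, and
    \<open>nu\<close> is absolutely continuous with respect to that measure.\<close>
  have cpos: "AE x in nu. c x > 0"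
  proof -
    define Z where "Z = {x\<in>space nu. c x = 0}"
    have Z: "Z \<in> sets nu" unfolding Z_def using c(1) by measurable
    have "emeasure (vmeas S b) Z = (\<integral>\<^sup>+x. ennreal (c x) * indicator Z x \<partial>nu)"
      unfolding c(3) using c(1) Z by (intro emeasure_density) auto
    also have "\<dots> = (\<integral>\<^sup>+x. 0 \<partial>nu)" by (intro nn_integral_cong) (auto simp: Z_def indicator_def)
    finally have "Z \<in> null_sets (vmeas S b)" using Z by (simp add: null_sets_def sets_vmeas sets_nu)
    then have "Z \<in> null_sets nu" using b by (auto simp: absolutely_continuous_def)
    from AE_not_in[OF this] show ?thesis
      using AE_space by eventually_elim (use c(2) in \<open>auto simp: Z_def less_le\<close>)
  qed
  have key: "AE x in nu. c x * a x = (e x)\<^sup>2"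
    using dens_minor[OF u, of b b] is_dens_unique[OF is_dens c(4)]
    by eventually_elim (simp add: a_def e_def power2_eq_square)
  have ai: "integrable nu a" and ei: "integrable nu e" by (simp_all add: a_def e_def dens_integrable)
  \<comment> \<open>Dividing the vanishing minor by \<open>c\<close> shows that
    \<open>c x * (r x)^2\<close> is integrable, which is square-integrability of \<open>r\<close>
    for \<open>vmeas S b\<close>.\<close>
  have ra: "AE x in nu. c x * (r x)\<^sup>2 = a x" using key cpos
    by eventually_elim (simp add: r_def power2_eq_square field_simps)
  have rm: "r \<in> borel_measurable nu" unfolding r_def using c(1) ei by auto
  have mv: "borel_measurable (vmeas S b) = borel_measurable nu"
    by (rule measurable_cong_sets) (simp_all add: sets_vmeas sets_nu)
  have rL: "r \<in> L2 (vmeas S b)"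
  proof -
    have "integrable nu (\<lambda>x. c x * (r x)\<^sup>2)"
      using integrable_cong_AE[THEN iffD2, OF _ _ ra ai] c(1) rm ai by auto
    then have "integrable (vmeas S b) (\<lambda>x. (r x)\<^sup>2)"
      unfolding c(3) using integrable_real_density[OF c(1), of "\<lambda>x. (r x)\<^sup>2"] c(2) rm by auto
    then show ?thesis using rm unfolding L2_def mv by blast
  qed
  obtain h where h: "\<And>n. h n \<in> Cc" "(\<lambda>n::nat. \<integral>x. (h n x - r x)\<^sup>2 \<partial>(vmeas S b)) \<longlonglongrightarrow> 0"
    using Cc_approx_seq[OF rL] by blast
  \<comment> \<open>By the vanishing minor, \<open>a - 2 k e + k\<^sup>2 c\<close> is the perfect square \<open>c (k - r)\<^sup>2\<close>.\<close>
  have dist: "(norm (mop k b - ?u))\<^sup>2 = (\<integral>x. (k x - r x)\<^sup>2 \<partial>(vmeas S b))" if k: "k \<in> Cc" for k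
  proof -
    have bk: "bounded_borel k" "bounded_borel (\<lambda>x. k x * k x)" by (intro Cc_borel Cc_mult k)+
    have km: "k \<in> borel_measurable nu" by (rule bounded_borel_nu[OF bk(1)])
    have i: "integrable nu (\<lambda>x. k x * e x)" "integrable nu (\<lambda>x. (k x * k x) * c x)"
      using is_dens_mult_integrable[OF is_dens bk(1)] is_dens_mult_integrable[OF c(4) bk(2)] by (simp_all add: e_def)
    have "(norm (mop k b - ?u))\<^sup>2 = inner (mop k b) (mop k b) - 2 * inner (mop k b) ?u + inner ?u ?u"
      by (simp add: power2_norm_eq_inner inner_diff_left inner_diff_right inner_commute[of ?u "mop k b"])
    also have "inner (mop k b) (mop k b) = hint b b (\<lambda>x. k x * k x)"
      using inner_mop_mop[OF k k] hint_vmeas[OF bk(2)] by simp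
    also have "\<dots> = (\<integral>x. (k x * k x) * c x \<partial>nu)" by (rule hint_is_dens[OF c(4) bk(2)])
    also have "inner (mop k b) ?u = (\<integral>x. k x * e x \<partial>nu)"
      unfolding inner_mop[OF k] e_def by (rule hint_is_dens[OF is_dens bk(1)])
    also have "inner ?u ?u = (\<integral>x. a x \<partial>nu)"
      using hint_is_dens[OF is_dens bounded_borel_const, of ?u ?u 1] by (simp add: hint_one a_def)
    also have "(\<integral>x. (k x * k x) * c x \<partial>nu) - 2 * (\<integral>x. k x * e x \<partial>nu) + (\<integral>x. a x \<partial>nu) =
       (\<integral>x. (k x * k x) * c x - 2 * (k x * e x) + a x \<partial>nu)" using i ai by simp
    also have "\<dots> = (\<integral>x. c x * (k x - r x)\<^sup>2 \<partial>nu)"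
    proof (rule integral_cong_AE)
      show "AE x in nu. (k x * k x) * c x - 2 * (k x * e x) + a x = c x * (k x - r x)\<^sup>2"
        using ra cpos
      proof eventually_elim
        case (elim x)
        have "c x * r x = e x" using elim(2) by (simp add: r_def)
        moreover have "c x * (k x - r x)\<^sup>2 = k x * k x * c x - 2 * (k x * (c x * r x)) + c x * (r x)\<^sup>2"
          by (simp add: power2_eq_square algebra_simps)
        ultimately show ?case using elim(1) by simp
      qed
    qed (use i ai c(1) rm km in auto)
    also have "\<dots> = (\<integral>x. (k x - r x)\<^sup>2 \<partial>(vmeas S b))"
      unfolding c(3) using integral_real_density[of c nu "\<lambda>x. (k x - r x)\<^sup>2"] c(1,2) km rm by simp
    finally show ?thesis .
  qed
  have "(\<lambda>n. (norm (mop (h n) b - ?u))\<^sup>2) \<longlonglongrightarrow> 0" using h by (simp add: dist)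
  from tendsto_real_sqrt[OF this] have "(\<lambda>n. norm (mop (h n) b - ?u)) \<longlonglongrightarrow> 0" by simp
  then have "(\<lambda>n. mop (h n) b) \<longlonglongrightarrow> ?u"
    by (rule LIM_zero_cancel[OF tendsto_norm_zero_cancel])
  from star_eqI[OF rL h this] show ?thesis using rL by blast
qed

end

context compact_form
begin

section \<open>Integration by parts\<close>

lemma martingale_dimension_one:
  assumes "has_martingale_dimension S 1"
  obtains nu where "minimal_energy_dominant S nu" "one_dim_form S nu"
proof -
  obtain nu p where nu: "minimal_energy_dominant S nu" and p: "index_bound S nu p"
    and e: "esssup nu (\<lambda>x. ennreal_of_enat (p x)) = ennreal_of_enat 1"
    using assms unfolding has_martingale_dimension_def pointwise_index_def by blast
  have p1: "AE x in nu. p x \<le> 1"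
    using esssup_AE[of "\<lambda>x. ennreal_of_enat (p x)" nu] unfolding e ennreal_of_enat_le_iff .
  have "one_dim_form S nu"
  proof (intro one_dim_form.intro dominated_form.intro compact_form_axioms)
    show "dominated_form_axioms S nu"
      using nu by (simp add: dominated_form_axioms_def minimal_energy_dominant_def)
    show "one_dim_form_axioms S nu"
    proof
      fix N :: nat and f :: "nat \<Rightarrow> 'a \<Rightarrow> real" assume f: "\<forall>i<N. f i \<in> core S"
      have "AE x in nu. enat (vec_space.rank N (mat N N (\<lambda>(i, j). signed_RN_deriv nu (emeas S (f i) (f j)) x))) \<le> p x"
        using p f unfolding index_bound_def by blast
      then show "AE x in nu. vec_space.rank N (mat N N (\<lambda>(i, j). signed_RN_deriv nu (emeas S (f i) (f j)) x)) \<le> 1"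
        using p1
      proof eventually_elim
        case (elim x)
        from order_trans[OF elim] show ?case by (simp add: one_enat_def)
      qed
    qed
  qed
  with nu show ?thesis by (rule that)
qed

text \<open>Both \<open>vmeas S b\<close> and the reference measure that witnesses the dimension are
  minimal energy-dominant, so the latter is absolutely continuous with respect to the former. This
  gives the choice in \<open>star_inv\<close> a candidate.\<close>

lemma star_inv_partial:
  assumes dim: "has_martingale_dimension S 1" and b: "minimal_energy_dominant S (vmeas S b)" and u: "u \<in> core S"
  shows "star_inv S b (partial S u) \<in> L2 (vmeas S b) \<and> star S b (star_inv S b (partial S u)) = partial S u"
proof -
  obtain nu where nu: "minimal_energy_dominant S nu" "one_dim_form S nu"
    using martingale_dimension_one[OF dim] by blast
  interpret one_dim_form S nu by (rule nu(2))
  have "absolutely_continuous (vmeas S b) nu"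
    using nu(1) b unfolding minimal_energy_dominant_def by blast
  from partial_in_range_star[OF u this]
  have "\<exists>g. g \<in> L2 (vmeas S b) \<and> star S b g = partial S u" by blast
  then show ?thesis unfolding star_inv_def by (rule someI_ex)
qed

lemma ker_perp_L2: "w \<in> ker_perp S b \<Longrightarrow> w \<in> L2 (vmeas S b)"
  by (simp add: ker_perp_def perp_dom_def)

lemma ker_perp_orthogonal:
  assumes w: "w \<in> ker_perp S b" and "\<phi> \<in> core S"
  shows "inner (star S b w) (partial S \<phi>) = 0"
proof -
  have "\<exists>\<psi>. is_adj S b {} (star S b w) \<psi>" using w by (simp add: ker_perp_def perp_dom_def adj_dom_def)
  then have a: "is_adj S b {} (star S b w) (adj S b {} (star S b w))"
    unfolding adj_def by (rule someI_ex)
  have "AE x in vmeas S b. adj S b {} (star S b w) x * \<phi> x = 0"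
    using w by (auto simp: ker_perp_def perp_def)
  then have "l2_inner (vmeas S b) (adj S b {} (star S b w)) \<phi> = 0"
    unfolding l2_inner_def by (rule integral_eq_zero_AE)
  then show ?thesis using a assms(2) by (simp add: is_adj_def core_off_def)
qed

section \<open>Functions vanishing on the null boundary and the normal part of
  \<open>b\<close>\<close>

text \<open>Uniform approximation by core functions does not preserve zeros. The approximated
  function therefore overshoots both ends of the unit interval, and the Markov property truncates
  the approximant to the exact values 0 and 1.\<close>

lemma core_off_cutoff:
  assumes "closed B" "B \<noteq> {}"
  obtains \<phi> where "\<And>n::nat. \<phi> n \<in> core_off S B" "\<And>n x. 0 \<le> \<phi> n x" "\<And>n x. \<phi> n x \<le> 1"
    "\<And>x. x \<notin> B \<Longrightarrow> (\<lambda>n. \<phi> n x) \<longlonglongrightarrow> 1"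
proof -
  have ex: "\<exists>\<phi>. \<phi> \<in> core_off S B \<and> (\<forall>x. 0 \<le> \<phi> x \<and> \<phi> x \<le> 1) \<and> (\<forall>x. real n * infdist x B \<ge> 1 \<longrightarrow> \<phi> x = 1)" for n
  proof -
    \<comment> \<open>The values run from -1 on \<open>B\<close> to 2 where
      \<open>real n * infdist x B >= 1\<close>; with an error below 1/2 the approximant is negative
      in the first case and exceeds one in the second.\<close>
    define F where "F x = 3 * min 1 (real n * infdist x B) - 1" for x
    have F: "F \<in> Cc" unfolding Cc_iff F_def by (intro continuous_intros)
    have "\<forall>f\<in>Cc. \<forall>\<epsilon>>0. \<exists>g\<in>core S. sup_norm (\<lambda>x. f x - g x) < \<epsilon>"
      using adm unfolding admissible_form_def by (elim conjE) assumption
    from this[rule_format, OF F, of "1/2"]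
    obtain G where G: "G \<in> core S" "sup_norm (\<lambda>x. F x - G x) < 1/2" by auto
    have FG: "\<bar>F x - G x\<bar> < 1/2" for x
    proof -
      obtain K where "\<And>x. \<bar>F x - G x\<bar> \<le> K"
        using Cc_borel[OF Cc_diff[OF F core_Cc[OF G(1)]]] unfolding bounded_borel_def by blast
      then have "\<bar>F x - G x\<bar> \<le> sup_norm (\<lambda>x. F x - G x)"
        unfolding sup_norm_def by (intro cSUP_upper bdd_aboveI[of _ K]) auto
      with G(2) show ?thesis by linarith
    qed
    define \<phi> where "\<phi> x = max (min (G x) 1) 0" for x
    have "\<forall>u\<in>core S. (\<lambda>x. max (min (u x) 1) 0) \<in> core S \<and>
       form S (\<lambda>x. max (min (u x) 1) 0) (\<lambda>x. max (min (u x) 1) 0) \<le> form S u u"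
      using adm unfolding admissible_form_def by (elim conjE) assumption
    then have c: "\<phi> \<in> core S" using G(1) unfolding \<phi>_def by blast
    have z: "\<phi> x = 0" if "x \<in> B" for x
    proof -
      have "F x = -1" using that by (simp add: F_def)
      then have "G x \<le> 0" using FG[of x] by linarith
      then show ?thesis by (simp add: \<phi>_def)
    qed
    have o: "\<phi> x = 1" if "real n * infdist x B \<ge> 1" for x
    proof -
      have "F x = 2" using that by (simp add: F_def)
      then have "G x \<ge> 1" using FG[of x] by linarith
      then show ?thesis by (simp add: \<phi>_def)
    qed
    show ?thesis
      by (intro exI[of _ \<phi>]) (use c z o in \<open>auto simp: core_off_def \<phi>_def\<close>)
  qed
  have "\<exists>\<phi>. \<forall>n. \<phi> n \<in> core_off S B \<and> (\<forall>x. 0 \<le> \<phi> n x \<and> \<phi> n x \<le> 1) \<and> (\<forall>x. real n * infdist x B \<ge> 1 \<longrightarrow> \<phi> n x = 1)"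
    by (rule choice) (use ex in blast)
  then obtain \<phi> where \<phi>: "\<And>n. \<phi> n \<in> core_off S B" "\<And>n x. 0 \<le> \<phi> n x" "\<And>n x. \<phi> n x \<le> 1"
    "\<And>n x. real n * infdist x B \<ge> 1 \<Longrightarrow> \<phi> n x = 1" by blast
  have "(\<lambda>n. \<phi> n x) \<longlonglongrightarrow> 1" if "x \<notin> B" for x
  proof (rule tendsto_eventually)
    have d: "infdist x B > 0"
      using in_closed_iff_infdist_zero[OF assms, of x] that infdist_nonneg[of x B] by (simp add: less_le)
    obtain N :: nat where N: "1 / infdist x B < real N" using reals_Archimedean2 by blast
    have "\<phi> n x = 1" if "n \<ge> N" for n
    proof (rule \<phi>(4))
      have "1 / infdist x B \<le> real n" using N that by linarith
      then show "1 \<le> real n * infdist x B" using d by (simp add: pos_divide_le_eq)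
    qed
    then show "eventually (\<lambda>n. \<phi> n x = 1) sequentially" by (auto simp: eventually_sequentially)
  qed
  with \<phi>(1-3) show ?thesis by (rule that)
qed

text \<open>Since \<open>B\<close> is a null set, this shows that the adjoint of \<open>\<partial>\<^sub>B\<close> is single-valued.\<close>

lemma l2_inner_eq_zero_of_core_off:
  assumes B: "closed B" "B \<noteq> {}" "B \<in> null_sets (vmeas S b)"
    and \<psi>: "\<psi> \<in> L2 (vmeas S b)" "\<And>\<phi>. \<phi> \<in> core_off S B \<Longrightarrow> l2_inner (vmeas S b) \<psi> \<phi> = 0"
    and g: "g \<in> core S"
  shows "l2_inner (vmeas S b) \<psi> g = 0"
proof -
  obtain \<phi> where \<phi>: "\<And>n::nat. \<phi> n \<in> core_off S B" "\<And>n x. 0 \<le> \<phi> n x" "\<And>n x. \<phi> n x \<le> 1"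
    "\<And>x. x \<notin> B \<Longrightarrow> (\<lambda>n. \<phi> n x) \<longlonglongrightarrow> 1"
    using core_off_cutoff[OF B(1,2)] by blast
  have gL: "g \<in> L2 (vmeas S b)" by (rule Cc_L2[OF core_Cc[OF g]])
  \<comment> \<open>The product with a cutoff vanishes on \<open>B\<close>, so it is an admissible
    test function; the cutoffs tend to one off the null set \<open>B\<close>, which recovers
    \<open>g\<close> in the limit.\<close>
  have \<phi>g: "(\<lambda>x. \<phi> n x * g x) \<in> core_off S B" for n
    using \<phi>(1)[of n] core_mult[of "\<phi> n" g] g by (simp add: core_off_def)
  have \<phi>gL: "(\<lambda>x. \<phi> n x * g x) \<in> L2 (vmeas S b)" for n
    using \<phi>g[of n] by (intro Cc_L2 core_Cc) (simp add: core_off_def)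
  have i: "integrable (vmeas S b) (\<lambda>x. \<psi> x * g x)" by (rule L2_mult_integrable[OF \<psi>(1) gL])
  have "(\<lambda>n. \<integral>x. \<psi> x * (\<phi> n x * g x) \<partial>(vmeas S b)) \<longlonglongrightarrow> (\<integral>x. \<psi> x * g x \<partial>(vmeas S b))"
  proof (rule integral_dominated_convergence[where w = "\<lambda>x. \<bar>\<psi> x * g x\<bar>"])
    show "(\<lambda>x. \<psi> x * (\<phi> n x * g x)) \<in> borel_measurable (vmeas S b)" for n
      using L2_mult_integrable[OF \<psi>(1) \<phi>gL] by (rule borel_measurable_integrable)
    show "AE x in vmeas S b. (\<lambda>n. \<psi> x * (\<phi> n x * g x)) \<longlonglongrightarrow> \<psi> x * g x"
      using AE_not_in[OF B(3)]
    proof eventually_elim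
      case (elim x)
      have "(\<lambda>n. \<psi> x * (\<phi> n x * g x)) \<longlonglongrightarrow> \<psi> x * (1 * g x)" by (intro tendsto_intros \<phi>(4) elim)
      then show ?case by simp
    qed
    show "AE x in vmeas S b. norm (\<psi> x * (\<phi> n x * g x)) \<le> \<bar>\<psi> x * g x\<bar>" for n
    proof (rule AE_I2)
      fix x
      have "\<phi> n x * \<bar>g x\<bar> \<le> 1 * \<bar>g x\<bar>" by (intro mult_right_mono \<phi>(3)) simp
      then show "norm (\<psi> x * (\<phi> n x * g x)) \<le> \<bar>\<psi> x * g x\<bar>"
        using \<phi>(2)[of n x] by (simp add: abs_mult mult_left_mono)
    qed
  qed (use i in auto)
  moreover have "(\<integral>x. \<psi> x * (\<phi> n x * g x) \<partial>(vmeas S b)) = 0" for n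
    using \<psi>(2)[OF \<phi>g[of n]] by (simp add: l2_inner_def)
  ultimately show ?thesis by (simp add: l2_inner_def LIMSEQ_const_iff)
qed

text \<open>\<open>adj\<close> selects some representative for \<open>b\<close>, not necessarily the
  zero function. It is orthogonal to all core functions vanishing on \<open>B\<close>, which forces
  its product with every core function to be zero. For empty \<open>B\<close> both sides are
  zero.\<close>

lemma normal_part_generator:
  assumes B: "closed B" "B \<in> null_sets (vmeas S b)" and b: "b \<in> ker_adj S B" and g: "g \<in> core S"
  shows "normal_part S b B b g = inner b (partial S g)"
proof (cases "B = {}")
  case True
  then show ?thesis using b g by (simp add: normal_part_def ker_adj_def core_off_def)
next
  case False
  have "is_adj S b B b (\<lambda>x. 0)" using b by (simp add: is_adj_def ker_adj_def L2_def l2_inner_def)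
  then have a: "is_adj S b B b (adj S b B b)" unfolding adj_def by (rule someI[of "is_adj S b B b"])
  have "l2_inner (vmeas S b) (adj S b B b) g = 0"
    by (rule l2_inner_eq_zero_of_core_off[OF B(1) False B(2) _ _ g])
       (use a b in \<open>auto simp: is_adj_def ker_adj_def\<close>)
  then show ?thesis using False by (simp add: normal_part_def)
qed

section \<open>Expansion of the two scalar products\<close>

text \<open>The other scalar product arises by exchanging the indices. The last term stems from the
  weak formulation for \<open>u2\<close> and is cancelled by the first term of the exchanged
  identity.\<close>

lemma l2_inner_perp_canonical:
  assumes dim: "has_martingale_dimension S 1" and b: "minimal_energy_dominant S (vmeas S b)"
    and f: "f2 \<in> L2 (vmeas S b)"
    and r1: "canonical_rep S b B f1 g1 u1 w1" and r2: "canonical_rep S b B f2 g2 u2 w2"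
  shows "l2_inner (vmeas S b) (perp S b B f1) f2 =
     l2_inner (vmeas S b) (z_part S b B f1 g1) g2 + l2_inner (vmeas S b) (z_part S b B f1 g1) w2
     + inner (fld S g2 g1) b
     + (normal_part S b B (star S b f2) g1 - normal_part S b B b (\<lambda>x. g1 x * g2 x))
     - l2_inner (vmeas S b) (z_part S b B f2 g2) g1"
proof -
  define z where "z = z_part S b B f1 g1"
  define s where "s = star_inv S b (partial S g1)"
  define t where "t = star_inv S b (partial S u2)"
  let ?M = "vmeas S b"
  have g1: "g1 \<in> core S" and z: "z \<in> ker_perp S b" using r1 by (simp_all add: canonical_rep_def z_def)
  have g2: "g2 \<in> core S" and u2: "u2 \<in> core S" and w2: "w2 \<in> ker_perp S b"
    and f2: "AE x in ?M. f2 x = g2 x + t x + w2 x"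
    and ws: "weak_solution S b u2 (z_part S b B f2 g2)
       (\<lambda>\<phi>. normal_part S b B (star S b f2) \<phi> - normal_part S b B b (\<lambda>x. g2 x * \<phi> x))"
    using r2 by (simp_all add: canonical_rep_def t_def dom_laplacian_def)
  have s: "s \<in> L2 ?M" "star S b s = partial S g1" and t: "t \<in> L2 ?M" "star S b t = partial S u2"
    using star_inv_partial[OF dim b] g1 u2 by (simp_all add: s_def t_def)
  have zL: "z \<in> L2 ?M" and wL: "w2 \<in> L2 ?M" by (intro ker_perp_L2 z w2)+
  have gL: "g2 \<in> L2 ?M" by (intro Cc_L2 core_Cc g2)
  have D: "perp S b B f1 x = z x + s x" for x by (simp add: z_def s_def z_part_def)
  have "l2_inner ?M (perp S b B f1) f2 =
      (\<integral>x. z x * g2 x + z x * t x + z x * w2 x + s x * g2 x + s x * t x + s x * w2 x \<partial>?M)"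
    unfolding l2_inner_def
  proof (rule integral_cong_AE)
    show "(\<lambda>x. perp S b B f1 x * f2 x) \<in> borel_measurable ?M"
      unfolding D using zL s f by (auto simp: L2_def)
    show "(\<lambda>x. z x * g2 x + z x * t x + z x * w2 x + s x * g2 x + s x * t x + s x * w2 x) \<in> borel_measurable ?M"
      using zL s t wL gL by (auto simp: L2_def)
    show "AE x in ?M. perp S b B f1 x * f2 x =
       z x * g2 x + z x * t x + z x * w2 x + s x * g2 x + s x * t x + s x * w2 x"
      using f2 by eventually_elim (simp add: D algebra_simps)
  qed
  also have "\<dots> = l2_inner ?M z g2 + l2_inner ?M z t + l2_inner ?M z w2
      + l2_inner ?M s g2 + l2_inner ?M s t + l2_inner ?M s w2"
    using zL s(1) t(1) wL gL by (simp add: l2_inner_def L2_mult_integrable)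
  also have "l2_inner ?M z t = 0"
    using inner_star[OF zL t(1)] ker_perp_orthogonal[OF z u2] t(2) by simp
  also have "l2_inner ?M s w2 = 0"
    using inner_star[OF s(1) wL] ker_perp_orthogonal[OF w2 g1] s(2) by (simp add: inner_commute)
  \<comment> \<open>For continuous \<open>g2\<close>, \<open>star\<close> is multiplication by
    \<open>g2\<close>, which self-adjointness moves from \<open>b\<close> to the gradient of
    \<open>g1\<close>.\<close>
  also have "l2_inner ?M s g2 = inner (fld S g2 g1) b"
    using inner_star[OF s(1) gL] s(2) core_Cc[OF g2]
    by (simp add: star_Cc fld_eq_mop_partial g1 mop_selfadjoint)
  also have "l2_inner ?M s t = form S u2 g1"
    using inner_star[OF s(1) t(1)] s(2) t(2) inner_partial[OF u2 g1] by (simp add: inner_commute)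
  also have "form S u2 g1 = (normal_part S b B (star S b f2) g1 - normal_part S b B b (\<lambda>x. g1 x * g2 x))
     - l2_inner ?M (z_part S b B f2 g2) g1"
    using ws g1 by (simp add: weak_solution_def mult.commute)
  finally show ?thesis by (simp add: z_def)
qed

text \<open>The two expansions contain the normal part of \<open>b\<close> at the product of
  \<open>g1\<close> and \<open>g2\<close> twice with a minus sign; the Leibniz terms supply it once
  with a plus sign, which leaves a single one.\<close>

lemma integration_by_parts:
  assumes dim: "has_martingale_dimension S 1" and b: "minimal_energy_dominant S (vmeas S b)"
    and B: "closed B" "form_null_set S B" and k: "b \<in> ker_adj S B"
    and f: "f1 \<in> L2 (vmeas S b)" "f2 \<in> L2 (vmeas S b)"
    and r1: "canonical_rep S b B f1 g1 u1 w1" and r2: "canonical_rep S b B f2 g2 u2 w2"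
  shows "l2_inner (vmeas S b) (perp S b B f1) f2 + l2_inner (vmeas S b) f1 (perp S b B f2) =
     boundary_terms S b B f1 g1 w1 f2 g2 w2"
proof -
  have g: "g1 \<in> core S" "g2 \<in> core S" using r1 r2 by (simp_all add: canonical_rep_def)
  have "B \<in> null_sets (vmeas S b)"
    using B(2) b unfolding form_null_set_def minimal_energy_dominant_def absolutely_continuous_def by blast
  then have "normal_part S b B b (\<lambda>x. g1 x * g2 x) = inner (fld S g1 g2 + fld S g2 g1) b"
    using normal_part_generator[OF B(1) _ k core_mult[OF g]] by (simp add: partial_mult g inner_commute)
  then show ?thesis
    using l2_inner_perp_canonical[OF dim b f(2) r1 r2] l2_inner_perp_canonical[OF dim b f(1) r2 r1]
    by (simp add: boundary_terms_def l2_inner_def inner_add_left mult.commute)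
qed

end

theorem theorem8p11:
  fixes S :: "('a::{metric_space,second_countable_topology},
               'h::{real_inner,complete_space}) form_data"
    and B :: "'a set" and p :: 'a and b :: 'h
    and f1 f2 :: "'a \<Rightarrow> real"
  assumes "locally compact (UNIV :: 'a set)"
    and "first_order_structure S"
    and "has_martingale_dimension S 1"
    and "closed B" and "form_null_set S B"
    and "p \<notin> B" and "complete_form S p"
    and "b \<in> ker_adj S B" and "minimal_energy_dominant S (vmeas S b)"
    and "f1 \<in> perp_dom S b B" and "f2 \<in> perp_dom S b B"
  shows "(\<forall>g1 u1 w1 g2 u2 w2.
            canonical_rep S b B f1 g1 u1 w1 \<and> canonical_rep S b B f2 g2 u2 w2 \<longrightarrow>
            l2_inner (vmeas S b) (perp S b B f1) f2 + l2_inner (vmeas S b) f1 (perp S b B f2)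
              = normal_part S b B (star S b f1) g2 + normal_part S b B (star S b f2) g1
                - normal_part S b B b (\<lambda>x. g1 x * g2 x)
                + l2_inner (vmeas S b) w1 (z_part S b B f2 g2)
                + l2_inner (vmeas S b) (z_part S b B f1 g1) w2) \<and>
         (\<forall>g1 u1 w1 g2 u2 w2 g1' u1' w1' g2' u2' w2'.
            canonical_rep S b B f1 g1 u1 w1 \<and> canonical_rep S b B f2 g2 u2 w2 \<and>
            canonical_rep S b B f1 g1' u1' w1' \<and> canonical_rep S b B f2 g2' u2' w2' \<longrightarrow>
            boundary_terms S b B f1 g1 w1 f2 g2 w2 = boundary_terms S b B f1 g1' w1' f2 g2' w2')"
proof -
  \<comment> \<open>Completeness puts the function one into the core.\<close>
  interpret compact_form S
    using assms(2,7) by (simp add: compact_form_def complete_form_def)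
  have f: "f1 \<in> L2 (vmeas S b)" "f2 \<in> L2 (vmeas S b)" using assms(10,11) by (simp_all add: perp_dom_def)
  note parts = integration_by_parts[OF assms(3,9,4,5,8) f]
  show ?thesis
  proof (intro conjI allI impI; elim conjE)
    fix g1 u1 w1 g2 u2 w2
    assume "canonical_rep S b B f1 g1 u1 w1" "canonical_rep S b B f2 g2 u2 w2"
    from parts[OF this]
    show "l2_inner (vmeas S b) (perp S b B f1) f2 + l2_inner (vmeas S b) f1 (perp S b B f2)
              = normal_part S b B (star S b f1) g2 + normal_part S b B (star S b f2) g1
                - normal_part S b B b (\<lambda>x. g1 x * g2 x)
                + l2_inner (vmeas S b) w1 (z_part S b B f2 g2)
                + l2_inner (vmeas S b) (z_part S b B f1 g1) w2"
      unfolding boundary_terms_def .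
  next
    fix g1 u1 w1 g2 u2 w2 g1' u1' w1' g2' u2' w2'
    assume "canonical_rep S b B f1 g1 u1 w1" "canonical_rep S b B f2 g2 u2 w2"
      and "canonical_rep S b B f1 g1' u1' w1'" "canonical_rep S b B f2 g2' u2' w2'"
    \<comment> \<open>Both sides equal the left-hand side of the formula, in which no representation
      occurs.\<close>
    then show "boundary_terms S b B f1 g1 w1 f2 g2 w2 = boundary_terms S b B f1 g1' w1' f2 g2' w2'"
      using parts by metis
  qed
qed

end
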